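(* The class of ($n$-component, strictly hyperbolic) systems of conservation laws $u^i_t=(V^i(\mathbf u))_x$ possessing a third-order Hamiltonian formulation is invariant under reciprocal transformations. That is: suppose $u^i_t=(V^i(\mathbf u))_x$, $i=1,\dots,n$, is Hamiltonian with respect to some non-degenerate third-order Hamiltonian operator $P^{ij}=\partial_x(g^{ij}\partial_x+c^{ij}_ku^k_x)\partial_x$, and let $a_i,b_i,a,b,c,d$ be constants defining a reciprocal transformation $$d\tilde x=(a_iu^i+a)\,dx+(a_iV^i+b)\,dt,\qquad d\tilde t=(b_iu^i+c)\,dx+(b_iV^i+d)\,dt .$$ Then the transformed system $\tilde u^i_{\tilde t}=(\tilde V^i(\tilde{\mathbf u}))_{\tilde x}$ is Hamiltonian with respect to some non-degenerate third-order Hamiltonian operator of the same form $\partial_{\tilde x}(\tilde g^{ij}\partial_{\tilde x}+\tilde c^{ij}_k\tilde u^k_{\tilde x})\partial_{\tilde x}$ in the coordinates $\tilde u^i$.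
   Context: Summation over repeated indices is understood; a comma in a lower index denotes a partial derivative. Strict hyperbolicity: the eigenvalues of $(\partial V^i/\partial u^j)$ are real and distinct. Reciprocal transformation: the 1-forms $u^i\,dx+V^i\,dt$ (closed on solutions) are rewritten as $u^idx+V^idt=\tilde u^id\tilde x+\tilde V^id\tilde t$. Explicitly, with $\Delta=(a_ku^k+a)(b_kV^k+d)-(a_kV^k+b)(b_ku^k+c)$, $$\tilde u^i=\frac{u^i(b_kV^k+d)-V^i(b_ku^k+c)}{\Delta},\qquad \tilde V^i=\frac{V^i(a_ku^k+a)-u^i(a_kV^k+b)}{\Delta},$$ and the transformed system is $\tilde u^i_{\tilde t}=(\tilde V^i)_{\tilde x}$, with $\tilde V^i$ expressed as functions of $\tilde{\mathbf u}$. The transformation is assumed to be well defined: one works locally where $\Delta\ne0$ and the map $\mathbf u\mapsto\tilde{\mathbf u}$ is a local diffeomorphism. Third-order Hamiltonian operator: $g^{ij}(\mathbf u)$ is symmetric with $\det g^{ij}\neq0$, $g_{ij}$ is its inverse, $c_{ijk}=g_{iq}g_{jp}c^{pq}_k$; $P^{ij}=\partial_x(g^{ij}\partial_x+c^{ij}_ku^k_x)\partial_x$ is Hamiltonian (defines a skew-symmetric bracket $\{F,G\}=\int\frac{\delta F}{\delta u^i}P^{ij}\frac{\delta G}{\delta u^j}dx$ satisfying the Jacobi identity), which is known to be equivalent to $$g_{mp,k}=-c_{mpk}-c_{pmk},\quad c_{mpk}=-c_{mkp},\quad c_{mpk}+c_{pkm}+c_{kmp}=0,\quad c_{mpk,l}=-g^{sq}c_{sml}c_{qpk}.$$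 A system is Hamiltonian with respect to $P$ if $\mathbf u_t=(V(\mathbf u))_x=P\,\delta H/\delta\mathbf u$ for some functional $H=\int h\,dx$, possibly nonlocal: $h$ may depend on $x$, the potentials $b^i$ with $b^i_x=u^i$, and finitely many $x$-derivatives of $b^i$. *)

theory Defs
  imports "HOL-Analysis.Analysis"
begin

section \<open>Smooth functions of the field variables\<close>

fun differentiable_order_on ::
    "nat \<Rightarrow> 'a::real_normed_vector set \<Rightarrow> ('a \<Rightarrow> 'b::real_normed_vector) \<Rightarrow> bool" where
  "differentiable_order_on 0 S f \<longleftrightarrow> continuous_on S f"
| "differentiable_order_on (Suc m) S f \<longleftrightarrow>
     (\<forall>x\<in>S. f differentiable (at x)) \<and>
     (\<forall>v. differentiable_order_on m S (\<lambda>x. frechet_derivative f (at x) v))"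

definition smooth_on :: "'a::real_normed_vector set \<Rightarrow> ('a \<Rightarrow> 'b::real_normed_vector) \<Rightarrow> bool" where
  "smooth_on S f \<longleftrightarrow> (\<forall>m. differentiable_order_on m S f)"

definition diffeomorphism_on ::
    "'a::real_normed_vector set \<Rightarrow> 'b::real_normed_vector set \<Rightarrow> ('a \<Rightarrow> 'b) \<Rightarrow> ('b \<Rightarrow> 'a) \<Rightarrow> bool" where
  "diffeomorphism_on S T f f' \<longleftrightarrow>
     open S \<and> open T \<and> homeomorphism S T f f' \<and> smooth_on S f \<and> smooth_on T f'"

definition partial_u :: "'n::finite \<Rightarrow> (real^'n \<Rightarrow> real) \<Rightarrow> real^'n \<Rightarrow> real" where
  "partial_u k f u = frechet_derivative f (at u) (axis k 1)"

text \<open>The characteristic matrix, with entries the derivatives of the i-th component of V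
  along the j-th coordinate, has n distinct real eigenvalues.\<close>

definition strictly_hyperbolic_on :: "(real^'n::finite) set \<Rightarrow> (real^'n \<Rightarrow> real^'n) \<Rightarrow> bool" where
  "strictly_hyperbolic_on U V \<longleftrightarrow>
     (\<forall>u\<in>U. card {l::real. \<exists>v. v \<noteq> 0 \<and>
        matrix (frechet_derivative V (at u)) *v v = l *\<^sub>R v} = CARD('n))"

section \<open>Jets of the potentials\<close>

text \<open>A point \<open>(x, J)\<close> of the jet space consists of the independent variable and of the
  x-derivatives of the potentials: \<open>J 0\<close> is b, \<open>J 1\<close> is u (the x-derivative of b),
  \<open>J 2\<close> is the x-derivative of u, and so on.  The topology is the product topology; functions on
  it are always required to depend on finitely many of the \<open>J k\<close> only.\<close>

type_synonym 'n jet = "real \<times> (nat \<Rightarrow> real^'n)"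

definition jet_dom :: "(real^'n::finite) set \<Rightarrow> 'n jet set" where
  "jet_dom U = {z. snd z 1 \<in> U}"

definition jet_shift :: "nat \<Rightarrow> 'n::finite \<Rightarrow> 'n jet \<Rightarrow> real \<Rightarrow> 'n jet" where
  "jet_shift k i z s = (fst z, (snd z)(k := snd z k + s *\<^sub>R axis i 1))"

definition jet_dx :: "('n::finite jet \<Rightarrow> real) \<Rightarrow> 'n jet \<Rightarrow> real" where
  "jet_dx f z = deriv (\<lambda>s. f (s, snd z)) (fst z)"

definition jet_db :: "nat \<Rightarrow> 'n::finite \<Rightarrow> ('n jet \<Rightarrow> real) \<Rightarrow> 'n jet \<Rightarrow> real" where
  "jet_db k i f z = deriv (\<lambda>s. f (jet_shift k i z s)) 0"

definition jet_order_le :: "nat \<Rightarrow> 'n::finite jet set \<Rightarrow> ('n jet \<Rightarrow> real) \<Rightarrow> bool" where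
  "jet_order_le N S f \<longleftrightarrow>
     (\<forall>z\<in>S. \<forall>z'\<in>S. fst z = fst z' \<and> (\<forall>k\<le>N. snd z k = snd z' k) \<longrightarrow> f z = f z')"

fun jet_Ck :: "nat \<Rightarrow> 'n::finite jet set \<Rightarrow> ('n jet \<Rightarrow> real) \<Rightarrow> bool" where
  "jet_Ck 0 S f \<longleftrightarrow> continuous_on S f"
| "jet_Ck (Suc m) S f \<longleftrightarrow>
     (\<forall>z\<in>S. (\<lambda>s. f (s, snd z)) differentiable (at (fst z))) \<and> jet_Ck m S (jet_dx f) \<and>
     (\<forall>k i. (\<forall>z\<in>S. (\<lambda>s. f (jet_shift k i z s)) differentiable (at 0)) \<and> jet_Ck m S (jet_db k i f))"

text \<open>Smooth differential functions of finite order, on the open set \<open>S\<close>.\<close>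

definition differential_function_on :: "'n::finite jet set \<Rightarrow> ('n jet \<Rightarrow> real) \<Rightarrow> bool" where
  "differential_function_on S f \<longleftrightarrow> (\<exists>N. jet_order_le N S f) \<and> (\<forall>m. jet_Ck m S f)"

text \<open>The infinite sums below have only finitely many nonzero terms at each point of \<open>S\<close>
  when \<open>f\<close> is a differential function on the open set \<open>S\<close>.\<close>

definition total_dx :: "('n::finite jet \<Rightarrow> real) \<Rightarrow> 'n jet \<Rightarrow> real" where
  "total_dx f z = jet_dx f z + (\<Sum>k. \<Sum>i\<in>UNIV. jet_db k i f z * snd z (Suc k) $ i)"

text \<open>The variational derivative of the functional with density \<open>h\<close> with respect to the
  potential \<open>b\<close> (component i).\<close>

definition var_deriv_b :: "('n::finite jet \<Rightarrow> real) \<Rightarrow> 'n \<Rightarrow> 'n jet \<Rightarrow> real" where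
  "var_deriv_b h i z = (\<Sum>k. (-1) ^ k * (total_dx ^^ k) (jet_db k i h) z)"

section \<open>Third-order Hamiltonian operators\<close>

text \<open>Conventions: \<open>g u $ i $ j\<close> is \<open>g\<close> with upper indices i, j, and
  \<open>c u $ i $ j $ k\<close> is \<open>c\<close> with upper indices i, j and lower index k.\<close>

definition g_low :: "(real^'n::finite \<Rightarrow> real^'n^'n) \<Rightarrow> 'n \<Rightarrow> 'n \<Rightarrow> real^'n \<Rightarrow> real" where
  "g_low g i j u = matrix_inv (g u) $ i $ j"

definition c_low :: "(real^'n::finite \<Rightarrow> real^'n^'n) \<Rightarrow> (real^'n \<Rightarrow> real^'n^'n^'n) \<Rightarrow>
    'n \<Rightarrow> 'n \<Rightarrow> 'n \<Rightarrow> real^'n \<Rightarrow> real" where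
  "c_low g c i j k u = (\<Sum>p\<in>UNIV. \<Sum>q\<in>UNIV. g_low g i q u * g_low g j p u * c u $ p $ q $ k)"

text \<open>Non-degenerate operators \<open>D (g D + c u_x) D\<close> that are Hamiltonian, the latter expressed by
  the classical system of equations on the coefficients, equivalent to skew-symmetry and
  the Jacobi identity of the bracket.\<close>

definition third_order_hamiltonian_operator ::
    "(real^'n::finite) set \<Rightarrow> (real^'n \<Rightarrow> real^'n^'n) \<Rightarrow> (real^'n \<Rightarrow> real^'n^'n^'n) \<Rightarrow> bool" where
  "third_order_hamiltonian_operator U g c \<longleftrightarrow>
     smooth_on U g \<and> smooth_on U c \<and>
     (\<forall>u\<in>U.
        (\<forall>i j. g u $ i $ j = g u $ j $ i) \<and> det (g u) \<noteq> 0 \<and>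
        (\<forall>m p k. partial_u k (g_low g m p) u = - c_low g c m p k u - c_low g c p m k u) \<and>
        (\<forall>m p k. c_low g c m p k u = - c_low g c m k p u) \<and>
        (\<forall>m p k. c_low g c m p k u + c_low g c p k m u + c_low g c k m p u = 0) \<and>
        (\<forall>m p k l. partial_u l (c_low g c m p k) u =
           - (\<Sum>s\<in>UNIV. \<Sum>q\<in>UNIV. g u $ s $ q * c_low g c s m l u * c_low g c q p k u)))"

text \<open>The operator \<open>D (g D + c u_x)\<close>, applied to the tuple \<open>q\<close>.  The third-order operator
  applied to \<open>p\<close> is this operator applied to \<open>D p\<close>.\<close>

definition outer_op :: "(real^'n::finite \<Rightarrow> real^'n^'n) \<Rightarrow> (real^'n \<Rightarrow> real^'n^'n^'n) \<Rightarrow>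
    ('n \<Rightarrow> 'n jet \<Rightarrow> real) \<Rightarrow> 'n \<Rightarrow> 'n jet \<Rightarrow> real" where
  "outer_op g c q i =
     total_dx (\<lambda>z. \<Sum>j\<in>UNIV. g (snd z 1) $ i $ j * total_dx (q j) z
                   + (\<Sum>k\<in>UNIV. c (snd z 1) $ i $ j $ k * snd z 2 $ k) * q j z)"

text \<open>For a functional with density depending on the potentials, the variational derivative with
  respect to u is in general nonlocal and determined up to constants by
  \<open>D (\<delta>H/\<delta>u) = - \<delta>H/\<delta>b\<close>, because \<open>u = D b\<close>.  The third-order
  operator involves only \<open>D (\<delta>H/\<delta>u)\<close>, hence the tuple \<open>- \<delta>H/\<delta>b\<close> below.\<close>

definition hamiltonian_system_wrt ::
    "(real^'n::finite) set \<Rightarrow> (real^'n \<Rightarrow> real^'n) \<Rightarrow>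
     (real^'n \<Rightarrow> real^'n^'n) \<Rightarrow> (real^'n \<Rightarrow> real^'n^'n^'n) \<Rightarrow> bool" where
  "hamiltonian_system_wrt U V g c \<longleftrightarrow>
     (\<exists>h. differential_function_on (jet_dom U) h \<and>
        (\<forall>z\<in>jet_dom U. \<forall>i.
           total_dx (\<lambda>z. V (snd z 1) $ i) z = outer_op g c (\<lambda>j z. - var_deriv_b h j z) i z))"

section \<open>Reciprocal transformations\<close>

text \<open>The transformation with differentials \<open>(\<alpha> u + a) dx + (\<alpha> V + b) dt\<close> and
  \<open>(\<beta> u + c) dx + (\<beta> V + d) dt\<close>.\<close>

definition recip_delta :: "real^'n::finite \<Rightarrow> real^'n \<Rightarrow> real \<Rightarrow> real \<Rightarrow> real \<Rightarrow> real \<Rightarrow>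
    (real^'n \<Rightarrow> real^'n) \<Rightarrow> real^'n \<Rightarrow> real" where
  "recip_delta \<alpha> \<beta> a b c d V u =
     (\<alpha> \<bullet> u + a) * (\<beta> \<bullet> V u + d) - (\<alpha> \<bullet> V u + b) * (\<beta> \<bullet> u + c)"

definition recip_u :: "real^'n::finite \<Rightarrow> real^'n \<Rightarrow> real \<Rightarrow> real \<Rightarrow> real \<Rightarrow> real \<Rightarrow>
    (real^'n \<Rightarrow> real^'n) \<Rightarrow> real^'n \<Rightarrow> real^'n" where
  "recip_u \<alpha> \<beta> a b c d V u =
     (1 / recip_delta \<alpha> \<beta> a b c d V u) *\<^sub>R ((\<beta> \<bullet> V u + d) *\<^sub>R u - (\<beta> \<bullet> u + c) *\<^sub>R V u)"

definition recip_flux :: "real^'n::finite \<Rightarrow> real^'n \<Rightarrow> real \<Rightarrow> real \<Rightarrow> real \<Rightarrow> real \<Rightarrow>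
    (real^'n \<Rightarrow> real^'n) \<Rightarrow> real^'n \<Rightarrow> real^'n" where
  "recip_flux \<alpha> \<beta> a b c d V u =
     (1 / recip_delta \<alpha> \<beta> a b c d V u) *\<^sub>R ((\<alpha> \<bullet> u + a) *\<^sub>R V u - (\<alpha> \<bullet> V u + b) *\<^sub>R u)"

end

theory Submission
  imports Defs
begin

text \<open>
  A solution of the system is a surface in the space of \<open>(b, x, t)\<close>, with tangent planes spanned by
  \<open>p = (u, 1, 0)\<close> and \<open>q = (V, 0, 1)\<close>, and reciprocal transformations are linear changes of
  \<open>(b, x, t)\<close>.  It therefore suffices to describe the Hamiltonian property by linear algebra
  in this space.  The system is Hamiltonian if and only if there are a vector-valued alternating
  form \<open>A\<close> and a nondegenerate symmetric form \<open>B\<close> such that \<open>A(p, q) = 0\<close> on \<open>U\<close> (the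
  planes form a linear line congruence), such that the 4-form \<open>B(A \<and> A)\<close> vanishes, and such that
  \<open>y \<mapsto> A(p, y)\<close> is bijective.

  Given the operator, the classical equations imply that \<open>c\<^sub>m\<^sub>p\<^sub>k\<close> is affine in \<open>u\<close> and that \<open>g\<^sub>i\<^sub>j\<close>
  is the Gram matrix, with respect to \<open>B\<close>, of a frame affine in \<open>u\<close>.  In this frame the
  Hamiltonian equation reads \<open>D w = F(u)\<close>, so that \<open>w\<close> is affine in \<open>(b, x)\<close> and \<open>F\<close> is affine in \<open>u\<close>;
  the Helmholtz conditions for \<open>\<delta>H/\<delta>b\<close> are the remaining components of \<open>B(A \<and> A) = 0\<close>.
  Conversely, \<open>h = - B(A(X, X'), A(X, T)) / 3\<close> with \<open>X = (b, x, 0)\<close>, \<open>X' = (u, 1, 0)\<close>, \<open>T = (0, 0, 1)\<close>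
  is a Hamiltonian density.
\<close>

section \<open>Smooth functions\<close>

text \<open>The definition of a Hamiltonian system singles out \<open>x\<close>: the operator, the
  density and \<open>total_dx\<close> live on jets in \<open>x\<close>, and a change that mixes
  \<open>x\<close> and \<open>t\<close> does not act on them. The congruence removes this asymmetry
  except in its last condition, bijectivity of \<open>y \<mapsto> A(p, y)\<close>, which
  distinguishes \<open>p\<close>. Only this condition takes work under a reciprocal transformation:
  it comes from differentiating \<open>A(p, q) = 0\<close> along \<open>U\<close> and from the
  invertible derivative of the coordinate change. The form \<open>B\<close> is kept and
  \<open>A\<close> is composed with the inverse of the linear change, whose existence is forced by
  openness of \<open>W\<close>. The new metric is never computed from the old one; it is rebuilt
  from the new pair of forms. Connectedness of \<open>U\<close> enters on the way to the congruence,
  where vanishing derivatives have to give constants. One of these, \<kappa>, is left over by the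
  outer \<open>D\<close> of the operator; it shifts \<open>V\<close> and is absorbed by the shear
  \<open>b \<mapsto> b - t \<kappa>\<close>.\<close>

lemma differentiable_cong_open:
  assumes "open S" "x \<in> S" "\<And>y. y \<in> S \<Longrightarrow> f y = h y"
  shows "f differentiable (at x) \<longleftrightarrow> h differentiable (at x)"
proof -
  have "(f has_derivative D) (at x) \<longleftrightarrow> (h has_derivative D) (at x)" for D
    using has_derivative_transform_within_open[OF _ assms(1,2), of f D UNIV h]
      has_derivative_transform_within_open[OF _ assms(1,2), of h D UNIV f] assms(3)
    by auto
  then show ?thesis by (simp add: differentiable_def)
qed

lemma frechet_derivative_cong_open:
  assumes "open S" "x \<in> S" "\<And>y. y \<in> S \<Longrightarrow> f y = h y"
  shows "frechet_derivative f (at x) = frechet_derivative h (at x)"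
proof -
  have "(f has_derivative D) (at x) \<longleftrightarrow> (h has_derivative D) (at x)" for D
    using has_derivative_transform_within_open[OF _ assms(1,2), of f D UNIV h]
      has_derivative_transform_within_open[OF _ assms(1,2), of h D UNIV f] assms(3)
    by auto
  then show ?thesis by (simp add: frechet_derivative_def)
qed

lemma differentiable_order_on_cong:
  assumes "open S" "\<And>y. y \<in> S \<Longrightarrow> f y = h y"
  shows "differentiable_order_on m S f \<longleftrightarrow> differentiable_order_on m S h"
  using assms(2)
proof (induction m arbitrary: f h)
  case 0
  then show ?case by (simp cong: continuous_on_cong)
next
  case (Suc m)
  have "differentiable_order_on m S (\<lambda>x. frechet_derivative f (at x) v) \<longleftrightarrow>
     differentiable_order_on m S (\<lambda>x. frechet_derivative h (at x) v)" for v
  proof (rule Suc.IH)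
    fix y assume "y \<in> S"
    from frechet_derivative_cong_open[OF assms(1) this, of f h] Suc.prems
    show "frechet_derivative f (at y) v = frechet_derivative h (at y) v" by simp
  qed
  moreover have "(\<forall>x\<in>S. f differentiable (at x)) \<longleftrightarrow> (\<forall>x\<in>S. h differentiable (at x))"
    using differentiable_cong_open[OF assms(1), of _ f h] Suc.prems by blast
  ultimately show ?case by simp
qed

lemma smooth_on_cong:
  assumes "open S" "\<And>y. y \<in> S \<Longrightarrow> f y = h y"
  shows "smooth_on S f \<longleftrightarrow> smooth_on S h"
  using differentiable_order_on_cong[OF assms] by (simp add: smooth_on_def)

lemma smooth_on_imp_differentiable:
  "smooth_on S f \<Longrightarrow> x \<in> S \<Longrightarrow> f differentiable (at x)"
  unfolding smooth_on_def by (metis differentiable_order_on.simps(2))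

lemma smooth_on_imp_continuous_on: "smooth_on S f \<Longrightarrow> continuous_on S f"
  unfolding smooth_on_def by (metis differentiable_order_on.simps(1))

lemma smooth_on_frechet_derivative:
  "smooth_on S f \<Longrightarrow> smooth_on S (\<lambda>x. frechet_derivative f (at x) v)"
  unfolding smooth_on_def by (metis differentiable_order_on.simps(2))

lemma smooth_on_const: "smooth_on S (\<lambda>x. k)"
proof -
  have "differentiable_order_on m S (\<lambda>x. k)" for m and k :: 'b
    by (induction m arbitrary: k) auto
  then show ?thesis by (simp add: smooth_on_def)
qed

lemma smooth_on_bounded_linear:
  assumes "bounded_linear L"
  shows "smooth_on S L"
proof -
  interpret bounded_linear L by fact
  have "frechet_derivative L (at x) = L" for x
    using bounded_linear_imp_has_derivative[OF assms] frechet_derivative_at by metis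
  moreover have "L differentiable (at x)" for x
    using bounded_linear_imp_has_derivative[OF assms] differentiable_def by blast
  moreover have "continuous_on S L"
    using bounded_linear_imp_has_derivative[OF assms]
    by (auto intro!: has_derivative_continuous_on)
  ultimately have "differentiable_order_on m S L" for m
    using smooth_on_const[of S] by (cases m) (auto simp: smooth_on_def)
  then show ?thesis by (simp add: smooth_on_def)
qed

lemma differentiable_order_on_add:
  assumes "open S" "differentiable_order_on m S f" "differentiable_order_on m S h"
  shows "differentiable_order_on m S (\<lambda>x. f x + h x)"
  using assms(2,3)
proof (induction m arbitrary: f h)
  case 0
  then show ?case by (auto intro: continuous_on_add)
next
  case (Suc m)
  have D: "((\<lambda>x. f x + h x) has_derivative
      (\<lambda>v. frechet_derivative f (at y) v + frechet_derivative h (at y) v)) (at y)"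
    if "y \<in> S" for y
    using Suc.prems that by (intro has_derivative_add) (auto simp: frechet_derivative_works[symmetric])
  have D': "differentiable_order_on m S (\<lambda>x. frechet_derivative (\<lambda>x. f x + h x) (at x) v)" for v
  proof (subst differentiable_order_on_cong[OF assms(1)])
    fix y assume "y \<in> S"
    then show "frechet_derivative (\<lambda>x. f x + h x) (at y) v =
        frechet_derivative f (at y) v + frechet_derivative h (at y) v"
      by (simp add: frechet_derivative_at[OF D, symmetric])
  next
    show "differentiable_order_on m S
        (\<lambda>y. frechet_derivative f (at y) v + frechet_derivative h (at y) v)"
      using Suc.prems by (intro Suc.IH) auto
  qed
  have "\<forall>y\<in>S. (\<lambda>x. f x + h x) differentiable (at y)"
    using D unfolding differentiable_def by blast
  with D' show ?case by simp
qed

lemma smooth_on_add: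
  "open S \<Longrightarrow> smooth_on S f \<Longrightarrow> smooth_on S h \<Longrightarrow> smooth_on S (\<lambda>x. f x + h x)"
  unfolding smooth_on_def using differentiable_order_on_add by blast

lemma smooth_on_sum:
  assumes "open S" "\<And>i. i \<in> I \<Longrightarrow> smooth_on S (f i)"
  shows "smooth_on S (\<lambda>x. \<Sum>i\<in>I. f i x)"
  using assms(2)
proof (induction I rule: infinite_finite_induct)
  case (insert j I)
  then have "smooth_on S (\<lambda>x. f j x + (\<Sum>i\<in>I. f i x))"
    by (intro smooth_on_add[OF assms(1)]) auto
  with insert show ?case by simp
qed (simp_all add: smooth_on_const)

text \<open>Both factors stay fully smooth during the induction over the order. The product rule
  yields two products of the same shape, and full smoothness passes to derivatives, so no orders
  have to be balanced between the factors.\<close>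

lemma (in bounded_bilinear) smooth_on_prod:
  assumes "open S" "smooth_on S f" "smooth_on S h"
  shows "smooth_on S (\<lambda>x. prod (f x) (h x))"
proof -
  have "differentiable_order_on m S (\<lambda>x. prod (f x) (h x))"
    if "smooth_on S f" "smooth_on S h" for m and f :: "'d::real_normed_vector \<Rightarrow> 'a" and h
    using that(1,2) \<open>open S\<close>
  proof (induction m arbitrary: f h)
    case 0
    then show ?case by (simp add: continuous_on smooth_on_imp_continuous_on)
  next
    case (Suc m)
    have D: "((\<lambda>x. prod (f x) (h x)) has_derivative
       (\<lambda>v. prod (f y) (frechet_derivative h (at y) v) + prod (frechet_derivative f (at y) v) (h y))) (at y)"
      if "y \<in> S" for y
      using Suc.prems that
      by (intro FDERIV) (auto simp: frechet_derivative_works[symmetric] dest: smooth_on_imp_differentiable)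
    have D': "differentiable_order_on m S (\<lambda>x. frechet_derivative (\<lambda>x. prod (f x) (h x)) (at x) v)" for v
    proof (subst differentiable_order_on_cong[OF \<open>open S\<close>])
      fix y assume "y \<in> S"
      then show "frechet_derivative (\<lambda>x. prod (f x) (h x)) (at y) v =
          prod (f y) (frechet_derivative h (at y) v) + prod (frechet_derivative f (at y) v) (h y)"
        by (simp add: frechet_derivative_at[OF D, symmetric])
    next
      show "differentiable_order_on m S (\<lambda>x. prod (f x) (frechet_derivative h (at x) v) + prod (frechet_derivative f (at x) v) (h x))"
        by (intro differentiable_order_on_add Suc.IH smooth_on_frechet_derivative Suc.prems)
    qed
    have "\<forall>y\<in>S. (\<lambda>x. prod (f x) (h x)) differentiable (at y)"
      using D unfolding differentiable_def by blast
    with D' show ?case by simp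
  qed
  then show ?thesis using assms by (simp add: smooth_on_def)
qed

lemmas smooth_on_mult = bounded_bilinear.smooth_on_prod[OF bounded_bilinear_mult]
lemmas smooth_on_scaleR = bounded_bilinear.smooth_on_prod[OF bounded_bilinear_scaleR]

text \<open>A case of the product rule: \<open>L (f x)\<close> is the bilinear map
  \<open>t *\<^sub>R L x\<close> applied to the constant 1 and to \<open>f\<close>.\<close>

lemma smooth_on_linear_comp:
  assumes "open S" "bounded_linear L" "smooth_on S f"
  shows "smooth_on S (\<lambda>x. L (f x))"
proof -
  interpret P: bounded_bilinear "\<lambda>t x. t *\<^sub>R L x"
    using bounded_bilinear.comp[OF bounded_bilinear_scaleR bounded_linear_ident assms(2)] .
  have "smooth_on S (\<lambda>x. 1 *\<^sub>R L (f x))"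
    by (rule P.smooth_on_prod[OF assms(1) smooth_on_const assms(3)])
  then show ?thesis by simp
qed

lemma smooth_on_diff:
  assumes "open S" "smooth_on S f" "smooth_on S h"
  shows "smooth_on S (\<lambda>x. f x - h x)"
  using smooth_on_add[OF assms(1,2) smooth_on_linear_comp[OF assms(1) bounded_linear_minus[OF bounded_linear_ident] assms(3)]]
  by simp

lemma smooth_on_prod_index:
  assumes "open S" "\<And>i. i \<in> I \<Longrightarrow> smooth_on S (f i :: _ \<Rightarrow> real)"
  shows "smooth_on S (\<lambda>x. \<Prod>i\<in>I. f i x)"
  using assms(2)
proof (induction I rule: infinite_finite_induct)
  case (insert j I)
  then have "smooth_on S (\<lambda>x. f j x * (\<Prod>i\<in>I. f i x))"
    by (intro smooth_on_mult[OF assms(1)]) auto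
  with insert show ?case by simp
qed (simp_all add: smooth_on_const)

lemma smooth_on_inverse:
  fixes f :: "'a::real_normed_vector \<Rightarrow> real"
  assumes "open S" "smooth_on S f" "\<And>x. x \<in> S \<Longrightarrow> f x \<noteq> 0"
  shows "smooth_on S (\<lambda>x. inverse (f x))"
proof -
  have D: "((\<lambda>x. inverse (f x)) has_derivative
      (\<lambda>v. - (inverse (f y) * frechet_derivative f (at y) v * inverse (f y)))) (at y)" if "y \<in> S" for y
  proof -
    have "(f has_derivative frechet_derivative f (at y)) (at y)"
      using smooth_on_imp_differentiable[OF assms(2) that] by (simp add: frechet_derivative_works)
    then show ?thesis by (rule Deriv.has_derivative_inverse[of f, OF assms(3)[OF that]])
  qed
  \<comment> \<open>Inverses alone are not closed under differentiation; the expressions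
    \<open>inverse (f x) ^ k * h x\<close> with smooth \<open>h\<close> are, up to sums. Hence
    \<open>k\<close> and \<open>h\<close> vary in the induction.\<close>
  have "differentiable_order_on m S (\<lambda>x. inverse (f x) ^ k * h x)" if "smooth_on S h" for m k h
    using that
  proof (induction m arbitrary: h k)
    case 0
    have "continuous_on S (\<lambda>x. inverse (f x) ^ k * h x)"
      using smooth_on_imp_continuous_on[OF assms(2)] smooth_on_imp_continuous_on[OF 0] assms(3)
      by (intro continuous_on_mult continuous_on_power continuous_on_inverse) auto
    then show ?case by simp
  next
    case (Suc m)
    let ?D = "\<lambda>y v. inverse (f y) ^ k * frechet_derivative h (at y) v +
            inverse (f y) ^ Suc k * ((- real k) * (frechet_derivative f (at y) v * h y))"
    have D2: "((\<lambda>x. inverse (f x) ^ k * h x) has_derivative ?D y) (at y)" if "y \<in> S" for y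
    proof -
      have "(h has_derivative frechet_derivative h (at y)) (at y)"
        using smooth_on_imp_differentiable[OF Suc.prems that] by (simp add: frechet_derivative_works)
      from has_derivative_mult[OF has_derivative_power[OF D[OF that], of k] this]
      show ?thesis
        by (rule has_derivative_eq_rhs) (cases k; simp add: fun_eq_iff algebra_simps)
    qed
    have "\<forall>y\<in>S. (\<lambda>x. inverse (f x) ^ k * h x) differentiable (at y)"
      using D2 unfolding differentiable_def by blast
    moreover have "differentiable_order_on m S
        (\<lambda>x. frechet_derivative (\<lambda>x. inverse (f x) ^ k * h x) (at x) v)" for v
    proof (subst differentiable_order_on_cong[OF \<open>open S\<close>])
      fix y assume "y \<in> S"
      then show "frechet_derivative (\<lambda>x. inverse (f x) ^ k * h x) (at y) v = ?D y v"
        using fun_cong[OF frechet_derivative_at[OF D2], of y v] by simp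
    next
      show "differentiable_order_on m S (\<lambda>y. ?D y v)"
        by (intro differentiable_order_on_add[OF \<open>open S\<close>] Suc.IH smooth_on_mult[OF \<open>open S\<close>]
            smooth_on_const smooth_on_frechet_derivative assms(2) Suc.prems)
    qed
    ultimately show ?case by simp
  qed
  from this[OF smooth_on_const, of _ 1 1] show ?thesis by (simp add: smooth_on_def)
qed

lemma smooth_on_vec_nth_iff:
  fixes f :: "'a::real_normed_vector \<Rightarrow> 'b::real_normed_vector ^ 'n"
  assumes "open S"
  shows "smooth_on S f \<longleftrightarrow> (\<forall>i. smooth_on S (\<lambda>x. f x $ i))"
proof
  assume "smooth_on S f"
  then show "\<forall>i. smooth_on S (\<lambda>x. f x $ i)"
    using smooth_on_linear_comp[OF assms bounded_linear_vec_nth] by blast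
next
  assume *: "\<forall>i. smooth_on S (\<lambda>x. f x $ i)"
  have lin: "bounded_linear (\<lambda>v. (axis i v :: 'b^'n))" for i
  proof (rule bounded_linear_intro[where K=1])
    have "norm (axis i x $ j) = (if j = i then norm x else 0)" for x :: 'b and j
      by (simp add: axis_def)
    then show "norm (axis i x :: 'b^'n) \<le> norm x * 1" for x
      by (simp add: norm_vec_def L2_set_def if_distrib[of "\<lambda>t. t\<^sup>2"] cong: if_cong)
  qed (auto simp: axis_def vec_eq_iff)
  have "f x = (\<Sum>i\<in>UNIV. axis i (f x $ i))" for x
    by (simp add: vec_eq_iff axis_def if_distrib [of "\<lambda>x. x $ _"] sum.delta cong: if_cong)
  moreover have "smooth_on S (\<lambda>x. \<Sum>i\<in>UNIV. axis i (f x $ i))"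
    using * by (intro smooth_on_sum smooth_on_linear_comp[OF assms lin] assms) auto
  ultimately show "smooth_on S f" by (metis (no_types, lifting) ext)
qed

lemma smooth_on_vec2:
  fixes g :: "'a::real_normed_vector \<Rightarrow> real^'m^'n"
  assumes "open U" "smooth_on U g"
  shows "smooth_on U (\<lambda>u. g u $ i $ j)"
proof -
  have "smooth_on U (\<lambda>u. g u $ i)" using iffD1[OF smooth_on_vec_nth_iff[OF assms(1)] assms(2)] by blast
  from iffD1[OF smooth_on_vec_nth_iff[OF assms(1)] this] show ?thesis by blast
qed

lemma smooth_on_vec3:
  fixes g :: "'a::real_normed_vector \<Rightarrow> real^'k^'m^'n"
  assumes "open U" "smooth_on U g"
  shows "smooth_on U (\<lambda>u. g u $ i $ j $ k)"
proof -
  have "smooth_on U (\<lambda>u. g u $ i)" using iffD1[OF smooth_on_vec_nth_iff[OF assms(1)] assms(2)] by blast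
  from smooth_on_vec2[OF assms(1) this] show ?thesis .
qed

lemma smooth_on_det:
  fixes M :: "'a::real_normed_vector \<Rightarrow> real^'n^'n"
  assumes "open S" "\<And>i j. smooth_on S (\<lambda>x. M x $ i $ j)"
  shows "smooth_on S (\<lambda>x. det (M x))"
  unfolding det_def
  by (intro smooth_on_sum smooth_on_mult smooth_on_prod_index smooth_on_const assms)

lemma matrix_inv_inverse:
  fixes M :: "real^'n^'n"
  assumes "det M \<noteq> 0"
  shows "M ** matrix_inv M = mat 1" "matrix_inv M ** M = mat 1"
proof -
  have "\<exists>N. M ** N = mat 1 \<and> N ** M = mat 1"
    using assms invertible_det_nz invertible_def by blast
  then have "M ** matrix_inv M = mat 1 \<and> matrix_inv M ** M = mat 1"
    unfolding matrix_inv_def by (rule someI_ex)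
  then show "M ** matrix_inv M = mat 1" "matrix_inv M ** M = mat 1" by auto
qed

text \<open>Cramer's rule for \<open>M *v y = axis l 1\<close>. It exhibits the entries of the
  inverse as quotients of determinants, from which their smoothness follows.\<close>

lemma matrix_inv_cramer:
  fixes M :: "real^'n^'n"
  assumes "det M \<noteq> 0"
  shows "matrix_inv M $ k $ l = det (\<chi> i j. if j = k then axis l 1 $ i else M $ i $ j) / det M"
proof -
  have "M *v (matrix_inv M *v axis l 1) = axis l 1"
    by (simp add: matrix_vector_mul_assoc matrix_inv_inverse assms)
  then have "matrix_inv M *v axis l 1 = (\<chi> k. det(\<chi> i j. if j=k then axis l 1 $ i else M$i$j) / det M)"
    using cramer[OF assms] by blast
  then have "(matrix_inv M *v axis l 1) $ k = det(\<chi> i j. if j=k then axis l 1 $ i else M$i$j) / det M"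
    by simp
  then show ?thesis by (simp add: matrix_vector_mul_component inner_axis)
qed

lemma smooth_on_matrix_inv:
  fixes M :: "'a::real_normed_vector \<Rightarrow> real^'n^'n"
  assumes "open S" "\<And>i j. smooth_on S (\<lambda>x. M x $ i $ j)" "\<And>x. x \<in> S \<Longrightarrow> det (M x) \<noteq> 0"
  shows "smooth_on S (\<lambda>x. matrix_inv (M x) $ k $ l)"
proof -
  have *: "smooth_on S (\<lambda>x. (\<chi> i j. if j = k then axis l 1 $ i else M x $ i $ j) $ i $ j)" for i j
    using assms(2) smooth_on_const[of S] by (cases "j = k") auto
  have "smooth_on S (\<lambda>x. det (\<chi> i j. if j = k then axis l 1 $ i else M x $ i $ j) * inverse (det (M x)))"
    by (intro smooth_on_mult smooth_on_det smooth_on_inverse assms * )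
  then show ?thesis
    by (subst smooth_on_cong[OF assms(1)]) (auto simp: matrix_inv_cramer assms(3) field_simps)
qed

section \<open>Differential functions\<close>

text \<open>One index type covers all coordinate directions: \<open>None\<close> is the independent
  variable, \<open>Some (k, i)\<close> is component \<open>i\<close> of the \<open>k\<close>-th jet
  variable. Every rule then has one proof instead of one for \<open>jet_dx\<close> and one for
  \<open>jet_db\<close>.\<close>

fun jet_move :: "(nat \<times> 'n::finite) option \<Rightarrow> 'n jet \<Rightarrow> real \<Rightarrow> 'n jet" where
  "jet_move None z s = (fst z + s, snd z)"
| "jet_move (Some (k, i)) z s = jet_shift k i z s"

definition jet_d :: "(nat \<times> 'n::finite) option \<Rightarrow> ('n jet \<Rightarrow> real) \<Rightarrow> 'n jet \<Rightarrow> real" where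
  "jet_d e f z = deriv (\<lambda>s. f (jet_move e z s)) 0"

lemma deriv_shift_real:
  fixes f :: "real \<Rightarrow> real"
  shows "(f has_real_derivative D) (at (a + b)) \<longleftrightarrow> ((\<lambda>s. f (a + s)) has_real_derivative D) (at b)"
  using DERIV_shift[of f D b a] by (simp add: add.commute)

lemma jet_db_eq: "jet_db k i f = jet_d (Some (k, i)) f"
  by (simp add: fun_eq_iff jet_db_def jet_d_def)

lemma jet_dx_eq: "jet_dx f = jet_d None f"
proof
  fix z
  show "jet_dx f z = jet_d None f z"
    using deriv_shift_real[of "\<lambda>s. f (s, snd z)" _ "fst z" 0]
    by (simp add: jet_dx_def jet_d_def deriv_def)
qed

lemma jet_move_0 [simp]: "jet_move e z 0 = z"
  by (cases e; cases z) (auto simp: jet_shift_def split: prod.splits)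

lemma jet_move_add: "jet_move e (jet_move e z s) t = jet_move e z (s + t)"
  by (cases e) (auto simp: jet_shift_def scaleR_left_distrib add.assoc)

lemma jet_move_commute: "jet_move e (jet_move e' z s) t = jet_move e' (jet_move e z t) s"
  by (cases e; cases e') (auto simp: jet_shift_def fun_eq_iff add.assoc add.commute)

lemma jet_move_other:
  "\<forall>i. e \<noteq> Some (k, i) \<Longrightarrow> snd (jet_move e z s) k = snd z k"
  by (cases e) (auto simp: jet_shift_def)

lemma fst_jet_move: "fst (jet_move e z s) = (if e = None then fst z + s else fst z)"
  by (cases e) (auto simp: jet_shift_def)

lemma snd_jet_move_nth:
  "snd (jet_move e z s) k $ i = snd z k $ i + (if e = Some (k, i) then s else 0)"
  by (cases e) (auto simp: jet_shift_def axis_def split: if_splits)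

lemma continuous_on_jet_move:
  assumes "continuous_on A h" "continuous_on A f"
  shows "continuous_on A (\<lambda>x. jet_move e (h x) (f x))"
proof -
  have co: "continuous_on A (\<lambda>x. snd (h x) l)" for l
    using continuous_on_compose2[OF continuous_on_product_coordinates[of l] continuous_on_snd[OF assms(1)]]
    by simp
  show ?thesis
  proof (cases e)
    case None
    have "continuous_on A (\<lambda>x. snd (h x))" by (rule continuous_on_snd[OF assms(1)])
    with None show ?thesis using assms
      by (auto intro!: continuous_on_Pair continuous_on_add continuous_on_fst)
  next
    case (Some p)
    obtain k i where p: "p = (k, i)" by force
    have "continuous_on A (\<lambda>x. ((snd (h x))(k := snd (h x) k + f x *\<^sub>R axis i 1)) l)" for l
      using co assms(2) by (cases "l = k") (auto intro!: continuous_intros)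
    then have "continuous_on A (\<lambda>x. (snd (h x))(k := snd (h x) k + f x *\<^sub>R axis i 1))"
      by (intro continuous_on_coordinatewise_then_product) simp
    then show ?thesis using assms(1) Some p
      by (auto simp: jet_shift_def intro!: continuous_intros)
  qed
qed

lemma continuous_on_jet_coord: "continuous_on S (\<lambda>z::'n::finite jet. snd z k)"
  using continuous_on_compose2[OF continuous_on_product_coordinates[of k] continuous_on_snd[OF continuous_on_id]]
  by auto

lemma open_jet_dom: "open U \<Longrightarrow> open (jet_dom U)"
proof -
  assume "open U"
  from open_vimage[OF \<open>open U\<close> continuous_on_jet_coord[of UNIV 1]] show ?thesis by (simp add: jet_dom_def vimage_def)
qed

lemma eventually_jet_move:
  assumes "open S" "z \<in> S"
  shows "\<forall>\<^sub>F s in nhds 0. jet_move e z s \<in> S"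
proof -
  have "open ((\<lambda>s. jet_move e z s) -` S)"
    by (intro open_vimage[OF assms(1)] continuous_on_jet_move continuous_intros)
  then show ?thesis using assms(2) eventually_nhds_in_open by fastforce
qed

lemma jet_Ck_Suc_iff:
  "jet_Ck (Suc m) S f \<longleftrightarrow> (\<forall>e. (\<forall>z\<in>S. (\<lambda>s. f (jet_move e z s)) differentiable (at 0)) \<and> jet_Ck m S (jet_d e f))"
proof -
  have "(\<lambda>s. f (s, snd z)) differentiable (at (fst z)) \<longleftrightarrow> (\<lambda>s. f (fst z + s, snd z)) differentiable (at 0)" for z
    using deriv_shift_real[of "\<lambda>s. f (s, snd z)" _ "fst z" 0]
    by (simp add: real_differentiable_def)
  then show ?thesis
    by (auto simp: split_option_all jet_dx_eq jet_db_eq split_paired_all)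
qed

definition jet_smooth :: "'n::finite jet set \<Rightarrow> ('n jet \<Rightarrow> real) \<Rightarrow> bool" where
  "jet_smooth S f \<longleftrightarrow> (\<forall>m. jet_Ck m S f)"

lemma jet_smooth_has_derivative:
  assumes "jet_smooth S f" "z \<in> S"
  shows "((\<lambda>s. f (jet_move e z s)) has_real_derivative jet_d e f z) (at 0)"
  using assms(1)[unfolded jet_smooth_def, rule_format, of "Suc 0"] assms(2)
  unfolding jet_Ck_Suc_iff jet_d_def
  by (auto simp: DERIV_deriv_iff_real_differentiable)

lemma jet_smooth_d: "jet_smooth S f \<Longrightarrow> jet_smooth S (jet_d e f)"
  unfolding jet_smooth_def using jet_Ck_Suc_iff by blast

lemma jet_smooth_continuous: "jet_smooth S f \<Longrightarrow> continuous_on S f"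
  unfolding jet_smooth_def by (metis jet_Ck.simps(1))

lemma jet_d_eqI: "((\<lambda>s. f (jet_move e z s)) has_real_derivative D) (at 0) \<Longrightarrow> jet_d e f z = D"
  unfolding jet_d_def by (rule DERIV_imp_deriv)

lemma jet_move_cong:
  assumes "open S" "z \<in> S" "\<And>y. y \<in> S \<Longrightarrow> f y = h y"
  shows "((\<lambda>s. f (jet_move e z s)) has_real_derivative D) (at 0) \<longleftrightarrow>
    ((\<lambda>s. h (jet_move e z s)) has_real_derivative D) (at 0)"
proof (rule DERIV_cong_ev)
  show "\<forall>\<^sub>F s in nhds 0. f (jet_move e z s) = h (jet_move e z s)"
    using eventually_jet_move[OF assms(1,2), of e] by (rule eventually_mono) (rule assms(3))
qed auto

lemma jet_d_cong:
  assumes "open S" "z \<in> S" "\<And>y. y \<in> S \<Longrightarrow> f y = h y"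
  shows "jet_d e f z = jet_d e h z"
  using jet_move_cong[of S z f h] assms by (simp add: jet_d_def deriv_def)

lemma jet_Ck_cong:
  assumes "open S" "\<And>y. y \<in> S \<Longrightarrow> f y = h y"
  shows "jet_Ck m S f \<longleftrightarrow> jet_Ck m S h"
  using assms(2)
proof (induction m arbitrary: f h)
  case 0
  then show ?case by (simp cong: continuous_on_cong)
next
  case (Suc m)
  have "jet_Ck m S (jet_d e f) \<longleftrightarrow> jet_Ck m S (jet_d e h)" for e
    using jet_d_cong[OF assms(1), of _ f h e] Suc.prems by (intro Suc.IH) blast
  moreover have "(\<lambda>s. f (jet_move e z s)) differentiable (at 0) \<longleftrightarrow> (\<lambda>s. h (jet_move e z s)) differentiable (at 0)"
    if "z \<in> S" for e z
    using jet_move_cong[OF assms(1) that, of f h e] Suc.prems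
    by (simp add: real_differentiable_def)
  ultimately show ?case by (simp only: jet_Ck_Suc_iff) blast
qed

lemma jet_smooth_cong:
  assumes "open S" "\<And>y. y \<in> S \<Longrightarrow> f y = h y"
  shows "jet_smooth S f \<longleftrightarrow> jet_smooth S h"
  using jet_Ck_cong[of S f h] assms unfolding jet_smooth_def by blast

lemma jet_CkI:
  assumes "open S" "\<And>e z. z \<in> S \<Longrightarrow> ((\<lambda>s. f (jet_move e z s)) has_real_derivative D e z) (at 0)"
    "\<And>e. jet_Ck m S (D e)"
  shows "jet_Ck (Suc m) S f"
proof -
  have "jet_Ck m S (jet_d e f)" for e
    using jet_Ck_cong[OF assms(1), of "jet_d e f" "D e"] jet_d_eqI[OF assms(2)] assms(3) by blast
  then show ?thesis using assms(2) unfolding jet_Ck_Suc_iff real_differentiable_def by blast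
qed

lemma jet_Ck_const: "open S \<Longrightarrow> jet_Ck m S (\<lambda>z. k)"
proof (induction m arbitrary: k)
  case (Suc m)
  then show ?case by (intro jet_CkI[where D="\<lambda>e z. 0"]) auto
qed simp

lemma jet_smooth_const: "open S \<Longrightarrow> jet_smooth S (\<lambda>z. k)"
  by (simp add: jet_smooth_def jet_Ck_const)

lemma jet_Ck_add:
  assumes "open S" "jet_Ck m S f" "jet_Ck m S h"
  shows "jet_Ck m S (\<lambda>z. f z + h z)"
  using assms(2,3)
proof (induction m arbitrary: f h)
  case 0
  then show ?case by (auto intro: continuous_on_add)
next
  case (Suc m)
  show ?case
  proof (rule jet_CkI[OF assms(1), where D="\<lambda>e z. jet_d e f z + jet_d e h z"])
    show "((\<lambda>s. f (jet_move e z s) + h (jet_move e z s)) has_real_derivative jet_d e f z + jet_d e h z) (at 0)"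
      if "z \<in> S" for e z
      using Suc.prems that unfolding jet_Ck_Suc_iff
      by (intro DERIV_add) (auto simp: jet_d_def DERIV_deriv_iff_real_differentiable)
    show "jet_Ck m S (\<lambda>z. jet_d e f z + jet_d e h z)" for e
      using Suc.prems unfolding jet_Ck_Suc_iff by (intro Suc.IH) auto
  qed
qed

lemma jet_smooth_add:
  "open S \<Longrightarrow> jet_smooth S f \<Longrightarrow> jet_smooth S h \<Longrightarrow> jet_smooth S (\<lambda>z. f z + h z)"
  unfolding jet_smooth_def using jet_Ck_add by blast

lemma jet_d_mult_has_derivative:
  assumes "jet_smooth S f" "jet_smooth S h" "z \<in> S"
  shows "((\<lambda>s. f (jet_move e z s) * h (jet_move e z s)) has_real_derivative
    jet_d e f z * h z + jet_d e h z * f z) (at 0)"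
  using DERIV_mult[OF jet_smooth_has_derivative[OF assms(1,3)] jet_smooth_has_derivative[OF assms(2,3)], of e]
  by simp

lemma jet_smooth_mult:
  assumes "open S" "jet_smooth S f" "jet_smooth S h"
  shows "jet_smooth S (\<lambda>z. f z * h z)"
proof -
  have "jet_Ck m S (\<lambda>z. f z * h z)" if "jet_smooth S f" "jet_smooth S h" for m f h
    using that
  proof (induction m arbitrary: f h)
    case 0
    then show ?case by (auto intro: continuous_on_mult dest: jet_smooth_continuous)
  next
    case (Suc m)
    show ?case
    proof (rule jet_CkI[OF assms(1)])
      show "((\<lambda>s. f (jet_move e z s) * h (jet_move e z s)) has_real_derivative
          jet_d e f z * h z + jet_d e h z * f z) (at 0)" if "z \<in> S" for e z
        using jet_d_mult_has_derivative Suc.prems that .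
      show "jet_Ck m S (\<lambda>z. jet_d e f z * h z + jet_d e h z * f z)" for e
        by (intro jet_Ck_add[OF assms(1)] Suc.IH jet_smooth_d Suc.prems)
    qed
  qed
  then show ?thesis using assms by (simp add: jet_smooth_def)
qed

lemma jet_smooth_fst: "open S \<Longrightarrow> jet_smooth S (\<lambda>z. fst z)"
proof -
  assume S: "open S"
  have "jet_Ck m S (\<lambda>z. fst z)" for m
  proof (cases m)
    case 0
    then show ?thesis by (auto intro: continuous_intros)
  next
    case (Suc l)
    show ?thesis unfolding Suc
      by (rule jet_CkI[OF S, where D="\<lambda>e z. if e = None then 1 else 0"])
        (auto simp: fst_jet_move jet_Ck_const[OF S] intro!: derivative_eq_intros)
  qed
  then show ?thesis by (simp add: jet_smooth_def)
qed

lemma jet_smooth_coord: "open S \<Longrightarrow> jet_smooth S (\<lambda>z. snd z k $ i)"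
proof -
  assume S: "open S"
  have "jet_Ck m S (\<lambda>z. snd z k $ i)" for m
  proof (cases m)
    case 0
    show ?thesis unfolding 0 by (auto intro!: continuous_on_component continuous_on_jet_coord)
  next
    case (Suc l)
    show ?thesis unfolding Suc
      by (rule jet_CkI[OF S, where D="\<lambda>e z. if e = Some (k, i) then 1 else 0"])
        (auto simp: snd_jet_move_nth jet_Ck_const[OF S] intro!: derivative_eq_intros)
  qed
  then show ?thesis by (simp add: jet_smooth_def)
qed

lemma jet_d_fst: "jet_d e fst z = (if e = None then 1 else 0)"
  by (rule jet_d_eqI) (auto simp: fst_jet_move intro!: derivative_eq_intros)

lemma jet_d_coord: "jet_d e (\<lambda>z. snd z k $ i) z = (if e = Some (k, i) then 1 else 0)"
  by (rule jet_d_eqI) (auto simp: snd_jet_move_nth intro!: derivative_eq_intros)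

lemma field_jet_has_derivative:
  assumes "f differentiable (at (snd z 1))"
  shows "((\<lambda>s. f (snd (jet_move e z s) 1)) has_real_derivative
    (case e of Some (k, i) \<Rightarrow> if k = 1 then partial_u i f (snd z 1) else 0 | None \<Rightarrow> 0)) (at 0)"
proof (cases "\<exists>i. e = Some (1, i)")
  case True
  then obtain i where e: "e = Some (1, i)" by blast
  have "(f has_derivative frechet_derivative f (at (snd z 1))) (at (snd z 1 + 0 *\<^sub>R axis i 1))"
    using assms by (simp add: frechet_derivative_works)
  then have "((\<lambda>s::real. f (snd z 1 + s *\<^sub>R axis i 1)) has_derivative
      (\<lambda>s. frechet_derivative f (at (snd z 1)) (s *\<^sub>R axis i 1))) (at 0)"
    by (rule has_derivative_compose[rotated]) (auto intro!: derivative_eq_intros)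
  moreover have "frechet_derivative f (at (snd z 1)) (s *\<^sub>R axis i 1) = partial_u i f (snd z 1) * s" for s
    using linear_frechet_derivative[OF assms] by (simp add: partial_u_def linear_scale)
  ultimately show ?thesis
    by (simp add: e has_field_derivative_def jet_shift_def)
next
  case False
  then have "snd (jet_move e z s) 1 = snd z 1" for s by (intro jet_move_other) auto
  with False show ?thesis by (auto split: option.splits)
qed

lemma jet_smooth_field:
  assumes "open U" "smooth_on U f"
  shows "jet_smooth (jet_dom U) (\<lambda>z. f (snd z 1))"
proof -
  have S: "open (jet_dom U)" by (rule open_jet_dom[OF assms(1)])
  have "jet_Ck m (jet_dom U) (\<lambda>z. f (snd z 1))" if "smooth_on U f" for m f
    using that
  proof (induction m arbitrary: f)
    case 0
    from continuous_on_compose2[OF smooth_on_imp_continuous_on[OF 0] continuous_on_jet_coord[of "jet_dom U" 1]]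
    show ?case by (auto simp: jet_dom_def)
  next
    case (Suc m)
    show ?case
    proof (rule jet_CkI[OF S])
      show "((\<lambda>s. f (snd (jet_move e z s) 1)) has_real_derivative
        (case e of Some (k, i) \<Rightarrow> if k = 1 then partial_u i f (snd z 1) else 0 | None \<Rightarrow> 0)) (at 0)"
        if "z \<in> jet_dom U" for e z
        using that by (intro field_jet_has_derivative smooth_on_imp_differentiable[OF Suc.prems])
          (simp add: jet_dom_def)
      show "jet_Ck m (jet_dom U) (\<lambda>z. case e of Some (k, i) \<Rightarrow> if k = 1 then partial_u i f (snd z 1) else 0 | None \<Rightarrow> 0)"
        for e :: "(nat \<times> 'a) option"
      proof (cases "\<exists>i. e = Some (1, i)")
        case True
        then show ?thesis
          unfolding partial_u_def using Suc.IH[OF smooth_on_frechet_derivative[OF Suc.prems]] by auto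
      next
        case False
        then have "(case e of Some (k, i) \<Rightarrow> if k = 1 then partial_u i f (snd z 1) else 0 | None \<Rightarrow> 0) = 0" for z :: "'a jet"
          by (auto split: option.splits)
        then show ?thesis using jet_Ck_const[OF S, of m 0] by presburger
      qed
    qed
  qed
  then show ?thesis using assms by (simp add: jet_smooth_def)
qed

lemma diff_fun_iff:
  "differential_function_on S f \<longleftrightarrow> (\<exists>N. jet_order_le N S f) \<and> jet_smooth S f"
  by (simp add: differential_function_on_def jet_smooth_def)

lemma jet_order_le_mono: "jet_order_le N S f \<Longrightarrow> N \<le> M \<Longrightarrow> jet_order_le M S f"
  unfolding jet_order_le_def by (meson order_trans)

lemma jet_order_le_d:
  assumes "open S" "jet_order_le N S f"
  shows "jet_order_le N S (jet_d e f)"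
  unfolding jet_order_le_def
proof (intro ballI impI)
  fix z z' assume z: "z \<in> S" "z' \<in> S" and eq: "fst z = fst z' \<and> (\<forall>k\<le>N. snd z k = snd z' k)"
  have *: "fst (jet_move e z s) = fst (jet_move e z' s) \<and>
      (\<forall>k\<le>N. snd (jet_move e z s) k = snd (jet_move e z' s) k)" for s
    using eq by (simp add: fst_jet_move vec_eq_iff snd_jet_move_nth)
  have "\<forall>\<^sub>F s in nhds 0. f (jet_move e z s) = f (jet_move e z' s)"
    using eventually_jet_move[OF assms(1) z(1), of e] eventually_jet_move[OF assms(1) z(2), of e]
  proof eventually_elim
    case (elim s)
    then show ?case using assms(2) * unfolding jet_order_le_def by blast
  qed
  then show "jet_d e f z = jet_d e f z'" unfolding jet_d_def by (rule deriv_cong_ev) simp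
qed

lemma jet_d_above_order:
  assumes "open S" "jet_order_le N S f" "N < k" "z \<in> S"
  shows "jet_d (Some (k, i)) f z = 0"
proof -
  have "\<forall>\<^sub>F s in nhds 0. f (jet_move (Some (k, i)) z s) = f z"
    using eventually_jet_move[OF assms(1,4), of "Some (k, i)"]
  proof eventually_elim
    case (elim s)
    have "fst (jet_move (Some (k, i)) z s) = fst z \<and>
        (\<forall>l\<le>N. snd (jet_move (Some (k, i)) z s) l = snd z l)"
      using \<open>N < k\<close> by (auto simp del: jet_move.simps simp: fst_jet_move vec_eq_iff snd_jet_move_nth)
    with elim assms(2,4) show ?case unfolding jet_order_le_def by blast
  qed
  then have "jet_d (Some (k, i)) f z = deriv (\<lambda>s. f z) 0"
    unfolding jet_d_def by (rule deriv_cong_ev) simp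
  then show ?thesis by simp
qed

text \<open>Orders are upper bounds and can be raised; this supplies a common order when several
  functions meet.\<close>

lemma jet_order_le_ex_ge:
  assumes "differential_function_on S f"
  obtains N where "N \<ge> M" "jet_order_le N S f"
  using assms jet_order_le_mono[of _ S f] unfolding diff_fun_iff
  by (metis max.cobounded1 max.cobounded2)

lemma diff_fun_smooth: "differential_function_on S f \<Longrightarrow> jet_smooth S f"
  by (simp add: diff_fun_iff)

lemma diff_fun_cong:
  assumes "open S" "\<And>y. y \<in> S \<Longrightarrow> f y = h y"
  shows "differential_function_on S f \<longleftrightarrow> differential_function_on S h"
  using jet_smooth_cong[of S f h] assms unfolding diff_fun_iff jet_order_le_def by simp

lemma jet_d_const: "jet_d e (\<lambda>z. k) z = 0"
  by (rule jet_d_eqI) simp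

lemma total_dx_const: "total_dx (\<lambda>z. k) z = 0"
  by (simp add: total_dx_def jet_dx_eq jet_db_eq jet_d_const)

lemma total_dx_fst: "total_dx fst z = 1"
  by (simp add: total_dx_def jet_dx_eq jet_db_eq jet_d_fst)

lemma total_dx_coord: "total_dx (\<lambda>z. snd z k $ i) z = snd z (Suc k) $ i"
proof -
  have "(\<Sum>l. \<Sum>j\<in>UNIV. jet_d (Some (l, j)) (\<lambda>z. snd z k $ i) z * snd z (Suc l) $ j) =
     (\<Sum>l. if l = k then snd z (Suc k) $ i else 0)"
    by (intro suminf_cong) (auto simp: jet_d_coord if_distrib[of "\<lambda>x. x * _"] cong: if_cong)
  also have "\<dots> = snd z (Suc k) $ i" using sums_single[of k "\<lambda>_. snd z (Suc k) $ i"] sums_unique by metis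
  finally show ?thesis by (simp add: total_dx_def jet_dx_eq jet_db_eq jet_d_coord)
qed

lemma total_dx_pow_zero: "(total_dx ^^ k) (\<lambda>z. 0) z = 0"
proof -
  have "total_dx (\<lambda>z::'a jet. 0) = (\<lambda>z. 0)" using total_dx_const by (rule ext)
  then have "(total_dx ^^ k) (\<lambda>z::'a jet. 0) = (\<lambda>z. 0)" by (induction k) simp_all
  then show ?thesis by simp
qed

context
  fixes S :: "'n::finite jet set"
  assumes S: "open S"
begin

lemma diff_fun_const: "differential_function_on S (\<lambda>z. k)"
  using jet_smooth_const[OF S] by (auto simp: diff_fun_iff jet_order_le_def)

lemma diff_fun_add:
  assumes "differential_function_on S f" "differential_function_on S h"
  shows "differential_function_on S (\<lambda>z. f z + h z)"
proof -
  obtain N where N: "jet_order_le N S f" using assms(1) diff_fun_iff by blast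
  obtain M where "M \<ge> N" "jet_order_le M S h" using jet_order_le_ex_ge[OF assms(2)] by blast
  with N have "jet_order_le M S (\<lambda>z. f z + h z)"
    using jet_order_le_mono[OF N] unfolding jet_order_le_def by metis
  then show ?thesis using assms jet_smooth_add[OF S] by (auto simp: diff_fun_iff)
qed

lemma diff_fun_mult:
  assumes "differential_function_on S f" "differential_function_on S h"
  shows "differential_function_on S (\<lambda>z. f z * h z)"
proof -
  obtain N where N: "jet_order_le N S f" using assms(1) diff_fun_iff by blast
  obtain M where "M \<ge> N" "jet_order_le M S h" using jet_order_le_ex_ge[OF assms(2)] by blast
  with N have "jet_order_le M S (\<lambda>z. f z * h z)"
    using jet_order_le_mono[OF N] unfolding jet_order_le_def by metis
  then show ?thesis using assms jet_smooth_mult[OF S] by (auto simp: diff_fun_iff)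
qed

lemma diff_fun_sum:
  "(\<And>i. i \<in> I \<Longrightarrow> differential_function_on S (f i)) \<Longrightarrow> differential_function_on S (\<lambda>z. \<Sum>i\<in>I. f i z)"
proof (induction I rule: infinite_finite_induct)
  case (insert j I)
  then have "differential_function_on S (\<lambda>z. f j z + (\<Sum>i\<in>I. f i z))"
    by (intro diff_fun_add) auto
  with insert show ?case by simp
qed (simp_all add: diff_fun_const)

lemma diff_fun_fst: "differential_function_on S fst"
  using jet_smooth_fst[OF S] by (auto simp: diff_fun_iff jet_order_le_def)

lemma diff_fun_coord: "differential_function_on S (\<lambda>z. snd z k $ i)"
  using jet_smooth_coord[OF S] by (auto simp: diff_fun_iff jet_order_le_def intro!: exI[of _ k])

lemma diff_fun_d:
  "differential_function_on S f \<Longrightarrow> differential_function_on S (jet_d e f)"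
  using jet_smooth_d jet_order_le_d[OF S] unfolding diff_fun_iff by blast

lemma jet_d_add:
  assumes "differential_function_on S f" "differential_function_on S h" "z \<in> S"
  shows "jet_d e (\<lambda>z. f z + h z) z = jet_d e f z + jet_d e h z"
  using assms
  by (intro jet_d_eqI DERIV_add jet_smooth_has_derivative) (auto simp: diff_fun_iff)

lemma jet_d_mult:
  assumes "differential_function_on S f" "differential_function_on S h" "z \<in> S"
  shows "jet_d e (\<lambda>z. f z * h z) z = jet_d e f z * h z + f z * jet_d e h z"
proof -
  have "jet_d e (\<lambda>z. f z * h z) z = jet_d e f z * h z + jet_d e h z * f z"
    using assms by (intro jet_d_eqI jet_d_mult_has_derivative) (auto simp: diff_fun_iff)
  then show ?thesis by simp
qed

text \<open>Any upper bound of the order may serve as \<open>N\<close>, so that several total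
  derivatives can be expanded over the same range.\<close>

lemma total_dx_finite:
  assumes "jet_order_le N S f" "z \<in> S"
  shows "total_dx f z = jet_d None f z + (\<Sum>k\<le>N. \<Sum>i\<in>UNIV. jet_d (Some (k, i)) f z * snd z (Suc k) $ i)"
proof -
  have "(\<Sum>k. \<Sum>i\<in>UNIV. jet_d (Some (k, i)) f z * snd z (Suc k) $ i) =
    (\<Sum>k\<le>N. \<Sum>i\<in>UNIV. jet_d (Some (k, i)) f z * snd z (Suc k) $ i)"
    using jet_d_above_order[OF S assms(1) _ assms(2)] by (intro suminf_finite) auto
  then show ?thesis by (simp add: total_dx_def jet_dx_eq jet_db_eq)
qed

lemma total_dx_cong:
  assumes "z \<in> S" "\<And>y. y \<in> S \<Longrightarrow> f y = h y"
  shows "total_dx f z = total_dx h z"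
  using jet_d_cong[of S z f h] S assms by (simp add: total_dx_def jet_dx_eq jet_db_eq)

lemma total_dx_add:
  assumes "differential_function_on S f" "differential_function_on S h" "z \<in> S"
  shows "total_dx (\<lambda>z. f z + h z) z = total_dx f z + total_dx h z"
proof -
  obtain N where N: "jet_order_le N S f" using assms(1) diff_fun_iff by blast
  obtain M where "M \<ge> N" "jet_order_le M S h" using jet_order_le_ex_ge[OF assms(2)] by blast
  moreover obtain L where "L \<ge> M" "jet_order_le L S (\<lambda>z. f z + h z)"
    using jet_order_le_ex_ge[OF diff_fun_add[OF assms(1,2)]] by blast
  ultimately have "jet_order_le L S f" "jet_order_le L S h" "jet_order_le L S (\<lambda>z. f z + h z)"
    using N jet_order_le_mono[of _ S _ L] by (meson order_trans)+
  then show ?thesis using assms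
    by (simp add: total_dx_finite jet_d_add sum.distrib algebra_simps)
qed

lemma total_dx_mult:
  assumes "differential_function_on S f" "differential_function_on S h" "z \<in> S"
  shows "total_dx (\<lambda>z. f z * h z) z = total_dx f z * h z + f z * total_dx h z"
proof -
  obtain N where N: "jet_order_le N S f" using assms(1) diff_fun_iff by blast
  obtain M where "M \<ge> N" "jet_order_le M S h" using jet_order_le_ex_ge[OF assms(2)] by blast
  moreover obtain L where "L \<ge> M" "jet_order_le L S (\<lambda>z. f z * h z)"
    using jet_order_le_ex_ge[OF diff_fun_mult[OF assms(1,2)]] by blast
  ultimately have "jet_order_le L S f" "jet_order_le L S h" "jet_order_le L S (\<lambda>z. f z * h z)"
    using N jet_order_le_mono[of _ S _ L] by (meson order_trans)+
  then show ?thesis using assms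
    by (simp add: total_dx_finite jet_d_mult sum.distrib sum_distrib_left sum_distrib_right algebra_simps)
qed

lemma diff_fun_total_dx:
  assumes "differential_function_on S f"
  shows "differential_function_on S (total_dx f)"
proof -
  obtain N where N: "jet_order_le N S f" using assms diff_fun_iff by blast
  have "differential_function_on S (\<lambda>z. jet_d None f z +
      (\<Sum>k\<le>N. \<Sum>i\<in>UNIV. jet_d (Some (k, i)) f z * snd z (Suc k) $ i))"
    by (intro diff_fun_add diff_fun_sum diff_fun_mult
        diff_fun_d diff_fun_coord assms)
  moreover have "differential_function_on S (total_dx f) \<longleftrightarrow> differential_function_on S (\<lambda>z. jet_d None f z +
      (\<Sum>k\<le>N. \<Sum>i\<in>UNIV. jet_d (Some (k, i)) f z * snd z (Suc k) $ i))"
    by (rule diff_fun_cong[OF S total_dx_finite[OF N]])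
  ultimately show ?thesis by (simp only:)
qed

end

text \<open>Schwarz's theorem. By two applications of the mean value theorem, the second difference
  of \<open>F\<close> over a small square of side \<open>h\<close> is \<open>h * h\<close> times a
  value of either mixed derivative inside the square; continuity at the origin brings both values
  close to those at 0.\<close>

lemma mixed_derivatives_eq:
  fixes F :: "real \<Rightarrow> real \<Rightarrow> real"
  assumes r: "r > 0"
    and Fs: "\<And>s t. \<bar>s\<bar> < r \<Longrightarrow> \<bar>t\<bar> < r \<Longrightarrow> ((\<lambda>s. F s t) has_real_derivative Fs s t) (at s)"
    and Ft: "\<And>s t. \<bar>s\<bar> < r \<Longrightarrow> \<bar>t\<bar> < r \<Longrightarrow> ((\<lambda>t. F s t) has_real_derivative Ft s t) (at t)"
    and Fst: "\<And>s t. \<bar>s\<bar> < r \<Longrightarrow> \<bar>t\<bar> < r \<Longrightarrow> ((\<lambda>t. Fs s t) has_real_derivative Fst s t) (at t)"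
    and Fts: "\<And>s t. \<bar>s\<bar> < r \<Longrightarrow> \<bar>t\<bar> < r \<Longrightarrow> ((\<lambda>s. Ft s t) has_real_derivative Fts s t) (at s)"
    and cst: "isCont (\<lambda>p. Fst (fst p) (snd p)) (0, 0)"
    and cts: "isCont (\<lambda>p. Fts (fst p) (snd p)) (0, 0)"
  shows "Fst 0 0 = Fts 0 0"
proof (rule ccontr)
  assume ne: "Fst 0 0 \<noteq> Fts 0 0"
  define e where "e = dist (Fst 0 0) (Fts 0 0) / 2"
  have e: "e > 0" using ne by (simp add: e_def)
  obtain d1 where d1: "d1 > 0" "\<And>p. dist p (0, 0) < d1 \<Longrightarrow> dist (Fst (fst p) (snd p)) (Fst 0 0) < e"
    using cst e unfolding continuous_at_eps_delta by (metis fst_conv snd_conv)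
  obtain d2 where d2: "d2 > 0" "\<And>p. dist p (0, 0) < d2 \<Longrightarrow> dist (Fts (fst p) (snd p)) (Fts 0 0) < e"
    using cts e unfolding continuous_at_eps_delta by (metis fst_conv snd_conv)
  \<comment> \<open>A third, because points of the open square of side \<open>h\<close> are within
    \<open>2 * h\<close> of the origin, and this must stay strictly below \<open>d1\<close> and
    \<open>d2\<close>.\<close>
  define h where "h = min (min d1 d2) r / 3"
  have h: "0 < h" "h < r" "2 * h < d1" "2 * h < d2" using d1(1) d2(1) r by (auto simp: h_def)
  have near: "dist (s, t) (0::real, 0::real) < 2 * h" if "0 < s" "s < h" "0 < t" "t < h" for s t
    using that norm_Pair_le[of s t] by (simp add: dist_norm)
  have "\<exists>s>0. s < h \<and> (F h h - F h 0) - (F 0 h - F 0 0) = (h - 0) * (Fs s h - Fs s 0)"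
    by (rule MVT2[OF h(1)]) (use h in \<open>auto intro!: DERIV_diff Fs\<close>)
  then obtain s where s: "s > 0" "s < h" "F h h - F h 0 - (F 0 h - F 0 0) = h * (Fs s h - Fs s 0)" by auto
  have "\<exists>t>0. t < h \<and> Fs s h - Fs s 0 = (h - 0) * Fst s t"
    by (rule MVT2[OF h(1)]) (use h s in \<open>auto intro!: Fst\<close>)
  then obtain t where t: "t > 0" "t < h" "Fs s h - Fs s 0 = h * Fst s t" by auto
  have "\<exists>t>0. t < h \<and> (F h h - F 0 h) - (F h 0 - F 0 0) = (h - 0) * (Ft h t - Ft 0 t)"
    by (rule MVT2[OF h(1)]) (use h in \<open>auto intro!: DERIV_diff Ft\<close>)
  then obtain t' where t': "t' > 0" "t' < h" "F h h - F 0 h - (F h 0 - F 0 0) = h * (Ft h t' - Ft 0 t')" by auto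
  have "\<exists>s>0. s < h \<and> Ft h t' - Ft 0 t' = (h - 0) * Fts s t'"
    by (rule MVT2[OF h(1)]) (use h t' in \<open>auto intro!: Fts\<close>)
  then obtain s' where s': "s' > 0" "s' < h" "Ft h t' - Ft 0 t' = h * Fts s' t'" by auto
  have "F h h - F h 0 - (F 0 h - F 0 0) = h * (h * Fst s t)"
    "F h h - F 0 h - (F h 0 - F 0 0) = h * (h * Fts s' t')"
    using s(3) t(3) t'(3) s'(3) by simp_all
  then have "h * (h * Fst s t) = h * (h * Fts s' t')" by linarith
  then have eq: "Fst s t = Fts s' t'" using h(1) by simp
  have "dist (Fst s t) (Fst 0 0) < e" using d1(2)[of "(s, t)"] near[OF s(1,2) t(1,2)] h by simp
  moreover have "dist (Fts s' t') (Fts 0 0) < e" using d2(2)[of "(s', t')"] near[OF s'(1,2) t'(1,2)] h by simp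
  ultimately show False using dist_triangle3[of "Fst 0 0" "Fts 0 0" "Fst s t"] unfolding e_def eq by linarith
qed

lemma jet_d_commute:
  assumes S: "open S" and f: "jet_smooth S f" and z: "z \<in> S"
  shows "jet_d e (jet_d e' f) z = jet_d e' (jet_d e f) z"
proof -
  define m where "m = (\<lambda>p. jet_move e (jet_move e' z (fst p)) (snd p))"
  have cm: "continuous_on A m" for A
    unfolding m_def by (intro continuous_on_jet_move continuous_intros)
  have "open (m -` S)" by (rule open_vimage[OF S cm])
  moreover have "(0, 0) \<in> m -` S" using z by (simp add: m_def)
  ultimately obtain r0 where r0: "r0 > 0" "ball (0, 0) r0 \<subseteq> m -` S" by (meson open_contains_ball)
  \<comment> \<open>Half, since the norm of a pair is at most the sum of the two absolute
    values.\<close>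
  define r where "r = r0 / 2"
  have r: "r > 0" using r0 by (simp add: r_def)
  have in_S: "m (s, t) \<in> S" if "\<bar>s\<bar> < r" "\<bar>t\<bar> < r" for s t
  proof -
    have "dist (0, 0) (s, t) < r0" using norm_Pair_le[of s t] that by (simp add: r_def dist_prod_def norm_prod_def)
    then show ?thesis using r0(2) by auto
  qed
  have m1: "m (s + h, t) = jet_move e' (m (s, t)) h" for s t h
    using jet_move_commute[of e e' "jet_move e' z s" h t] by (simp add: m_def jet_move_add)
  have m2: "m (s, t + h) = jet_move e (m (s, t)) h" for s t h
    unfolding m_def by (simp add: jet_move_add)
  have D1: "((\<lambda>s. k (m (s, t))) has_real_derivative jet_d e' k (m (s, t))) (at s)"
    if "jet_smooth S k" "\<bar>s\<bar> < r" "\<bar>t\<bar> < r" for k s t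
    using deriv_shift_real[of "\<lambda>s. k (m (s, t))" "jet_d e' k (m (s, t))" s 0]
      jet_smooth_has_derivative[OF that(1) in_S[OF that(2,3)], of e'] by (simp add: m1)
  have D2: "((\<lambda>t. k (m (s, t))) has_real_derivative jet_d e k (m (s, t))) (at t)"
    if "jet_smooth S k" "\<bar>s\<bar> < r" "\<bar>t\<bar> < r" for k s t
    using deriv_shift_real[of "\<lambda>t. k (m (s, t))" "jet_d e k (m (s, t))" t 0]
      jet_smooth_has_derivative[OF that(1) in_S[OF that(2,3)], of e] by (simp add: m2)
  have C: "isCont (\<lambda>p. k (m p)) (0, 0)" if "jet_smooth S k" for k
  proof -
    have "isCont k (m (0, 0))"
      using jet_smooth_continuous[OF that] S in_S[of 0 0] r by (simp add: continuous_on_eq_continuous_at)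
    moreover have "isCont m (0, 0)" using cm[of UNIV] by (simp add: continuous_on_eq_continuous_at)
    ultimately show ?thesis by (simp add: isCont_o2)
  qed
  have "jet_d e (jet_d e' f) (m (0, 0)) = jet_d e' (jet_d e f) (m (0, 0))"
    by (rule mixed_derivatives_eq[where F="\<lambda>s t. f (m (s, t))" and Fs="\<lambda>s t. jet_d e' f (m (s, t))"
          and Ft="\<lambda>s t. jet_d e f (m (s, t))" and Fst="\<lambda>s t. jet_d e (jet_d e' f) (m (s, t))"
          and Fts="\<lambda>s t. jet_d e' (jet_d e f) (m (s, t))", OF r])
      (auto intro: D1 D2 C jet_smooth_d f simp: C[simplified])
  then show ?thesis by (simp add: m_def)
qed

section \<open>The Euler operator\<close>

context
  fixes S :: "'n::finite jet set"
  assumes S: "open S"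
begin

lemma jet_d_sum:
  assumes "\<And>i. i \<in> I \<Longrightarrow> differential_function_on S (f i)" "z \<in> S"
  shows "jet_d e (\<lambda>z. \<Sum>i\<in>I. f i z) z = (\<Sum>i\<in>I. jet_d e (f i) z)"
  using assms(1)
proof (induction I rule: infinite_finite_induct)
  case (insert j I)
  then have "jet_d e (\<lambda>z. f j z + (\<Sum>i\<in>I. f i z)) z = jet_d e (f j) z + jet_d e (\<lambda>z. \<Sum>i\<in>I. f i z) z"
    by (intro jet_d_add[OF S] diff_fun_sum[OF S] assms(2)) auto
  with insert show ?case by simp
qed (simp_all add: jet_d_const)

lemma total_dx_sum:
  assumes "\<And>i. i \<in> I \<Longrightarrow> differential_function_on S (f i)" "z \<in> S"
  shows "total_dx (\<lambda>z. \<Sum>i\<in>I. f i z) z = (\<Sum>i\<in>I. total_dx (f i) z)"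
  using assms(1)
proof (induction I rule: infinite_finite_induct)
  case (insert j I)
  then have "total_dx (\<lambda>z. f j z + (\<Sum>i\<in>I. f i z)) z = total_dx (f j) z + total_dx (\<lambda>z. \<Sum>i\<in>I. f i z) z"
    by (intro total_dx_add[OF S] diff_fun_sum[OF S] assms(2)) auto
  with insert show ?case by simp
qed (simp_all add: total_dx_const)

text \<open>The commutator term comes from the explicit jet variable \<open>snd z (Suc k)\<close> in
  \<open>total_dx\<close>; in all other terms the two derivatives are exchanged. The directions
  \<open>x\<close> and \<open>b\<close> do not occur among these explicit variables, so they commute
  with \<open>total_dx\<close>.\<close>

lemma jet_d_total_dx:
  assumes f: "differential_function_on S f" and z: "z \<in> S"
  shows "jet_d e (total_dx f) z = total_dx (jet_d e f) z +
    (case e of Some (Suc k, i) \<Rightarrow> jet_d (Some (k, i)) f z | _ \<Rightarrow> 0)"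
proof -
  obtain N where N: "jet_order_le N S f" using f diff_fun_iff by blast
  note df = diff_fun_sum[OF S] diff_fun_mult[OF S]
        diff_fun_d[OF S] diff_fun_coord[OF S] f
  have "jet_d e (total_dx f) z = jet_d e (\<lambda>z. jet_d None f z +
      (\<Sum>k\<le>N. \<Sum>i\<in>UNIV. jet_d (Some (k, i)) f z * snd z (Suc k) $ i)) z"
    by (rule jet_d_cong[OF S z total_dx_finite[OF S N]])
  also have "\<dots> = jet_d e (jet_d None f) z +
      jet_d e (\<lambda>z. \<Sum>k\<le>N. \<Sum>i\<in>UNIV. jet_d (Some (k, i)) f z * snd z (Suc k) $ i) z"
    by (intro jet_d_add[OF S] df z)
  also have "jet_d e (\<lambda>z. \<Sum>k\<le>N. \<Sum>i\<in>UNIV. jet_d (Some (k, i)) f z * snd z (Suc k) $ i) z =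
      (\<Sum>k\<le>N. jet_d e (\<lambda>z. \<Sum>i\<in>UNIV. jet_d (Some (k, i)) f z * snd z (Suc k) $ i) z)"
    by (intro jet_d_sum df z)
  also have "\<dots> = (\<Sum>k\<le>N. \<Sum>i\<in>UNIV. jet_d e (\<lambda>z. jet_d (Some (k, i)) f z * snd z (Suc k) $ i) z)"
    by (intro sum.cong refl jet_d_sum df z)
  also have "\<dots> = (\<Sum>k\<le>N. \<Sum>i\<in>UNIV. jet_d e (jet_d (Some (k, i)) f) z * snd z (Suc k) $ i +
      jet_d (Some (k, i)) f z * jet_d e (\<lambda>z. snd z (Suc k) $ i) z)"
    by (intro sum.cong refl jet_d_mult[OF S] df z)
  also have "\<dots> = (\<Sum>k\<le>N. \<Sum>i\<in>UNIV. jet_d (Some (k, i)) (jet_d e f) z * snd z (Suc k) $ i) +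
     (\<Sum>k\<le>N. \<Sum>i\<in>UNIV. jet_d (Some (k, i)) f z * jet_d e (\<lambda>z. snd z (Suc k) $ i) z)"
    by (simp add: sum.distrib jet_d_commute[OF S diff_fun_smooth[OF f] z, of e])
  also have "(\<Sum>k\<le>N. \<Sum>i\<in>UNIV. jet_d (Some (k, i)) f z * jet_d e (\<lambda>z. snd z (Suc k) $ i) z) =
    (case e of Some (Suc k, i) \<Rightarrow> jet_d (Some (k, i)) f z | _ \<Rightarrow> 0)"
  proof -
    have "(\<Sum>k\<le>N. \<Sum>i\<in>UNIV. jet_d (Some (k, i)) f z * jet_d (Some (Suc l, j)) (\<lambda>z. snd z (Suc k) $ i) z) =
       jet_d (Some (l, j)) f z" for l j
    proof -
      have "(\<Sum>k\<le>N. \<Sum>i\<in>UNIV. jet_d (Some (k, i)) f z * jet_d (Some (Suc l, j)) (\<lambda>z. snd z (Suc k) $ i) z) =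
         (\<Sum>k\<le>N. if k = l then jet_d (Some (l, j)) f z else 0)"
        by (intro sum.cong) (auto simp: jet_d_coord if_distrib[of "\<lambda>x. _ * x"] cong: if_cong)
      also have "\<dots> = jet_d (Some (l, j)) f z"
        \<comment> \<open>For \<open>l\<close> above \<open>N\<close> the index is missing from the
          sum, but then the derivative of \<open>f\<close> vanishes as well.\<close>
        using jet_d_above_order[OF S N _ z, of l j] by auto
      finally show ?thesis .
    qed
    then show ?thesis by (auto simp: jet_d_coord split: option.splits nat.splits)
  qed
  finally show ?thesis
    using jet_d_commute[OF S diff_fun_smooth[OF f] z, of e None]
    by (simp add: total_dx_finite[OF S jet_order_le_d[OF S N] z])
qed

lemma diff_fun_total_dx_pow:
  "differential_function_on S f \<Longrightarrow> differential_function_on S ((total_dx ^^ k) f)"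
  by (induction k) (auto intro: diff_fun_total_dx[OF S])

lemma total_dx_pow_cong:
  assumes "\<And>y. y \<in> S \<Longrightarrow> f y = h y" "z \<in> S"
  shows "(total_dx ^^ k) f z = (total_dx ^^ k) h z"
  using assms(2)
proof (induction k arbitrary: z)
  case (Suc k)
  from total_dx_cong[OF S Suc.prems, of "(total_dx ^^ k) f" "(total_dx ^^ k) h"] Suc.IH
  show ?case by simp
qed (simp add: assms(1))

lemma total_dx_pow_add:
  assumes "differential_function_on S f" "differential_function_on S h" "z \<in> S"
  shows "(total_dx ^^ k) (\<lambda>z. f z + h z) z = (total_dx ^^ k) f z + (total_dx ^^ k) h z"
  using assms(3)
proof (induction k arbitrary: z)
  case (Suc k)
  from total_dx_cong[OF S Suc.prems, of "(total_dx ^^ k) (\<lambda>z. f z + h z)" "\<lambda>z. (total_dx ^^ k) f z + (total_dx ^^ k) h z"] Suc.IH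
  show ?case
    by (simp add: total_dx_add[OF S] diff_fun_total_dx_pow assms(1,2) Suc.prems)
qed simp

text \<open>Iterates the commutator rule in the case without correction term: no jet variable lies
  below \<open>b\<close>.\<close>

lemma jet_d_b_total_dx_pow:
  assumes "differential_function_on S f" "z \<in> S"
  shows "jet_d (Some (0, j)) ((total_dx ^^ k) f) z = (total_dx ^^ k) (jet_d (Some (0, j)) f) z"
  using assms(2)
proof (induction k arbitrary: z)
  case (Suc k)
  have "jet_d (Some (0, j)) (total_dx ((total_dx ^^ k) f)) z = total_dx (jet_d (Some (0, j)) ((total_dx ^^ k) f)) z"
    using jet_d_total_dx[OF diff_fun_total_dx_pow[OF assms(1)] Suc.prems, of "Some (0, j)" k]
    by simp
  also have "\<dots> = total_dx ((total_dx ^^ k) (jet_d (Some (0, j)) f)) z"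
    by (rule total_dx_cong[OF S Suc.prems Suc.IH])
  finally show ?case by simp
qed simp

lemma var_deriv_b_finite:
  assumes "jet_order_le N S f" "z \<in> S"
  shows "var_deriv_b f i z = (\<Sum>k\<le>N. (-1) ^ k * (total_dx ^^ k) (jet_d (Some (k, i)) f) z)"
proof -
  have "(total_dx ^^ k) (jet_d (Some (k, i)) f) z = 0" if "k \<notin> {..N}" for k
    using total_dx_pow_cong[of "jet_d (Some (k, i)) f" "\<lambda>z. 0" z k]
      jet_d_above_order[OF S assms(1)] that assms(2) total_dx_pow_zero[of k z] by simp
  then show ?thesis unfolding var_deriv_b_def jet_db_eq by (intro suminf_finite) auto
qed

lemma diff_fun_var_deriv_b:
  assumes "differential_function_on S f"
  shows "differential_function_on S (var_deriv_b f i)"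
proof -
  obtain N where N: "jet_order_le N S f" using assms diff_fun_iff by blast
  have "differential_function_on S (\<lambda>z. \<Sum>k\<le>N. (-1) ^ k * (total_dx ^^ k) (jet_d (Some (k, i)) f) z)"
    by (intro diff_fun_sum[OF S] diff_fun_mult[OF S]
        diff_fun_const[OF S] diff_fun_total_dx_pow
        diff_fun_d[OF S] assms)
  moreover have "differential_function_on S (var_deriv_b f i) \<longleftrightarrow>
    differential_function_on S (\<lambda>z. \<Sum>k\<le>N. (-1) ^ k * (total_dx ^^ k) (jet_d (Some (k, i)) f) z)"
    by (rule diff_fun_cong[OF S var_deriv_b_finite[OF N]])
  ultimately show ?thesis by (simp only:)
qed

lemma var_deriv_b_cong:
  assumes "\<And>y. y \<in> S \<Longrightarrow> f y = h y" "z \<in> S"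
  shows "var_deriv_b f i z = var_deriv_b h i z"
proof -
  have "(total_dx ^^ k) (jet_d (Some (k, i)) f) z = (total_dx ^^ k) (jet_d (Some (k, i)) h) z" for k
    using jet_d_cong[of S _ f h] S assms by (intro total_dx_pow_cong) auto
  then show ?thesis by (simp add: var_deriv_b_def jet_db_eq)
qed

lemma var_deriv_b_add:
  assumes f: "differential_function_on S f" and h: "differential_function_on S h" and z: "z \<in> S"
  shows "var_deriv_b (\<lambda>z. f z + h z) i z = var_deriv_b f i z + var_deriv_b h i z"
proof -
  obtain N where N: "jet_order_le N S f" using f diff_fun_iff by blast
  obtain M where M: "M \<ge> N" "jet_order_le M S h" using jet_order_le_ex_ge[OF h] by blast
  moreover obtain L where L: "L \<ge> M" "jet_order_le L S (\<lambda>z. f z + h z)"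
    using jet_order_le_ex_ge[OF diff_fun_add[OF S f h]] by blast
  ultimately have o: "jet_order_le L S f" "jet_order_le L S h"
    using N jet_order_le_mono[of _ S _ L] by (meson order_trans)+
  have "(total_dx ^^ k) (jet_d (Some (k, i)) (\<lambda>z. f z + h z)) z =
    (total_dx ^^ k) (jet_d (Some (k, i)) f) z + (total_dx ^^ k) (jet_d (Some (k, i)) h) z" for k
  proof -
    have "(total_dx ^^ k) (jet_d (Some (k, i)) (\<lambda>z. f z + h z)) z =
        (total_dx ^^ k) (\<lambda>z. jet_d (Some (k, i)) f z + jet_d (Some (k, i)) h z) z"
      by (intro total_dx_pow_cong jet_d_add[OF S] f h z)
    also have "\<dots> = (total_dx ^^ k) (jet_d (Some (k, i)) f) z + (total_dx ^^ k) (jet_d (Some (k, i)) h) z"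
      by (intro total_dx_pow_add diff_fun_d[OF S] f h z)
    finally show ?thesis .
  qed
  then show ?thesis
    by (simp add: var_deriv_b_finite[OF L(2) z] var_deriv_b_finite[OF o(1) z] var_deriv_b_finite[OF o(2) z]
        sum.distrib distrib_left)
qed

text \<open>Telescoping, because \<open>\<partial>/\<partial>b\<^sub>k\<^sub>+\<^sub>1\<close> of a total derivative \<open>D f\<close> is
  \<open>D \<partial>f/\<partial>b\<^sub>k\<^sub>+\<^sub>1 + \<partial>f/\<partial>b\<^sub>k\<close>.\<close>

lemma var_deriv_b_total_dx:
  assumes f: "differential_function_on S f" and z: "z \<in> S"
  shows "var_deriv_b (total_dx f) i z = 0"
proof -
  obtain M where M: "jet_order_le M S f" using f diff_fun_iff by blast
  \<comment> \<open>The summation bound is pushed past the order \<open>M\<close> of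
    \<open>f\<close>, so that the one term left over by telescoping differentiates \<open>f\<close>
    above its order and vanishes.\<close>
  obtain N' where "N' \<ge> Suc M" and N': "jet_order_le N' S (total_dx f)"
    using jet_order_le_ex_ge[OF diff_fun_total_dx[OF S f]] by blast
  then obtain N where N'_eq: "N' = Suc N" and "M \<le> N" by (metis Suc_le_D Suc_le_mono)
  have oN: "jet_order_le N S f" using jet_order_le_mono[OF M \<open>M \<le> N\<close>] .
  define p where "p k = (total_dx ^^ k) (jet_d (Some (k, i)) f)" for k
  have dp: "(total_dx ^^ Suc k) (jet_d (Some (k, i)) f) = total_dx (p k)" for k by (simp add: p_def)
  have pow0: "(total_dx ^^ k) (total_dx q) = (total_dx ^^ Suc k) q" for k and q :: "'n jet \<Rightarrow> real"
    by (simp add: funpow_swap1)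
  have t: "(total_dx ^^ k) (jet_d (Some (k, i)) (total_dx f)) z =
     total_dx (p k) z + (case k of 0 \<Rightarrow> 0 | Suc l \<Rightarrow> total_dx (p l) z)" for k
  proof (cases k)
    case 0
    then show ?thesis using jet_d_total_dx[OF f z, of "Some (0, i)"] by (simp add: p_def)
  next
    case (Suc l)
    have "(total_dx ^^ k) (jet_d (Some (k, i)) (total_dx f)) z =
      (total_dx ^^ k) (\<lambda>z. total_dx (jet_d (Some (k, i)) f) z + jet_d (Some (l, i)) f z) z"
      using jet_d_total_dx[OF f, of _ "Some (k, i)"] z by (intro total_dx_pow_cong) (auto simp: Suc)
    also have "\<dots> = (total_dx ^^ k) (total_dx (jet_d (Some (k, i)) f)) z + (total_dx ^^ k) (jet_d (Some (l, i)) f) z"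
      by (intro total_dx_pow_add diff_fun_total_dx[OF S] diff_fun_d[OF S] f z)
    also have "(total_dx ^^ k) (total_dx (jet_d (Some (k, i)) f)) = total_dx (p k)"
      by (simp add: pow0 p_def)
    also have "(total_dx ^^ k) (jet_d (Some (l, i)) f) = total_dx (p l)"
      by (simp add: Suc p_def)
    finally show ?thesis by (simp add: Suc)
  qed
  have "var_deriv_b (total_dx f) i z = (\<Sum>k\<le>Suc N. (-1) ^ k * (total_dx ^^ k) (jet_d (Some (k, i)) (total_dx f)) z)"
    by (rule var_deriv_b_finite[OF N'[unfolded N'_eq] z])
  also have "\<dots> = (\<Sum>k\<le>Suc N. (-1) ^ k * total_dx (p k) z) +
      (\<Sum>k\<le>Suc N. (-1) ^ k * (case k of 0 \<Rightarrow> 0 | Suc l \<Rightarrow> total_dx (p l) z))"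
    by (simp only: t distrib_left sum.distrib)
  also have "(\<Sum>k\<le>Suc N. (-1) ^ k * (case k of 0 \<Rightarrow> 0 | Suc l \<Rightarrow> total_dx (p l) z)) =
     - (\<Sum>k\<le>N. (-1) ^ k * total_dx (p k) z)"
    unfolding sum.atMost_Suc_shift by (simp add: sum_negf)
  also have "(\<Sum>k\<le>Suc N. (-1) ^ k * total_dx (p k) z) =
     (\<Sum>k\<le>N. (-1) ^ k * total_dx (p k) z) + (-1) ^ Suc N * total_dx (p (Suc N)) z"
    by simp
  also have "total_dx (p (Suc N)) z = (total_dx ^^ Suc (Suc N)) (jet_d (Some (Suc N, i)) f) z"
    by (simp only: dp)
  also have "\<dots> = (total_dx ^^ Suc (Suc N)) (\<lambda>z. 0) z"
    by (intro total_dx_pow_cong jet_d_above_order[OF S oN] z) auto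
  also have "\<dots> = 0" by (rule total_dx_pow_zero)
  finally show ?thesis by simp
qed

text \<open>All terms of the Euler operator except \<open>k = 0\<close> carry a total derivative,
  which can be pulled out. As the Euler operator annihilates total derivatives, a second application
  sees only the first summand.\<close>

lemma var_deriv_b_decompose:
  assumes f: "differential_function_on S f"
  obtains r where "differential_function_on S r"
    "\<And>z. z \<in> S \<Longrightarrow> var_deriv_b f i z = jet_d (Some (0, i)) f z + total_dx r z"
proof -
  obtain N where N: "N \<ge> 1" "jet_order_le N S f" using jet_order_le_ex_ge[OF f] by blast
  then obtain M where M: "N = Suc M" by (cases N) auto
  define r where "r = (\<lambda>z. \<Sum>k\<le>M. (-1) ^ Suc k * (total_dx ^^ k) (jet_d (Some (Suc k, i)) f) z)"
  note df = diff_fun_sum[OF S] diff_fun_mult[OF S]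
        diff_fun_const[OF S] diff_fun_total_dx_pow
        diff_fun_d[OF S] f
  have "differential_function_on S r" unfolding r_def by (intro df)
  moreover have "var_deriv_b f i z = jet_d (Some (0, i)) f z + total_dx r z" if z: "z \<in> S" for z
  proof -
    have "total_dx r z = (\<Sum>k\<le>M. total_dx (\<lambda>z. (-1) ^ Suc k * (total_dx ^^ k) (jet_d (Some (Suc k, i)) f) z) z)"
      unfolding r_def by (intro total_dx_sum df z)
    also have "\<dots> = (\<Sum>k\<le>M. (-1) ^ Suc k * total_dx ((total_dx ^^ k) (jet_d (Some (Suc k, i)) f)) z)"
      by (intro sum.cong refl, subst total_dx_mult[OF S])
        (auto intro!: df z simp: total_dx_const)
    finally show ?thesis
      unfolding var_deriv_b_finite[OF N(2) z] M sum.atMost_Suc_shift by simp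
  qed
  ultimately show ?thesis by (rule that)
qed

text \<open>The Helmholtz conditions, in the form: the Euler operator, applied to an Euler-Lagrange
  expression, is the derivative along the potential.\<close>

lemma var_deriv_b_var_deriv_b:
  assumes h: "differential_function_on S h" and z: "z \<in> S"
  shows "var_deriv_b (var_deriv_b h j) i z = jet_d (Some (0, j)) (var_deriv_b h i) z"
proof -
  note df = diff_fun_sum[OF S] diff_fun_mult[OF S]
        diff_fun_const[OF S] diff_fun_total_dx_pow
        diff_fun_d[OF S] h
  obtain r where r: "differential_function_on S r"
    "\<And>z. z \<in> S \<Longrightarrow> var_deriv_b h j z = jet_d (Some (0, j)) h z + total_dx r z"
    using var_deriv_b_decompose[OF h] by blast
  obtain N where N: "jet_order_le N S h" using h diff_fun_iff by blast
  have "var_deriv_b (var_deriv_b h j) i z = var_deriv_b (\<lambda>z. jet_d (Some (0, j)) h z + total_dx r z) i z"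
    by (intro var_deriv_b_cong r z)
  also have "\<dots> = var_deriv_b (jet_d (Some (0, j)) h) i z + var_deriv_b (total_dx r) i z"
    by (intro var_deriv_b_add diff_fun_d[OF S] diff_fun_total_dx[OF S] h r z)
  also have "\<dots> = var_deriv_b (jet_d (Some (0, j)) h) i z"
    by (simp add: var_deriv_b_total_dx[OF r(1) z])
  also have "\<dots> = (\<Sum>k\<le>N. (-1) ^ k * (total_dx ^^ k) (jet_d (Some (k, i)) (jet_d (Some (0, j)) h)) z)"
    by (rule var_deriv_b_finite[OF jet_order_le_d[OF S N] z])
  also have "\<dots> = (\<Sum>k\<le>N. (-1) ^ k * (total_dx ^^ k) (jet_d (Some (0, j)) (jet_d (Some (k, i)) h)) z)"
    by (intro sum.cong refl arg_cong2[where f="(*)"] total_dx_pow_cong z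
        jet_d_commute[OF S diff_fun_smooth[OF h]])
  also have "\<dots> = (\<Sum>k\<le>N. (-1) ^ k * jet_d (Some (0, j)) ((total_dx ^^ k) (jet_d (Some (k, i)) h)) z)"
    by (simp add: jet_d_b_total_dx_pow[OF diff_fun_d[OF S h] z])
  also have "\<dots> = (\<Sum>k\<le>N. jet_d (Some (0, j)) (\<lambda>z. (-1) ^ k * (total_dx ^^ k) (jet_d (Some (k, i)) h) z) z)"
    by (intro sum.cong refl, subst jet_d_mult[OF S]) (auto intro!: df z simp: jet_d_const)
  also have "\<dots> = jet_d (Some (0, j)) (\<lambda>z. \<Sum>k\<le>N. (-1) ^ k * (total_dx ^^ k) (jet_d (Some (k, i)) h) z) z"
    by (intro jet_d_sum[symmetric] df z)
  also have "\<dots> = jet_d (Some (0, j)) (var_deriv_b h i) z"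
    by (intro jet_d_cong[OF S z] var_deriv_b_finite[OF N, symmetric])
  finally show ?thesis .
qed

end

section \<open>First integrals of the total derivative\<close>

text \<open>Only derivatives along the axes are given, and no continuity of \<open>w\<close>.
  Therefore \<open>v\<close> is reached from \<open>u\<close> inside a box by changing one
  coordinate at a time; the box keeps each intermediate segment in \<open>U\<close>.\<close>

lemma zero_partials_locally_constant:
  fixes w :: "real^'n::finite \<Rightarrow> real"
  assumes "open U" "u \<in> U"
    and d: "\<And>v i. v \<in> U \<Longrightarrow> ((\<lambda>s. w (v + s *\<^sub>R axis i 1)) has_real_derivative 0) (at 0)"
  shows "\<forall>\<^sub>F v in nhds u. w v = w u"
proof -
  obtain e where e: "e > 0" "\<And>v. (\<And>i. \<bar>v $ i - u $ i\<bar> < e) \<Longrightarrow> v \<in> U"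
  proof -
    obtain r where r: "r > 0" "ball u r \<subseteq> U" using assms(1,2) open_contains_ball by blast
    show ?thesis
    proof (rule that)
      \<comment> \<open>The Euclidean norm is at most the sum of the absolute values of the
        coordinates, so each coordinate may use up this share of \<open>r\<close>.\<close>
      show "r / CARD('n) > 0" using r by simp
      fix v assume *: "\<And>i. \<bar>v $ i - u $ i\<bar> < r / CARD('n)"
      have "norm (v - u) \<le> (\<Sum>i\<in>UNIV. \<bar>(v - u) $ i\<bar>)" by (rule norm_le_l1_cart)
      also have "\<dots> < (\<Sum>i\<in>(UNIV::'n set). r / CARD('n))"
        using * by (intro sum_strict_mono) auto
      finally show "v \<in> U" using r by (auto simp: dist_norm norm_minus_commute)
    qed
  qed
  have "w v = w u" if v: "\<And>i. \<bar>v $ i - u $ i\<bar> < e" for v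
  proof -
    have "w (\<chi> i. if i \<in> A then v $ i else u $ i) = w u" if "finite A" for A
      using that
    proof induction
      case empty
      then show ?case by simp
    next
      case (insert j A)
      define p where "p = (\<chi> i. if i \<in> A then v $ i else u $ i)"
      have seg: "p + s *\<^sub>R axis j 1 \<in> U" if "s \<in> closed_segment 0 (v $ j - u $ j)" for s
      proof (rule e(2))
        fix i
        have "\<bar>s\<bar> \<le> \<bar>v $ j - u $ j\<bar>" using that by (auto simp: closed_segment_eq_real_ivl split: if_splits)
        then show "\<bar>(p + s *\<^sub>R axis j 1) $ i - u $ i\<bar> < e"
          using v[of i] e(1) insert.hyps by (auto simp: p_def axis_def)
      qed
      have "((\<lambda>s. w (p + s *\<^sub>R axis j 1)) has_real_derivative 0) (at s within T)"
        if "s \<in> closed_segment 0 (v $ j - u $ j)" for s T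
      proof -
        have "((\<lambda>h. w (p + (s + h) *\<^sub>R axis j 1)) has_real_derivative 0) (at 0)"
          using d[OF seg[OF that], of j] by (simp add: scaleR_left_distrib add.assoc)
        then show ?thesis
          using deriv_shift_real[of "\<lambda>s. w (p + s *\<^sub>R axis j 1)" 0 s 0]
          by (simp add: has_field_derivative_at_within)
      qed
      then obtain c where "\<And>s. s \<in> closed_segment 0 (v $ j - u $ j) \<Longrightarrow> w (p + s *\<^sub>R axis j 1) = c"
        using has_field_derivative_zero_constant[of "closed_segment 0 (v $ j - u $ j)" "\<lambda>s. w (p + s *\<^sub>R axis j 1)"]
        by (metis convex_closed_segment)
      from this[of 0] this[of "v $ j - u $ j"]
      have "w (p + (v $ j - u $ j) *\<^sub>R axis j 1) = w p" by simp
      moreover have "p + (v $ j - u $ j) *\<^sub>R axis j 1 = (\<chi> i. if i \<in> insert j A then v $ i else u $ i)"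
        using insert.hyps by (auto simp: p_def vec_eq_iff axis_def)
      ultimately show ?case using insert.IH by (simp add: p_def)
    qed
    from this[of UNIV] show ?thesis by simp
  qed
  moreover have "\<forall>\<^sub>F v in nhds u. \<forall>i. \<bar>v $ i - u $ i\<bar> < e"
  proof -
    have "\<bar>v $ i - u $ i\<bar> < e" if "dist v u < e" for v i
      using that component_le_norm_cart[of "v - u" i] by (simp add: dist_norm)
    then show ?thesis using e(1) by (auto simp: eventually_nhds_metric)
  qed
  ultimately show ?thesis by (auto elim: eventually_mono)
qed

lemma zero_partials_constant:
  fixes w :: "real^'n::finite \<Rightarrow> real"
  assumes "open U" "connected U" "u \<in> U" "v \<in> U"
    and "\<And>v i. v \<in> U \<Longrightarrow> ((\<lambda>s. w (v + s *\<^sub>R axis i 1)) has_real_derivative 0) (at 0)"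
  shows "w u = w v"
proof (rule connected_local_const[OF assms(2,3,4)], intro ballI)
  fix a assume "a \<in> U"
  from zero_partials_locally_constant[OF assms(1) this assms(5)]
  have "\<forall>\<^sub>F v in nhds a. w a = w v" by (auto elim: eventually_mono)
  then show "\<forall>\<^sub>F v in at a within U. w a = w v"
    unfolding eventually_at_filter by (rule eventually_mono) simp
qed

context
  fixes U :: "(real^'n::finite) set" and S :: "'n jet set"
  assumes U: "open U" "connected U" and S_def: "S = jet_dom U"
begin

lemma open_S: "open S" unfolding S_def by (rule open_jet_dom[OF U(1)])

lemma in_S_iff: "z \<in> S \<longleftrightarrow> snd z 1 \<in> U" by (simp add: S_def jet_dom_def)

text \<open>A function of finite order sees finitely many vectors \<open>J k\<close>, which can be
  exchanged one after the other. Only \<open>J 1\<close> is confined, to the connected set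
  \<open>U\<close>; the other variables range over whole spaces, so that all intermediate jets lie
  in \<open>S\<close>.\<close>

lemma jet_constant:
  assumes a: "differential_function_on S a" and d: "\<And>e z. z \<in> S \<Longrightarrow> jet_d e a z = 0"
    and z: "z \<in> S" "z' \<in> S"
  shows "a z = a z'"
proof -
  have D: "((\<lambda>s. a (jet_move e z s)) has_real_derivative 0) (at 0)" if "z \<in> S" for e z
    using jet_smooth_has_derivative[OF diff_fun_smooth[OF a] that, of e] d[OF that] by simp
  have coord: "a (x, J(k := v)) = a (x, J(k := v'))"
    if JS: "k = 1 \<Longrightarrow> v \<in> U \<and> v' \<in> U" "k \<noteq> 1 \<Longrightarrow> J 1 \<in> U" for x J k v v'
  proof (rule zero_partials_constant[where U="if k = 1 then U else UNIV" and w="\<lambda>v. a (x, J(k := v))"])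
    fix v i assume "v \<in> (if k = 1 then U else UNIV)"
    then have "(x, J(k := v)) \<in> S" using JS by (auto simp: in_S_iff split: if_splits)
    from D[OF this, of "Some (k, i)"]
    show "((\<lambda>s. a (x, J(k := v + s *\<^sub>R axis i 1))) has_real_derivative 0) (at 0)"
      by (simp add: jet_shift_def)
  qed (use U JS in auto)
  have x: "a (x, J) = a (x', J)" if "J 1 \<in> U" for x x' J
  proof -
    have "((\<lambda>x. a (x, J)) has_real_derivative 0) (at y)" for y
      using D[of "(y, J)" None] that deriv_shift_real[of "\<lambda>x. a (x, J)" 0 y 0] by (simp add: in_S_iff)
    then show ?thesis using DERIV_isconst_all[of "\<lambda>x. a (x, J)" x x'] by blast
  qed
  have all: "a (x, J) = a (x, \<lambda>k. if k < m then J' k else J k)" if J: "J 1 \<in> U" "J' 1 \<in> U" for x J J' m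
  proof (induction m)
    case (Suc m)
    define K where "K = (\<lambda>k. if k < m then J' k else J k)"
    have "(\<lambda>k. if k < Suc m then J' k else J k) = K(m := J' m)" "K = K(m := J m)"
      by (auto simp: K_def fun_eq_iff less_Suc_eq)
    moreover have "a (x, K(m := J m)) = a (x, K(m := J' m))"
      using J by (intro coord) (auto simp: K_def)
    ultimately show ?case using Suc by (simp add: K_def)
  qed simp
  obtain N where N: "jet_order_le N S a" using a diff_fun_iff by blast
  have "a (fst z, snd z) = a (fst z', snd z)" using z by (intro x) (simp add: in_S_iff)
  also have "\<dots> = a (fst z', \<lambda>k. if k < Suc N then snd z' k else snd z k)"
    using z by (intro all) (auto simp: in_S_iff)
  also have "\<dots> = a z'"
    using N[unfolded jet_order_le_def, rule_format, of "(fst z', \<lambda>k. if k < Suc N then snd z' k else snd z k)" z'] z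
    by (auto simp: in_S_iff)
  finally show ?thesis by simp
qed

lemma jet_d_total_dx_field:
  assumes "\<And>z. z \<in> S \<Longrightarrow> total_dx f z = F (snd z 1)" "\<And>i. e \<noteq> Some (1, i)" "z \<in> S"
  shows "jet_d e (total_dx f) z = 0"
proof -
  have "jet_d e (total_dx f) z = jet_d e (\<lambda>z. F (snd z 1)) z"
    by (rule jet_d_cong[OF open_S assms(3,1)])
  also have "\<dots> = 0"
  proof (rule jet_d_eqI)
    have "snd (jet_move e z s) 1 = snd z 1" for s using assms(2) by (intro jet_move_other) auto
    then show "((\<lambda>s. F (snd (jet_move e z s) 1)) has_real_derivative 0) (at 0)" by simp
  qed
  finally show ?thesis .
qed

text \<open>Downward induction from the order. As \<open>F\<close> depends on \<open>snd z 1\<close>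
  only, the derivative of \<open>total_dx f\<close> along a jet variable of index
  \<open>l + 2\<close> vanishes; by the commutator rule the derivative of \<open>f\<close> of index
  \<open>l + 1\<close> is minus the total derivative of the one of index \<open>l + 2\<close>, which
  is zero already. So \<open>f\<close> involves \<open>x\<close> and \<open>b\<close> alone.\<close>

lemma total_dx_field_imp_order_0:
  assumes f: "differential_function_on S f" and F: "\<And>z. z \<in> S \<Longrightarrow> total_dx f z = F (snd z 1)"
  shows "z \<in> S \<Longrightarrow> jet_d (Some (Suc k, i)) f z = 0"
proof -
  obtain N where N: "jet_order_le N S f" using f diff_fun_iff by blast
  have "\<forall>z\<in>S. jet_d (Some (Suc (N - m), i)) f z = 0" for m
  proof (induction m)
    case 0
    then show ?case using jet_d_above_order[OF open_S N] by simp
  next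
    case (Suc m)
    show ?case
    proof (cases "N \<le> m")
      case True
      with Suc show ?thesis by simp
    next
      case False
      then obtain l where l: "N - m = Suc l" "N - Suc m = l" by (metis Suc_diff_Suc not_le)
      show ?thesis unfolding l
      proof
        fix z assume z: "z \<in> S"
        have "jet_d (Some (Suc (Suc l), i)) (total_dx f) z = 0"
          by (rule jet_d_total_dx_field[OF F _ z]) auto
        moreover have "total_dx (jet_d (Some (Suc (Suc l), i)) f) z = total_dx (\<lambda>z. 0) z"
          using Suc.IH unfolding l by (intro total_dx_cong[OF open_S z]) auto
        ultimately show "jet_d (Some (Suc l, i)) f z = 0"
          using jet_d_total_dx[OF open_S f z, of "Some (Suc (Suc l), i)"] by (simp add: total_dx_const)
      qed
    qed
  qed
  from this[of "N - k"] show "z \<in> S \<Longrightarrow> jet_d (Some (Suc k, i)) f z = 0"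
    using jet_d_above_order[OF open_S N, of "Suc k" z i] by (cases "k \<le> N") auto
qed

lemma total_dx_field_eq:
  assumes f: "differential_function_on S f" and F: "\<And>z. z \<in> S \<Longrightarrow> total_dx f z = F (snd z 1)"
    and z: "z \<in> S"
  shows "total_dx f z = jet_d None f z + (\<Sum>i\<in>UNIV. jet_d (Some (0, i)) f z * snd z 1 $ i)"
proof -
  obtain N where N: "jet_order_le N S f" using f diff_fun_iff by blast
  have "(\<Sum>k\<le>N. \<Sum>i\<in>UNIV. jet_d (Some (k, i)) f z * snd z (Suc k) $ i) =
    (\<Sum>k\<le>N. if k = 0 then \<Sum>i\<in>UNIV. jet_d (Some (0, i)) f z * snd z 1 $ i else 0)"
    using total_dx_field_imp_order_0[OF f F z] by (intro sum.cong) (auto simp: gr0_conv_Suc)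
  then show ?thesis by (simp add: total_dx_finite[OF open_S N z])
qed

text \<open>For the zero field the downward induction gains one step: the derivative of
  \<open>total_dx a\<close> along \<open>u\<close> vanishes too, which removes the dependence on
  \<open>b\<close>. What remains of \<open>total_dx a\<close> is the
  \<open>x\<close>-derivative.\<close>

lemma total_dx_zero_imp_constant:
  assumes a: "differential_function_on S a" and 0: "\<And>z. z \<in> S \<Longrightarrow> total_dx a z = 0"
    and z: "z \<in> S" "z' \<in> S"
  shows "a z = a z'"
proof -
  have s: "jet_d (Some (Suc k, i)) a z = 0" if "z \<in> S" for k i z
    using total_dx_field_imp_order_0[OF a, of "\<lambda>_. 0"] 0 that by blast
  have b: "jet_d (Some (0, i)) a z = 0" if zS: "z \<in> S" for i z
  proof -
    have "jet_d (Some (1, i)) (total_dx a) z = jet_d (Some (1, i)) (\<lambda>z. 0) z"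
      by (rule jet_d_cong[OF open_S zS 0])
    moreover have "total_dx (jet_d (Some (1, i)) a) z = total_dx (\<lambda>z. 0) z"
      using s[of _ 0] by (intro total_dx_cong[OF open_S zS]) auto
    ultimately show ?thesis
      using jet_d_total_dx[OF open_S a zS, of "Some (1, i)"] by (simp add: jet_d_const total_dx_const)
  qed
  have x: "jet_d None a z = 0" if "z \<in> S" for z
    using total_dx_field_eq[OF a, of "\<lambda>_. 0"] 0 that b by simp
  have "jet_d e a z = 0" if "z \<in> S" for e z
  proof (cases e)
    case (Some p)
    obtain k i where "p = (k, i)" by force
    with Some s b that show ?thesis by (cases k) auto
  qed (use x that in simp)
  then show ?thesis by (rule jet_constant[OF a _ z])
qed

text \<open>Derivatives along \<open>x\<close> and \<open>b\<close> commute with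
  \<open>total_dx\<close> and annihilate \<open>F (snd z 1)\<close>. Hence those of \<open>f\<close>
  lie in the kernel of \<open>total_dx\<close> and are constant.\<close>

lemma total_dx_field_imp_affine:
  assumes f: "differential_function_on S f" and F: "\<And>z. z \<in> S \<Longrightarrow> total_dx f z = F (snd z 1)"
    and ne: "U \<noteq> {}"
  obtains \<eta> \<xi> \<zeta> where "\<And>z. z \<in> S \<Longrightarrow> f z = \<eta> \<bullet> snd z 0 + \<xi> * fst z + \<zeta>"
    "\<And>u. u \<in> U \<Longrightarrow> F u = \<eta> \<bullet> u + \<xi>"
proof -
  obtain u0 where u0: "u0 \<in> U" using ne by blast
  define z0 :: "'n jet" where "z0 = (0, \<lambda>k. u0)"
  have z0: "z0 \<in> S" using u0 by (simp add: z0_def in_S_iff)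
  have const: "jet_d e f z = jet_d e f z0" if e: "e = None \<or> (\<exists>i. e = Some (0, i))" and z: "z \<in> S" for e z
  proof (rule total_dx_zero_imp_constant[OF diff_fun_d[OF open_S f] _ z z0])
    fix z assume z: "z \<in> S"
    have "jet_d e (total_dx f) z = 0" using e by (intro jet_d_total_dx_field[OF F _ z]) auto
    then show "total_dx (jet_d e f) z = 0"
      using jet_d_total_dx[OF open_S f z, of e] e by auto
  qed
  define \<eta> :: "real^'n" where "\<eta> = (\<chi> i. jet_d (Some (0, i)) f z0)"
  define \<xi> where "\<xi> = jet_d None f z0"
  have e1: "jet_d None f z = \<xi>" if "z \<in> S" for z using const[OF _ that, of None] by (simp add: \<xi>_def)
  have e2: "jet_d (Some (0, i)) f z = \<eta> $ i" if "z \<in> S" for z i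
    using const[OF _ that, of "Some (0, i)"] by (simp add: \<eta>_def)
  \<comment> \<open>The candidate linear part is taken with a minus sign, so that all derivatives of
    \<open>f z + lin z\<close> vanish.\<close>
  define lin where "lin = (\<lambda>z::'n jet. (\<Sum>i\<in>UNIV. (- \<eta> $ i) * snd z 0 $ i) + (- \<xi>) * fst z)"
  note df = diff_fun_sum[OF open_S] diff_fun_mult[OF open_S]
     diff_fun_const[OF open_S] diff_fun_coord[OF open_S]
     diff_fun_fst[OF open_S] diff_fun_add[OF open_S]
  have dlin: "differential_function_on S lin" unfolding lin_def by (intro df)
  have jlin: "jet_d e lin z = (\<Sum>i\<in>UNIV. if e = Some (0, i) then - \<eta> $ i else 0) +
      (if e = None then - \<xi> else 0)" for e z
  proof (rule jet_d_eqI)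
    show "((\<lambda>s. lin (jet_move e z s)) has_real_derivative
      (\<Sum>i\<in>UNIV. if e = Some (0, i) then - \<eta> $ i else 0) + (if e = None then - \<xi> else 0)) (at 0)"
      unfolding lin_def fst_jet_move snd_jet_move_nth
      by (intro DERIV_add DERIV_sum) (auto intro!: derivative_eq_intros)
  qed
  have sum_const: "f z + lin z = f z0 + lin z0" if z: "z \<in> S" for z
  proof (rule jet_constant[OF diff_fun_add[OF open_S f dlin] _ z z0])
    fix e and z :: "'n jet" assume z: "z \<in> S"
    have "jet_d e f z + jet_d e lin z = 0"
    proof (cases e)
      case None
      then show ?thesis using e1[OF z] by (simp add: jlin)
    next
      case (Some p)
      obtain k i where p: "p = (k, i)" by force
      show ?thesis
      proof (cases k)
        case 0
        then show ?thesis using e2[OF z, of i] by (simp add: jlin Some p)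
      next
        case (Suc l)
        then show ?thesis using total_dx_field_imp_order_0[OF f F z, of l i] by (simp add: jlin Some p)
      qed
    qed
    then show "jet_d e (\<lambda>z. f z + lin z) z = 0" by (simp add: jet_d_add[OF open_S f dlin z])
  qed
  have lin_eq: "lin z = - (\<eta> \<bullet> snd z 0 + \<xi> * fst z)" for z
    by (simp add: lin_def inner_vec_def sum_negf)
  have "f z = \<eta> \<bullet> snd z 0 + \<xi> * fst z + (f z0 + lin z0)" if "z \<in> S" for z
    using sum_const[OF that] lin_eq[of z] by linarith
  moreover have "F u = \<eta> \<bullet> u + \<xi>" if "u \<in> U" for u
  proof -
    let ?z = "(0, \<lambda>k. u) :: 'n jet"
    have z: "?z \<in> S" using that by (simp add: in_S_iff)
    show ?thesis
      using F[OF z] total_dx_field_eq[OF f F z] e1[OF z] e2[OF z] by (simp add: inner_vec_def)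
  qed
  ultimately show ?thesis by (rule that)
qed

end

section \<open>Derivations of vector-valued differential functions\<close>

text \<open>The rules common to \<open>jet_d e\<close> and \<open>total_dx\<close>, restricted to
  differential functions, for which both obey the Leibniz rule. The calculus of vector-valued
  functions is then developed once for the two.\<close>

definition jet_derivation ::
    "'n::finite jet set \<Rightarrow> (('n jet \<Rightarrow> real) \<Rightarrow> 'n jet \<Rightarrow> real) \<Rightarrow> bool" where
  "jet_derivation S \<delta> \<longleftrightarrow> open S \<and>
     (\<forall>f h z. differential_function_on S f \<longrightarrow> differential_function_on S h \<longrightarrow> z \<in> S \<longrightarrow>
        \<delta> (\<lambda>z. f z + h z) z = \<delta> f z + \<delta> h z \<and>
        \<delta> (\<lambda>z. f z * h z) z = \<delta> f z * h z + f z * \<delta> h z) \<and>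
     (\<forall>k z. \<delta> (\<lambda>z. k) z = 0)"

lemma jet_derivation_jet_d: "open S \<Longrightarrow> jet_derivation S (jet_d e)"
  by (simp add: jet_derivation_def jet_d_add jet_d_mult jet_d_const)

lemma jet_derivation_total_dx: "open S \<Longrightarrow> jet_derivation S total_dx"
  by (simp add: jet_derivation_def total_dx_add total_dx_mult total_dx_const)

definition jet_field_on :: "'n::finite jet set \<Rightarrow> ('n jet \<Rightarrow> 'e::euclidean_space) \<Rightarrow> bool" where
  "jet_field_on S P \<longleftrightarrow> (\<forall>b\<in>Basis. differential_function_on S (\<lambda>z. P z \<bullet> b))"

definition jet_vec ::
    "(('n jet \<Rightarrow> real) \<Rightarrow> 'n jet \<Rightarrow> real) \<Rightarrow> ('n::finite jet \<Rightarrow> 'e::euclidean_space) \<Rightarrow> 'n jet \<Rightarrow> 'e" where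
  "jet_vec \<delta> P z = (\<Sum>b\<in>Basis. \<delta> (\<lambda>z. P z \<bullet> b) z *\<^sub>R b)"

lemma jet_field_on_real: "jet_field_on S f \<longleftrightarrow> differential_function_on S (f :: _ \<Rightarrow> real)"
  by (simp add: jet_field_on_def)

lemma jet_vec_real: "jet_vec \<delta> f z = \<delta> (f :: _ \<Rightarrow> real) z"
  by (simp add: jet_vec_def)

lemma jet_vec_inner: "b \<in> Basis \<Longrightarrow> jet_vec \<delta> P z \<bullet> b = \<delta> (\<lambda>z. P z \<bullet> b) z"
  by (simp add: jet_vec_def inner_sum_left inner_Basis if_distrib[of "\<lambda>x. _ * x"] cong: if_cong)

lemma jet_vec_eqI: "(\<And>b. b \<in> Basis \<Longrightarrow> \<delta> (\<lambda>z. P z \<bullet> b) z = v \<bullet> b) \<Longrightarrow> jet_vec \<delta> P z = v"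
  by (rule euclidean_eqI) (simp add: jet_vec_inner)

context
  fixes S :: "'n::finite jet set" and \<delta> :: "('n jet \<Rightarrow> real) \<Rightarrow> 'n jet \<Rightarrow> real"
  assumes \<delta>: "jet_derivation S \<delta>"
begin

lemma derivation_open: "open S" using \<delta> by (simp add: jet_derivation_def)

lemma derivation_const: "\<delta> (\<lambda>z. k) z = 0"
  using \<delta> unfolding jet_derivation_def by blast

lemma derivation_add:
  assumes "differential_function_on S f" "differential_function_on S h" "z \<in> S"
  shows "\<delta> (\<lambda>z. f z + h z) z = \<delta> f z + \<delta> h z"
  using \<delta> assms unfolding jet_derivation_def by blast

lemma derivation_mult:
  assumes "differential_function_on S f" "differential_function_on S h" "z \<in> S"
  shows "\<delta> (\<lambda>z. f z * h z) z = \<delta> f z * h z + f z * \<delta> h z"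
  using \<delta> assms unfolding jet_derivation_def by blast

lemma derivation_sum:
  assumes "\<And>i. i \<in> I \<Longrightarrow> differential_function_on S (f i)" "z \<in> S"
  shows "\<delta> (\<lambda>z. \<Sum>i\<in>I. f i z) z = (\<Sum>i\<in>I. \<delta> (f i) z)"
  using assms(1)
proof (induction I rule: infinite_finite_induct)
  case (insert j I)
  then have "\<delta> (\<lambda>z. f j z + (\<Sum>i\<in>I. f i z)) z = \<delta> (f j) z + \<delta> (\<lambda>z. \<Sum>i\<in>I. f i z) z"
    by (intro derivation_add diff_fun_sum[OF derivation_open] assms(2)) auto
  with insert show ?case by simp
qed (simp_all add: derivation_const)

lemma derivation_cmult:
  assumes "differential_function_on S f" "z \<in> S"
  shows "\<delta> (\<lambda>z. f z * k) z = \<delta> f z * k"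
  using derivation_mult[OF assms(1) diff_fun_const[OF derivation_open] assms(2), of k]
  by (simp add: derivation_const)

lemma jet_vec_add:
  assumes "jet_field_on S P" "jet_field_on S R" "z \<in> S"
  shows "jet_vec \<delta> (\<lambda>z. P z + R z) z = jet_vec \<delta> P z + jet_vec \<delta> R z"
  using assms
  by (intro jet_vec_eqI) (simp add: inner_add_left jet_vec_inner derivation_add jet_field_on_def)

lemma jet_vec_const: "jet_vec \<delta> (\<lambda>z. k) z = 0"
  by (intro jet_vec_eqI) (simp add: derivation_const)

text \<open>In bases, the components of \<open>\<beta> (P z) (R z)\<close> are sums of products of
  coordinates with constant coefficients, so the scalar Leibniz rule carries over to every bilinear
  map.\<close>

lemma jet_vec_bilinear:
  fixes \<beta> :: "'a::euclidean_space \<Rightarrow> 'b::euclidean_space \<Rightarrow> 'c::euclidean_space"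
  assumes \<beta>: "bilinear \<beta>" and P: "jet_field_on S P" and R: "jet_field_on S R"
  shows "jet_field_on S (\<lambda>z. \<beta> (P z) (R z))"
    and "z \<in> S \<Longrightarrow> jet_vec \<delta> (\<lambda>z. \<beta> (P z) (R z)) z = \<beta> (jet_vec \<delta> P z) (R z) + \<beta> (P z) (jet_vec \<delta> R z)"
proof -
  have expand: "\<beta> v w \<bullet> c = (\<Sum>b\<in>Basis. \<Sum>b'\<in>Basis. ((v \<bullet> b) * (w \<bullet> b')) * (\<beta> b b' \<bullet> c))" for v w c
  proof -
    have "\<beta> v w = \<beta> (\<Sum>b\<in>Basis. (v \<bullet> b) *\<^sub>R b) (\<Sum>b'\<in>Basis. (w \<bullet> b') *\<^sub>R b')"
      by (simp add: euclidean_representation)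
    also have "\<dots> = (\<Sum>(b, b')\<in>Basis \<times> Basis. \<beta> ((v \<bullet> b) *\<^sub>R b) ((w \<bullet> b') *\<^sub>R b'))"
      by (rule bilinear_sum[OF \<beta>])
    finally show ?thesis
      by (simp add: sum.cartesian_product[symmetric] bilinear_lmul[OF \<beta>] bilinear_rmul[OF \<beta>]
          inner_sum_left mult_ac)
  qed
  have eP: "\<beta> (P z) (R z) \<bullet> c = (\<Sum>b\<in>Basis. \<Sum>b'\<in>Basis. ((P z \<bullet> b) * (R z \<bullet> b')) * (\<beta> b b' \<bullet> c))" for z c
    by (rule expand)
  have dP: "differential_function_on S (\<lambda>z. P z \<bullet> b)" "differential_function_on S (\<lambda>z. R z \<bullet> b')"
    if "b \<in> Basis" "b' \<in> Basis" for b b'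
    using P R that by (auto simp: jet_field_on_def)
  note df = diff_fun_sum[OF derivation_open] diff_fun_mult[OF derivation_open]
     diff_fun_const[OF derivation_open] dP
  show "jet_field_on S (\<lambda>z. \<beta> (P z) (R z))"
    unfolding jet_field_on_def eP by (intro ballI df)
  show "jet_vec \<delta> (\<lambda>z. \<beta> (P z) (R z)) z = \<beta> (jet_vec \<delta> P z) (R z) + \<beta> (P z) (jet_vec \<delta> R z)" if z: "z \<in> S"
  proof (rule jet_vec_eqI)
    fix c :: 'c assume "c \<in> Basis"
    have "\<delta> (\<lambda>z. \<beta> (P z) (R z) \<bullet> c) z =
      (\<Sum>b\<in>Basis. \<delta> (\<lambda>z. \<Sum>b'\<in>Basis. ((P z \<bullet> b) * (R z \<bullet> b')) * (\<beta> b b' \<bullet> c)) z)"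
      unfolding eP by (intro derivation_sum df z)
    also have "\<dots> = (\<Sum>b\<in>Basis. \<Sum>b'\<in>Basis. \<delta> (\<lambda>z. ((P z \<bullet> b) * (R z \<bullet> b')) * (\<beta> b b' \<bullet> c)) z)"
      by (intro sum.cong refl derivation_sum df z)
    also have "\<dots> = (\<Sum>b\<in>Basis. \<Sum>b'\<in>Basis. \<delta> (\<lambda>z. (P z \<bullet> b) * (R z \<bullet> b')) z * (\<beta> b b' \<bullet> c))"
      by (intro sum.cong refl derivation_cmult df z)
    also have "\<dots> = (\<Sum>b\<in>Basis. \<Sum>b'\<in>Basis.
       ((jet_vec \<delta> P z \<bullet> b) * (R z \<bullet> b') + (P z \<bullet> b) * (jet_vec \<delta> R z \<bullet> b')) * (\<beta> b b' \<bullet> c))"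
      by (intro sum.cong refl) (simp add: derivation_mult[OF dP(1) dP(2) z] jet_vec_inner)
    also have "\<dots> = (\<beta> (jet_vec \<delta> P z) (R z) + \<beta> (P z) (jet_vec \<delta> R z)) \<bullet> c"
      by (simp add: expand[of "jet_vec \<delta> P z"] expand[of "P z" "jet_vec \<delta> R z"] inner_add_left sum.distrib distrib_right)
    finally show "\<delta> (\<lambda>z. \<beta> (P z) (R z) \<bullet> c) z = (\<beta> (jet_vec \<delta> P z) (R z) + \<beta> (P z) (jet_vec \<delta> R z)) \<bullet> c" .
  qed
qed

lemma jet_field_on_const: "jet_field_on S (\<lambda>z. k)"
  unfolding jet_field_on_def using diff_fun_const[OF derivation_open] by blast

lemma jet_vec_linear:
  fixes L :: "'a::euclidean_space \<Rightarrow> 'c::euclidean_space"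
  assumes L: "linear L" and P: "jet_field_on S P"
  shows "jet_field_on S (\<lambda>z. L (P z))"
    and "z \<in> S \<Longrightarrow> jet_vec \<delta> (\<lambda>z. L (P z)) z = L (jet_vec \<delta> P z)"
proof -
  have b: "bilinear (\<lambda>(t::real) x. t *\<^sub>R L x)"
    unfolding bilinear_def using L
    by (auto intro!: linearI simp: scaleR_left_distrib linear_add linear_cmul scaleR_right_distrib)
  show "jet_field_on S (\<lambda>z. L (P z))"
    using jet_vec_bilinear(1)[OF b jet_field_on_const[of 1] P] by simp
  show "z \<in> S \<Longrightarrow> jet_vec \<delta> (\<lambda>z. L (P z)) z = L (jet_vec \<delta> P z)"
    using jet_vec_bilinear(2)[OF b jet_field_on_const[of 1] P] by (simp add: jet_vec_const)
qed

end

lemma jet_field_on_add: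
  "open S \<Longrightarrow> jet_field_on S P \<Longrightarrow> jet_field_on S R \<Longrightarrow> jet_field_on S (\<lambda>z. P z + R z)"
  by (simp add: jet_field_on_def inner_add_left diff_fun_add)

lemma jet_field_on_coord: "open S \<Longrightarrow> jet_field_on S (\<lambda>z. snd z k)"
  by (auto simp: jet_field_on_def Basis_vec_def inner_axis diff_fun_coord)

lemma jet_field_on_fst: "open S \<Longrightarrow> jet_field_on S fst"
  by (simp add: jet_field_on_real diff_fun_fst)

lemma jet_vec_total_dx_coord: "jet_vec total_dx (\<lambda>z. snd z k) z = snd z (Suc k)"
  by (rule jet_vec_eqI) (auto simp: Basis_vec_def inner_axis total_dx_coord)

lemma jet_vec_total_dx_fst: "jet_vec total_dx fst z = 1"
  by (simp add: jet_vec_real total_dx_fst)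

lemma axis_nth_ne: "i \<noteq> j \<Longrightarrow> axis i x $ j = 0"
  by (simp add: axis_def)

lemma jet_vec_jet_d_coord:
  "jet_vec (jet_d e) (\<lambda>z. snd z k) z = (case e of Some (l, i) \<Rightarrow> if l = k then axis i 1 else 0 | None \<Rightarrow> 0)"
  by (rule jet_vec_eqI)
    (auto simp: Basis_vec_def inner_axis jet_d_coord axis_nth axis_nth_ne split: option.splits)

lemma jet_vec_jet_d_fst: "jet_vec (jet_d e) fst z = (if e = None then 1 else 0)"
  by (simp add: jet_vec_real jet_d_fst)

section \<open>From linear congruences to Hamiltonian systems\<close>

lemma matrix_vector_axis_sum: "(M *v y) $ i = (\<Sum>j\<in>UNIV. M $ i $ j * y $ j)"
  for M :: "real^'n::finite^'m::finite"
  by (simp add: matrix_vector_mult_def)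

lemma linear_axis_sum:
  fixes L :: "real^'n::finite \<Rightarrow> 'b::real_vector"
  assumes "linear L"
  shows "L y = (\<Sum>j\<in>UNIV. y $ j *\<^sub>R L (axis j 1))"
proof -
  have "L y = L (\<Sum>j\<in>UNIV. y $ j *\<^sub>R axis j 1)"
    using basis_expansion[of y] by (simp add: scalar_mult_eq_scaleR)
  then show ?thesis by (simp add: linear_sum[OF assms] linear_scale[OF assms])
qed

lemma bilinear_linear: "bilinear \<beta> \<Longrightarrow> linear (\<beta> x)" "bilinear \<beta> \<Longrightarrow> linear (\<lambda>x. \<beta> x y)"
  by (simp_all add: bilinear_def)

text \<open>\<open>B\<close> is a scalar product of any signature, and \<open>\<Psi>\<close> sends
  the coordinate axes to a frame; injectivity suffices for this, the dimensions being equal. The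
  Gram matrix plays the part of the metric with lower indices.\<close>

locale metric_frame =
  fixes B :: "real^'n::finite \<Rightarrow> real^'n \<Rightarrow> real" and \<Psi> :: "real^'n \<Rightarrow> real^'n"
  assumes bil: "bilinear B" and sym: "\<And>v w. B v w = B w v"
    and nondeg: "\<And>v. (\<And>w. B w v = 0) \<Longrightarrow> v = 0"
    and lin: "linear \<Psi>" and inj: "\<And>y. \<Psi> y = 0 \<Longrightarrow> y = 0"
begin

definition gram :: "real^'n^'n" where "gram = (\<chi> i j. B (\<Psi> (axis i 1)) (\<Psi> (axis j 1)))"

lemma gram_mult: "(gram *v y) $ i = B (\<Psi> (axis i 1)) (\<Psi> y)"
proof -
  have "linear (\<lambda>y. B (\<Psi> (axis i 1)) (\<Psi> y))"
    using linear_compose[OF lin bilinear_linear(1)[OF bil]] by (simp add: o_def)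
  from linear_axis_sum[OF this, of y] show ?thesis
    by (simp add: matrix_vector_axis_sum gram_def mult.commute)
qed

lemma frame_surj: obtains y where "v = \<Psi> y"
proof -
  have "inj \<Psi>" using linear_injective_0[OF lin] inj by blast
  then have "surj \<Psi>" using linear_injective_imp_surjective[OF lin] by simp
  then show ?thesis using that by blast
qed

lemma det_gram: "det gram \<noteq> 0"
proof -
  have "y = 0" if "gram *v y = 0" for y
  proof (rule inj, rule nondeg)
    fix w
    obtain x where x: "w = \<Psi> x" by (rule frame_surj)
    have "linear (\<lambda>x. B (\<Psi> x) (\<Psi> y))"
      using linear_compose[OF lin bilinear_linear(2)[OF bil]] by (simp add: o_def)
    from linear_axis_sum[OF this, of x] show "B w (\<Psi> y) = 0"
      using gram_mult[of y] that by (simp add: x)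
  qed
  then show ?thesis
    using matrix_left_invertible_ker[of gram] invertible_left_inverse invertible_det_nz by blast
qed

text \<open>The numbers \<open>B (\<Psi> (axis j 1)) v\<close> are the covariant components of
  \<open>v\<close> in the frame, and the inverse Gram matrix contracts them to the scalar product.
  In this way contractions with the upper metric in the Hamiltonian conditions become values of
  \<open>B\<close>.\<close>

lemma inverse_metric:
  "(\<Sum>j\<in>UNIV. \<Sum>a\<in>UNIV. matrix_inv gram $ j $ a * B (\<Psi> (axis j 1)) v * B (\<Psi> (axis a 1)) w) = B v w"
proof -
  obtain x where x: "v = \<Psi> x" by (rule frame_surj)
  obtain y where y: "w = \<Psi> y" by (rule frame_surj)
  have gG: "matrix_inv gram *v (gram *v y) = y"
    by (simp add: matrix_vector_mul_assoc matrix_inv_inverse[OF det_gram])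
  have "(\<Sum>j\<in>UNIV. \<Sum>a\<in>UNIV. matrix_inv gram $ j $ a * B (\<Psi> (axis j 1)) v * B (\<Psi> (axis a 1)) w) =
     (\<Sum>j\<in>UNIV. B (\<Psi> (axis j 1)) v * (matrix_inv gram *v (gram *v y)) $ j)"
    unfolding matrix_vector_axis_sum[of "matrix_inv gram"] gram_mult y[symmetric]
    by (simp add: sum_distrib_left mult_ac)
  also have "\<dots> = (\<Sum>j\<in>UNIV. y $ j * B (\<Psi> (axis j 1)) v)" by (simp add: gG mult.commute)
  also have "\<dots> = B (\<Psi> y) v"
  proof -
    have "linear (\<lambda>y. B (\<Psi> y) v)"
      using linear_compose[OF lin bilinear_linear(2)[OF bil]] by (simp add: o_def)
    from linear_axis_sum[OF this, of y] show ?thesis by simp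
  qed
  finally show ?thesis by (simp add: y sym)
qed

end

text \<open>The space of \<open>(b, x, t)\<close>, nested so that an alternating form on the
  \<open>b\<close>-space can be extended to \<open>x\<close> and to \<open>t\<close> by adding one
  real coordinate at a time.\<close>

type_synonym 'n ambient = "((real, 'n) vec \<times> real) \<times> real"

text \<open>The identity in four arguments is the vanishing of the alternation of
  \<open>B (A X Y) (A Z T)\<close>; three pairings remain because \<open>A\<close> is alternating
  and \<open>B\<close> symmetric. The last condition only asks for injectivity of
  \<open>y \<mapsto> A(p, y)\<close>, which gives bijectivity by equality of dimensions.\<close>

definition linear_congruence_on ::
    "(real^'n::finite) set \<Rightarrow> (real^'n \<Rightarrow> real^'n) \<Rightarrow>
     ('n ambient \<Rightarrow> 'n ambient \<Rightarrow> real^'n) \<Rightarrow> (real^'n \<Rightarrow> real^'n \<Rightarrow> real) \<Rightarrow> bool" where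
  "linear_congruence_on U V A B \<longleftrightarrow>
     bilinear A \<and> (\<forall>X Y. A X Y = - A Y X) \<and>
     bilinear B \<and> (\<forall>v w. B v w = B w v) \<and> (\<forall>v. (\<forall>w. B w v = 0) \<longrightarrow> v = 0) \<and>
     (\<forall>X Y Z T. B (A X Y) (A Z T) - B (A X Z) (A Y T) + B (A X T) (A Y Z) = 0) \<and>
     (\<forall>u\<in>U. A ((u, 1), 0) ((V u, 0), 1) = 0) \<and>
     (\<forall>u\<in>U. \<forall>y. A ((u, 1), 0) ((y, 0), 0) = 0 \<longrightarrow> y = 0)"

context
  fixes U :: "(real^'n::finite) set" and V :: "real^'n \<Rightarrow> real^'n"
    and A :: "'n ambient \<Rightarrow> 'n ambient \<Rightarrow> real^'n"
    and B :: "real^'n \<Rightarrow> real^'n \<Rightarrow> real"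
  assumes U: "open U" and cong: "linear_congruence_on U V A B"
begin

abbreviation (input) embed :: "real^'n \<Rightarrow> 'n ambient" where "embed y \<equiv> ((y, 0), 0)"

lemma lc_bilinear: "bilinear A" and lc_skew: "A X Y = - A Y X" and form_bilinear: "bilinear B" and form_sym: "B v w = B w v"
  and form_nondeg: "(\<And>w. B w v = 0) \<Longrightarrow> v = 0"
  and lc_quadric: "B (A X Y) (A Z T) - B (A X Z) (A Y T) + B (A X T) (A Y Z) = 0"
  and lc_line: "u \<in> U \<Longrightarrow> A ((u, 1), 0) ((V u, 0), 1) = 0"
  and lc_frame_inj: "u \<in> U \<Longrightarrow> A ((u, 1), 0) ((y, 0), 0) = 0 \<Longrightarrow> y = 0"
  using cong unfolding linear_congruence_on_def by blast+

section \<open>The third-order operator of a congruence\<close>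

definition frame_map :: "real^'n \<Rightarrow> real^'n \<Rightarrow> real^'n" where "frame_map u y = A ((u, 1), 0) (embed y)"

lemma linear_embed: "linear embed"
  by (rule linearI) (simp_all add: zero_prod_def[symmetric])

lemma lc_frame: "u \<in> U \<Longrightarrow> metric_frame B (frame_map u)"
proof (rule metric_frame.intro)
  show "linear (frame_map u)"
    using linear_compose[OF linear_embed bilinear_linear(1)[OF lc_bilinear]] by (simp add: o_def frame_map_def[abs_def])
qed (use form_bilinear form_sym form_nondeg lc_frame_inj in \<open>auto simp: frame_map_def\<close>)

definition lc_gram :: "real^'n \<Rightarrow> real^'n^'n" where "lc_gram u = metric_frame.gram B (frame_map u)"
definition lc_metric :: "real^'n \<Rightarrow> real^'n^'n" where "lc_metric u = matrix_inv (lc_gram u)"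
text \<open>Dictated by the condition on the derivative of the metric: along \<open>axis k 1\<close>
  the derivative of \<open>lc_gram u\<close> falls on either of the two frame vectors, and each of
  the two terms is minus one of these coefficients.\<close>

definition lc_c_low :: "'n \<Rightarrow> 'n \<Rightarrow> 'n \<Rightarrow> real^'n \<Rightarrow> real" where
  "lc_c_low m p k u = - B (frame_map u (axis m 1)) (A (embed (axis k 1)) (embed (axis p 1)))"
text \<open>The indices are raised crosswise because \<open>c_low\<close> contracts its first index
  with the second upper index of \<open>c\<close> and its second index with the first.\<close>

definition lc_c :: "real^'n \<Rightarrow> real^'n^'n^'n" where
  "lc_c u = (\<chi> p q k. \<Sum>i\<in>UNIV. \<Sum>j\<in>UNIV. lc_metric u $ q $ i * lc_metric u $ p $ j * lc_c_low i j k u)"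

lemma lc_gram_nth: "u \<in> U \<Longrightarrow> lc_gram u $ i $ j = B (frame_map u (axis i 1)) (frame_map u (axis j 1))"
  by (simp add: lc_gram_def metric_frame.gram_def[OF lc_frame])

lemma det_lc_gram: "u \<in> U \<Longrightarrow> det (lc_gram u) \<noteq> 0"
  by (simp add: lc_gram_def metric_frame.det_gram[OF lc_frame])

lemma metric_gram_inverse: "u \<in> U \<Longrightarrow> lc_metric u ** lc_gram u = mat 1" "u \<in> U \<Longrightarrow> lc_gram u ** lc_metric u = mat 1"
  by (simp_all add: lc_metric_def matrix_inv_inverse det_lc_gram)

lemma det_lc_metric: "u \<in> U \<Longrightarrow> det (lc_metric u) \<noteq> 0"
  using metric_gram_inverse det_mul[of "lc_metric u" "lc_gram u"] by force

lemma g_low_congruence: "u \<in> U \<Longrightarrow> g_low lc_metric i j u = lc_gram u $ i $ j"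
proof -
  assume u: "u \<in> U"
  have "matrix_inv (lc_metric u) = (lc_gram u ** lc_metric u) ** matrix_inv (lc_metric u)" by (simp add: metric_gram_inverse[OF u])
  also have "\<dots> = lc_gram u" by (simp add: matrix_mul_assoc[symmetric] matrix_inv_inverse det_lc_metric[OF u])
  finally show ?thesis by (simp add: g_low_def)
qed

lemma matrix_mult_sum: "(M ** N) $ i $ j = (\<Sum>k\<in>UNIV. M $ i $ k * N $ k $ j)" for M N :: "real^'n^'n"
  by (simp add: matrix_matrix_mult_def)

lemma gram_metric_sum: "u \<in> U \<Longrightarrow> (\<Sum>q\<in>UNIV. lc_gram u $ i $ q * lc_metric u $ q $ a) = (if i = a then 1 else 0)"
  using arg_cong[OF metric_gram_inverse(2), of u "\<lambda>M. M $ i $ a"] by (simp add: matrix_mult_sum mat_def)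

lemma c_low_congruence: "u \<in> U \<Longrightarrow> c_low lc_metric lc_c i j k u = lc_c_low i j k u"
proof -
  assume u: "u \<in> U"
  have "c_low lc_metric lc_c i j k u = (\<Sum>p\<in>UNIV. \<Sum>q\<in>UNIV. \<Sum>a\<in>UNIV. \<Sum>b\<in>UNIV.
     (lc_gram u $ i $ q * lc_metric u $ q $ a) * ((lc_gram u $ j $ p * lc_metric u $ p $ b) * lc_c_low a b k u))"
    by (simp add: c_low_def g_low_congruence[OF u] lc_c_def sum_distrib_left mult_ac)
  also have "\<dots> = (\<Sum>p\<in>UNIV. \<Sum>a\<in>UNIV. \<Sum>q\<in>UNIV. \<Sum>b\<in>UNIV.
     (lc_gram u $ i $ q * lc_metric u $ q $ a) * ((lc_gram u $ j $ p * lc_metric u $ p $ b) * lc_c_low a b k u))"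
    by (intro sum.cong refl sum.swap)
  also have "\<dots> = (\<Sum>p\<in>UNIV. \<Sum>a\<in>UNIV. (\<Sum>q\<in>UNIV. lc_gram u $ i $ q * lc_metric u $ q $ a) *
      (\<Sum>b\<in>UNIV. (lc_gram u $ j $ p * lc_metric u $ p $ b) * lc_c_low a b k u))"
    by (simp add: sum_product)
  also have "\<dots> = (\<Sum>p\<in>UNIV. \<Sum>b\<in>UNIV. (lc_gram u $ j $ p * lc_metric u $ p $ b) * lc_c_low i b k u)"
    by (simp add: gram_metric_sum[OF u] if_distrib[of "\<lambda>x. x * _"] cong: if_cong)
  also have "\<dots> = (\<Sum>b\<in>UNIV. \<Sum>p\<in>UNIV. (lc_gram u $ j $ p * lc_metric u $ p $ b) * lc_c_low i b k u)"
    by (rule sum.swap)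
  also have "\<dots> = lc_c_low i j k u"
    by (simp add: sum_distrib_right[symmetric] gram_metric_sum[OF u] if_distrib[of "\<lambda>x. x * _"] cong: if_cong)
  finally show ?thesis .
qed

lemma frame_map_has_derivative:
  "((\<lambda>u. frame_map u y) has_derivative (\<lambda>v. A (embed v) (embed y))) (at u)"
proof -
  have l: "linear (\<lambda>v. A (embed v) (embed y))"
    using linear_compose[OF linear_embed bilinear_linear(2)[OF lc_bilinear]] by (simp add: o_def)
  have "frame_map u y = A (embed u) (embed y) + A ((0, 1), 0) (embed y)" for u
    using bilinear_ladd[OF lc_bilinear, of "embed u" "((0, 1), 0)"] by (simp add: frame_map_def)
  then have "(\<lambda>u. frame_map u y) = (\<lambda>u. A (embed u) (embed y) + A ((0, 1), 0) (embed y))" by (rule ext)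
  moreover have "((\<lambda>u. A (embed u) (embed y) + A ((0, 1), 0) (embed y)) has_derivative (\<lambda>v. A (embed v) (embed y))) (at u)"
    using linear_imp_has_derivative[OF l, of "at u"] by (auto intro: has_derivative_add_const)
  ultimately show ?thesis by simp
qed

lemma smooth_on_frame_map: "smooth_on U (\<lambda>u. frame_map u y)"
proof -
  have l: "bounded_linear (\<lambda>v. A (embed v) (embed y))"
    using linear_compose[OF linear_embed bilinear_linear(2)[OF lc_bilinear]] by (simp add: o_def linear_conv_bounded_linear)
  have "frame_map u y = A (embed u) (embed y) + A ((0, 1), 0) (embed y)" for u
    using bilinear_ladd[OF lc_bilinear, of "embed u" "((0, 1), 0)"] by (simp add: frame_map_def)
  then have "(\<lambda>u. frame_map u y) = (\<lambda>u. A (embed u) (embed y) + A ((0, 1), 0) (embed y))" by (rule ext)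
  then show ?thesis using smooth_on_add[OF U smooth_on_bounded_linear[OF l] smooth_on_const] by simp
qed

lemma form_bounded_bilinear: "bounded_bilinear B"
  using form_bilinear by (simp add: bilinear_conv_bounded_bilinear)

lemma smooth_on_lc_gram: "smooth_on U (\<lambda>u. lc_gram u $ i $ j)"
proof -
  have "smooth_on U (\<lambda>u. B (frame_map u (axis i 1)) (frame_map u (axis j 1)))"
    by (intro bounded_bilinear.smooth_on_prod[OF form_bounded_bilinear U] smooth_on_frame_map)
  then show ?thesis using smooth_on_cong[OF U, of "\<lambda>u. lc_gram u $ i $ j"] lc_gram_nth by simp
qed

lemma smooth_on_lc_metric: "smooth_on U (\<lambda>u. lc_metric u $ i $ j)"
  unfolding lc_metric_def by (rule smooth_on_matrix_inv[OF U smooth_on_lc_gram det_lc_gram])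

lemma smooth_on_lc_c_low: "smooth_on U (\<lambda>u. lc_c_low i j k u)"
proof -
  have "smooth_on U (\<lambda>u. (- 1) * B (frame_map u (axis i 1)) (A (embed (axis k 1)) (embed (axis j 1))))"
    by (intro smooth_on_mult[OF U] smooth_on_const bounded_bilinear.smooth_on_prod[OF form_bounded_bilinear U] smooth_on_frame_map)
  then show ?thesis by (simp add: lc_c_low_def)
qed

lemma partial_lc_metric: "u \<in> U \<Longrightarrow> partial_u k (g_low lc_metric m p) u = - lc_c_low m p k u - lc_c_low p m k u"
proof -
  assume u: "u \<in> U"
  have "frechet_derivative (g_low lc_metric m p) (at u) = frechet_derivative (\<lambda>u. B (frame_map u (axis m 1)) (frame_map u (axis p 1))) (at u)"
    using g_low_congruence lc_gram_nth by (intro frechet_derivative_cong_open[OF U u]) simp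
  also have "\<dots> = (\<lambda>v. B (frame_map u (axis m 1)) (A (embed v) (embed (axis p 1))) + B (A (embed v) (embed (axis m 1))) (frame_map u (axis p 1)))"
    by (rule frechet_derivative_at[symmetric], rule bounded_bilinear.FDERIV[OF form_bounded_bilinear frame_map_has_derivative frame_map_has_derivative])
  finally show ?thesis by (simp add: partial_u_def lc_c_low_def form_sym)
qed

lemma partial_lc_c_low:
  assumes u: "u \<in> U"
  shows "partial_u l (c_low lc_metric lc_c m p k) u = - B (A (embed (axis l 1)) (embed (axis m 1))) (A (embed (axis k 1)) (embed (axis p 1)))"
proof -
  have "frechet_derivative (c_low lc_metric lc_c m p k) (at u) = frechet_derivative (\<lambda>u. - B (frame_map u (axis m 1)) (A (embed (axis k 1)) (embed (axis p 1)))) (at u)"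
    using c_low_congruence by (intro frechet_derivative_cong_open[OF U u]) (simp add: lc_c_low_def)
  also have "\<dots> = (\<lambda>v. - B (A (embed v) (embed (axis m 1))) (A (embed (axis k 1)) (embed (axis p 1))))"
    by (rule frechet_derivative_at[symmetric], rule has_derivative_minus,
      rule bounded_linear.has_derivative[OF bounded_bilinear.bounded_linear_left[OF form_bounded_bilinear] frame_map_has_derivative])
  finally show ?thesis by (simp add: partial_u_def)
qed

text \<open>Each condition has its own source: skewness in the last two indices is that of
  \<open>A\<close>, the cyclic identity is the quadric relation for \<open>((u, 1), 0)\<close> and
  three coordinate vectors, and the quadratic equation is \<open>inverse_metric\<close>, the
  derivatives of the lowered \<open>c\<close> being scalar products of two values of
  \<open>A\<close>.\<close>

lemma third_order_hamiltonian_operator_congruence: "third_order_hamiltonian_operator U lc_metric lc_c"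
  unfolding third_order_hamiltonian_operator_def
proof (intro conjI ballI allI)
  show "smooth_on U lc_metric"
    unfolding smooth_on_vec_nth_iff[OF U] using smooth_on_lc_metric by blast
  have "smooth_on U (\<lambda>u. \<Sum>i\<in>UNIV. \<Sum>j\<in>UNIV. lc_metric u $ q $ i * lc_metric u $ p $ j * lc_c_low i j k u)" for p q k
    by (intro smooth_on_sum[OF U] smooth_on_mult[OF U] smooth_on_lc_metric smooth_on_lc_c_low)
  then show "smooth_on U lc_c"
    unfolding smooth_on_vec_nth_iff[OF U] by (simp add: lc_c_def)
next
  fix u assume u: "u \<in> U"
  note [simp] = c_low_congruence[OF u]
  interpret frame: metric_frame B "frame_map u" by (rule lc_frame[OF u])
  fix i j :: 'n
  show "lc_metric u $ i $ j = lc_metric u $ j $ i"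
  proof -
    have "transpose (lc_gram u) = lc_gram u" by (simp add: transpose_def vec_eq_iff lc_gram_nth[OF u] form_sym)
    then have t: "transpose (lc_metric u) ** lc_gram u = mat 1"
      using arg_cong[OF metric_gram_inverse(2)[OF u], of transpose] by (simp add: matrix_transpose_mul transpose_mat)
    have "transpose (lc_metric u) = (transpose (lc_metric u) ** lc_gram u) ** lc_metric u"
      by (simp add: matrix_mul_assoc[symmetric] metric_gram_inverse(2)[OF u])
    also have "\<dots> = lc_metric u" by (simp add: t)
    finally have "transpose (lc_metric u) $ j $ i = lc_metric u $ j $ i" by simp
    then show ?thesis by (simp add: transpose_def)
  qed
  show "det (lc_metric u) \<noteq> 0" by (rule det_lc_metric[OF u])
  fix m p k l :: 'n
  show "partial_u k (g_low lc_metric m p) u = - c_low lc_metric lc_c m p k u - c_low lc_metric lc_c p m k u"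
    by (simp add: partial_lc_metric[OF u])
  show "c_low lc_metric lc_c m p k u = - c_low lc_metric lc_c m k p u"
    using lc_skew[of "embed (axis k 1)" "embed (axis p 1)"] bilinear_rneg[OF form_bilinear] by (simp add: lc_c_low_def)
  show "c_low lc_metric lc_c m p k u + c_low lc_metric lc_c p k m u + c_low lc_metric lc_c k m p u = 0"
  proof -
    have "B (frame_map u (axis p 1)) (A (embed (axis m 1)) (embed (axis k 1))) =
        - B (frame_map u (axis p 1)) (A (embed (axis k 1)) (embed (axis m 1)))"
      using lc_skew[of "embed (axis k 1)" "embed (axis m 1)"] bilinear_rneg[OF form_bilinear] by simp
    moreover have "B (frame_map u (axis k 1)) (A (embed (axis p 1)) (embed (axis m 1))) =
        - B (frame_map u (axis k 1)) (A (embed (axis m 1)) (embed (axis p 1)))"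
      using lc_skew[of "embed (axis p 1)" "embed (axis m 1)"] bilinear_rneg[OF form_bilinear] by simp
    ultimately show ?thesis
      using lc_quadric[of "((u, 1), 0)" "embed (axis m 1)" "embed (axis k 1)" "embed (axis p 1)"]
      by (simp add: lc_c_low_def frame_map_def)
  qed
  show "partial_u l (c_low lc_metric lc_c m p k) u =
     - (\<Sum>s\<in>UNIV. \<Sum>q\<in>UNIV. lc_metric u $ s $ q * c_low lc_metric lc_c s m l u * c_low lc_metric lc_c q p k u)"
    using frame.inverse_metric[of "A (embed (axis l 1)) (embed (axis m 1))" "A (embed (axis k 1)) (embed (axis p 1))"]
    by (simp add: partial_lc_c_low[OF u] lc_c_low_def lc_metric_def lc_gram_def)
qed

section \<open>The Hamiltonian density and its Euler-Lagrange expression\<close>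

definition jet_point :: "'n jet \<Rightarrow> 'n ambient" where "jet_point z = ((snd z 0, fst z), 0)"
definition jet_velocity :: "'n jet \<Rightarrow> 'n ambient" where "jet_velocity z = ((snd z 1, 1), 0)"
definition time_vector :: "'n ambient" where "time_vector = ((0, 0), 1)"
text \<open>Origin of the factor: differentiating along \<open>b\<close> and along \<open>u\<close>
  each contributes one third of the single term in \<open>var_deriv_b_density\<close>; the two other
  terms that arise are turned into the missing third by the quadric relation.\<close>

definition lc_density :: "'n jet \<Rightarrow> real" where "lc_density z = - (1/3) * B (A (jet_point z) (jet_velocity z)) (A (jet_point z) time_vector)"

lemma jet_point_eq: "jet_point = (\<lambda>z. embed (snd z 0) + ((0, fst z), 0))"
  by (rule ext) (simp add: jet_point_def)

lemma jet_velocity_eq: "jet_velocity = (\<lambda>z. embed (snd z 1) + ((0, 1), 0))"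
  by (rule ext) (simp add: jet_velocity_def)

lemma linear_embed_x: "linear (\<lambda>x. ((0, x), 0) :: 'n ambient)"
  by (rule linearI) simp_all

context
  fixes S :: "'n jet set"
  assumes S: "open S"
begin

lemma jet_field_on_point: "jet_field_on S jet_point"
  unfolding jet_point_eq
  by (intro jet_field_on_add[OF S] jet_vec_linear(1)[OF jet_derivation_total_dx[OF S] linear_embed]
     jet_vec_linear(1)[OF jet_derivation_total_dx[OF S] linear_embed_x] jet_field_on_coord[OF S] jet_field_on_fst[OF S])

lemma jet_field_on_velocity: "jet_field_on S jet_velocity"
  unfolding jet_velocity_eq
  by (intro jet_field_on_add[OF S] jet_vec_linear(1)[OF jet_derivation_total_dx[OF S] linear_embed]
     jet_field_on_coord[OF S] jet_field_on_const[OF jet_derivation_total_dx[OF S]])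

lemma jet_vec_point:
  assumes "jet_derivation S \<delta>" "z \<in> S"
  shows "jet_vec \<delta> jet_point z = embed (jet_vec \<delta> (\<lambda>z. snd z 0) z) + ((0, jet_vec \<delta> fst z), 0)"
  unfolding jet_point_eq
  by (subst jet_vec_add[OF assms(1)])
    (simp_all add: jet_vec_linear[OF assms(1) linear_embed] jet_vec_linear[OF assms(1) linear_embed_x]
      jet_field_on_coord[OF S] jet_field_on_fst[OF S] assms(2))

lemma jet_vec_velocity:
  assumes "jet_derivation S \<delta>" "z \<in> S"
  shows "jet_vec \<delta> jet_velocity z = embed (jet_vec \<delta> (\<lambda>z. snd z 1) z)"
  unfolding jet_velocity_eq
  by (subst jet_vec_add[OF assms(1)])
    (simp_all add: jet_vec_linear[OF assms(1) linear_embed] jet_vec_const[OF assms(1)]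
      jet_field_on_coord[OF S] jet_field_on_const[OF assms(1)] assms(2))

lemma jet_vec_A:
  assumes "jet_derivation S \<delta>" "z \<in> S" "jet_field_on S P" "jet_field_on S R"
  shows "jet_field_on S (\<lambda>z. A (P z) (R z))"
    and "jet_vec \<delta> (\<lambda>z. A (P z) (R z)) z = A (jet_vec \<delta> P z) (R z) + A (P z) (jet_vec \<delta> R z)"
  using jet_vec_bilinear[OF assms(1) lc_bilinear assms(3,4)] assms(2) by auto

lemma jet_vec_B:
  assumes "jet_derivation S \<delta>" "z \<in> S" "jet_field_on S P" "jet_field_on S R"
  shows "differential_function_on S (\<lambda>z. B (P z) (R z))"
    and "\<delta> (\<lambda>z. B (P z) (R z)) z = B (jet_vec \<delta> P z) (R z) + B (P z) (jet_vec \<delta> R z)"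
  using jet_vec_bilinear[OF assms(1) form_bilinear assms(3,4)] assms(2)
  by (auto simp: jet_field_on_real jet_vec_real)

lemma jet_field_on_A: "jet_field_on S P \<Longrightarrow> jet_field_on S R \<Longrightarrow> jet_field_on S (\<lambda>z. A (P z) (R z))"
  by (rule jet_vec_bilinear(1)[OF jet_derivation_total_dx[OF S] lc_bilinear])

lemma diff_fun_B:
  "jet_field_on S P \<Longrightarrow> jet_field_on S R \<Longrightarrow> differential_function_on S (\<lambda>z. B (P z) (R z))"
  using jet_vec_bilinear(1)[OF jet_derivation_total_dx[OF S] form_bilinear] by (simp add: jet_field_on_real)

lemma jet_field_on_constant: "jet_field_on S (\<lambda>z. k)"
  by (rule jet_field_on_const[OF jet_derivation_total_dx[OF S]])

lemmas lc_fields = jet_field_on_point jet_field_on_velocity jet_field_on_constant jet_field_on_A diff_fun_B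

lemma diff_fun_density: "differential_function_on S lc_density"
  unfolding lc_density_def[abs_def]
  by (intro diff_fun_mult[OF S] diff_fun_const[OF S] lc_fields)

lemma derivation_density:
  assumes d: "jet_derivation S \<delta>" and z: "z \<in> S"
  shows "\<delta> lc_density z = - (1/3) * (B (A (jet_vec \<delta> jet_point z) (jet_velocity z)) (A (jet_point z) time_vector) + B (A (jet_point z) (jet_vec \<delta> jet_velocity z)) (A (jet_point z) time_vector)
     + B (A (jet_point z) (jet_velocity z)) (A (jet_vec \<delta> jet_point z) time_vector))"
proof -
  have "\<delta> lc_density z = \<delta> (\<lambda>z. - (1/3)) z * B (A (jet_point z) (jet_velocity z)) (A (jet_point z) time_vector) +
     - (1/3) * \<delta> (\<lambda>z. B (A (jet_point z) (jet_velocity z)) (A (jet_point z) time_vector)) z"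
    unfolding lc_density_def[abs_def]
    by (intro derivation_mult[OF d _ _ z] diff_fun_const[OF S] lc_fields)
  also have "\<delta> (\<lambda>z. B (A (jet_point z) (jet_velocity z)) (A (jet_point z) time_vector)) z =
      B (jet_vec \<delta> (\<lambda>z. A (jet_point z) (jet_velocity z)) z) (A (jet_point z) time_vector) + B (A (jet_point z) (jet_velocity z)) (jet_vec \<delta> (\<lambda>z. A (jet_point z) time_vector) z)"
    by (intro jet_vec_B(2)[OF d z] lc_fields)
  also have "jet_vec \<delta> (\<lambda>z. A (jet_point z) (jet_velocity z)) z = A (jet_vec \<delta> jet_point z) (jet_velocity z) + A (jet_point z) (jet_vec \<delta> jet_velocity z)"
    by (intro jet_vec_A(2)[OF d z] lc_fields)
  also have "jet_vec \<delta> (\<lambda>z. A (jet_point z) time_vector) z = A (jet_vec \<delta> jet_point z) time_vector + A (jet_point z) (jet_vec \<delta> (\<lambda>z. time_vector) z)"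
    by (intro jet_vec_A(2)[OF d z] lc_fields)
  finally show ?thesis
    by (simp add: jet_vec_const[OF d] derivation_const[OF d] bilinear_rzero[OF lc_bilinear] bilinear_ladd[OF form_bilinear])
qed

lemma total_dx_form:
  assumes z: "z \<in> S" and P: "jet_field_on S P"
  shows "total_dx (\<lambda>z. B (A (P z) e) (A (jet_point z) time_vector)) z =
    B (A (jet_vec total_dx P z) e) (A (jet_point z) time_vector) + B (A (P z) e) (A (jet_velocity z) time_vector)"
proof -
  note d = jet_derivation_total_dx[OF S]
  have jet_point: "jet_vec total_dx jet_point z = jet_velocity z"
    by (simp add: jet_vec_point[OF d z] jet_vec_total_dx_coord jet_vec_total_dx_fst jet_velocity_def)
  have "total_dx (\<lambda>z. B (A (P z) e) (A (jet_point z) time_vector)) z =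
      B (jet_vec total_dx (\<lambda>z. A (P z) e) z) (A (jet_point z) time_vector) + B (A (P z) e) (jet_vec total_dx (\<lambda>z. A (jet_point z) time_vector) z)"
    by (intro jet_vec_B(2)[OF d z] lc_fields P)
  also have "jet_vec total_dx (\<lambda>z. A (P z) e) z = A (jet_vec total_dx P z) e + A (P z) (jet_vec total_dx (\<lambda>z. e) z)"
    by (intro jet_vec_A(2)[OF d z] lc_fields P)
  also have "jet_vec total_dx (\<lambda>z. A (jet_point z) time_vector) z = A (jet_vec total_dx jet_point z) time_vector + A (jet_point z) (jet_vec total_dx (\<lambda>z. time_vector) z)"
    by (intro jet_vec_A(2)[OF d z] lc_fields)
  finally show ?thesis
    by (simp add: jet_vec_const[OF d] bilinear_rzero[OF lc_bilinear] bilinear_ladd[OF form_bilinear] jet_point)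
qed

text \<open>The Euler-Lagrange expression collapses to a single term by the quadric relation for the
  four vectors \<open>X, X', e\<^sub>j, T\<close>.\<close>

lemma var_deriv_b_density:
  assumes z: "z \<in> S"
  shows "var_deriv_b lc_density j z = B (A (jet_velocity z) (embed (axis j 1))) (A (jet_point z) time_vector)"
proof -
  let ?e = "embed (axis j 1)"
  have o1: "jet_order_le 1 S lc_density"
    by (auto simp: jet_order_le_def lc_density_def jet_point_def jet_velocity_def)
  have "\<And>z. z \<in> S \<Longrightarrow> jet_d (Some (1, j)) lc_density z = - (1/3) * B (A (jet_point z) ?e) (A (jet_point z) time_vector)"
    by (simp add: derivation_density jet_derivation_jet_d[OF S] jet_vec_point jet_vec_velocity jet_vec_jet_d_coord jet_vec_jet_d_fst
        bilinear_lzero[OF lc_bilinear] bilinear_lzero[OF form_bilinear] bilinear_rzero[OF form_bilinear] zero_prod_def[symmetric])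
  then have "total_dx (jet_d (Some (1, j)) lc_density) z = total_dx (\<lambda>z. - (1/3) * B (A (jet_point z) ?e) (A (jet_point z) time_vector)) z"
    by (rule total_dx_cong[OF S z])
  also have "\<dots> = - (1/3) * total_dx (\<lambda>z. B (A (jet_point z) ?e) (A (jet_point z) time_vector)) z"
    by (subst total_dx_mult[OF S _ _ z]) (auto intro!: diff_fun_const[OF S] lc_fields simp: total_dx_const)
  also have "total_dx (\<lambda>z. B (A (jet_point z) ?e) (A (jet_point z) time_vector)) z = B (A (jet_velocity z) ?e) (A (jet_point z) time_vector) + B (A (jet_point z) ?e) (A (jet_velocity z) time_vector)"
    using jet_vec_point[OF jet_derivation_total_dx[OF S] z]
    by (simp add: total_dx_form[OF z jet_field_on_point] jet_vec_total_dx_coord jet_vec_total_dx_fst jet_velocity_def)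
  finally have t1: "total_dx (jet_d (Some (1, j)) lc_density) z =
     - (1/3) * (B (A (jet_velocity z) ?e) (A (jet_point z) time_vector) + B (A (jet_point z) ?e) (A (jet_velocity z) time_vector))" .
  have t0: "jet_d (Some (0, j)) lc_density z = - (1/3) * (B (A ?e (jet_velocity z)) (A (jet_point z) time_vector) + B (A (jet_point z) (jet_velocity z)) (A ?e time_vector))"
    by (simp add: derivation_density jet_derivation_jet_d[OF S] jet_vec_point jet_vec_velocity jet_vec_jet_d_coord jet_vec_jet_d_fst z
        bilinear_rzero[OF lc_bilinear] bilinear_lzero[OF form_bilinear] bilinear_rzero[OF form_bilinear] zero_prod_def[symmetric])
  have sk: "B (A ?e (jet_velocity z)) (A (jet_point z) time_vector) = - B (A (jet_velocity z) ?e) (A (jet_point z) time_vector)"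
    using lc_skew[of ?e "jet_velocity z"] bilinear_lneg[OF form_bilinear] by simp
  have "var_deriv_b lc_density j z = jet_d (Some (0, j)) lc_density z - total_dx (jet_d (Some (1, j)) lc_density) z"
    by (simp add: var_deriv_b_finite[OF S o1 z])
  also have "\<dots> = B (A (jet_velocity z) ?e) (A (jet_point z) time_vector)"
    using lc_quadric[of "jet_point z" "jet_velocity z" ?e time_vector] form_sym[of "A (jet_point z) time_vector" "A (jet_velocity z) ?e"] unfolding t0 t1 sk by argo
  finally show ?thesis .
qed

end

text \<open>The equation is verified before the outer total derivative is taken. The Euler-Lagrange
  expressions are the frame components of \<open>W = A (jet_point z) time_vector\<close>. Their
  total derivative has two parts: the derivative of the frame cancels against the term with
  \<open>lc_c\<close>, and the derivative of \<open>W\<close> gives minus \<open>V u\<close> with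
  lowered index, since the line condition says \<open>A(p, T) = - frame_map u (V u)\<close>.\<close>

lemma hamiltonian_system_congruence: "hamiltonian_system_wrt U V lc_metric lc_c"
  unfolding hamiltonian_system_wrt_def
proof (intro exI conjI ballI allI)
  let ?S = "jet_dom U"
  have S: "open ?S" by (rule open_jet_dom[OF U])
  note d = jet_derivation_total_dx[OF S]
  show "differential_function_on ?S lc_density" by (rule diff_fun_density[OF S])
  fix z i assume z: "z \<in> ?S"
  have "V (snd z 1) $ i = (\<Sum>j\<in>UNIV. lc_metric (snd z 1) $ i $ j * total_dx (\<lambda>z. - var_deriv_b lc_density j z) z +
      (\<Sum>k\<in>UNIV. lc_c (snd z 1) $ i $ j $ k * snd z 2 $ k) * - var_deriv_b lc_density j z)" if z: "z \<in> ?S" for z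
  proof -
    define u where "u = snd z 1"
    have u: "u \<in> U" using z by (simp add: jet_dom_def u_def)
    interpret frame: metric_frame B "frame_map u" by (rule lc_frame[OF u])
    define W where "W = A (jet_point z) time_vector"
    define e where "e j = embed (axis j 1)" for j
    define w where "w = embed (snd z 2)"
    have jet_velocity: "jet_velocity z = ((u, 1), 0)" by (simp add: jet_velocity_def u_def)
    have pT: "A ((u, 1), 0) time_vector = - frame_map u (V u)"
    proof -
      have "A ((u, 1), 0) (embed (V u) + time_vector) = 0" using lc_line[OF u] by (simp add: time_vector_def)
      then show ?thesis by (simp add: bilinear_radd[OF lc_bilinear] frame_map_def eq_neg_iff_add_eq_0 add.commute)
    qed
    have v: "var_deriv_b lc_density j z = B (frame_map u (axis j 1)) W" for j
      using var_deriv_b_density[OF S z, of j] by (simp add: jet_velocity frame_map_def W_def)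
    have t: "total_dx (\<lambda>z. - var_deriv_b lc_density j z) z = - B (A w (e j)) W + (lc_gram u *v V u) $ j" for j
    proof -
      have "total_dx (\<lambda>z. - var_deriv_b lc_density j z) z = total_dx (\<lambda>z. (- 1) * B (A (jet_velocity z) (e j)) (A (jet_point z) time_vector)) z"
        by (rule total_dx_cong[OF S z]) (simp add: var_deriv_b_density[OF S] e_def)
      also have "\<dots> = (- 1) * total_dx (\<lambda>z. B (A (jet_velocity z) (e j)) (A (jet_point z) time_vector)) z"
        by (subst total_dx_mult[OF S _ _ z]) (auto intro!: diff_fun_const[OF S] lc_fields[OF S] simp: total_dx_const)
      also have "total_dx (\<lambda>z. B (A (jet_velocity z) (e j)) (A (jet_point z) time_vector)) z = B (A w (e j)) W + B (A (jet_velocity z) (e j)) (A (jet_velocity z) time_vector)"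
        by (simp add: total_dx_form[OF S z jet_field_on_velocity[OF S]] jet_vec_velocity[OF S d z] jet_vec_total_dx_coord W_def w_def numeral_2_eq_2)
      also have "B (A (jet_velocity z) (e j)) (A (jet_velocity z) time_vector) = - (lc_gram u *v V u) $ j"
        by (simp add: jet_velocity pT bilinear_rneg[OF form_bilinear] lc_gram_def frame.gram_mult frame_map_def e_def)
      finally show ?thesis by simp
    qed
    have C: "(\<Sum>k\<in>UNIV. lc_c_low a b k u * snd z 2 $ k) = - B (frame_map u (axis a 1)) (A w (e b))" for a b
    proof -
      have "linear (\<lambda>y. B (frame_map u (axis a 1)) (A (embed y) (e b)))"
        using linear_compose[OF linear_compose[OF linear_embed bilinear_linear(2)[OF lc_bilinear]] bilinear_linear(1)[OF form_bilinear]]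
        by (simp add: o_def)
      from linear_axis_sum[OF this, of "snd z 2"] show ?thesis
        by (simp add: lc_c_low_def w_def e_def sum_negf[symmetric] mult.commute)
    qed
    have Ga: "(\<Sum>k\<in>UNIV. lc_c u $ i $ j $ k * snd z 2 $ k) = (\<Sum>a\<in>UNIV. \<Sum>b\<in>UNIV. lc_metric u $ j $ a * lc_metric u $ i $ b * - B (frame_map u (axis a 1)) (A w (e b)))" for j
    proof -
      have "(\<Sum>k\<in>UNIV. lc_c u $ i $ j $ k * snd z 2 $ k) =
        (\<Sum>k\<in>UNIV. \<Sum>a\<in>UNIV. \<Sum>b\<in>UNIV. lc_metric u $ j $ a * lc_metric u $ i $ b * (lc_c_low a b k u * snd z 2 $ k))"
        by (simp add: lc_c_def sum_distrib_right mult.assoc)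
      also have "\<dots> = (\<Sum>a\<in>UNIV. \<Sum>k\<in>UNIV. \<Sum>b\<in>UNIV. lc_metric u $ j $ a * lc_metric u $ i $ b * (lc_c_low a b k u * snd z 2 $ k))"
        by (rule sum.swap)
      also have "\<dots> = (\<Sum>a\<in>UNIV. \<Sum>b\<in>UNIV. \<Sum>k\<in>UNIV. lc_metric u $ j $ a * lc_metric u $ i $ b * (lc_c_low a b k u * snd z 2 $ k))"
        by (intro sum.cong refl sum.swap)
      finally show ?thesis by (simp add: sum_distrib_left[symmetric] C)
    qed
    have second: "(\<Sum>j\<in>UNIV. (\<Sum>k\<in>UNIV. lc_c u $ i $ j $ k * snd z 2 $ k) * - B (frame_map u (axis j 1)) W) =
      (\<Sum>b\<in>UNIV. lc_metric u $ i $ b * B W (A w (e b)))"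
    proof -
      have "(\<Sum>j\<in>UNIV. (\<Sum>k\<in>UNIV. lc_c u $ i $ j $ k * snd z 2 $ k) * - B (frame_map u (axis j 1)) W) =
        (\<Sum>j\<in>UNIV. \<Sum>a\<in>UNIV. \<Sum>b\<in>UNIV. lc_metric u $ i $ b * (lc_metric u $ j $ a * B (frame_map u (axis j 1)) W * B (frame_map u (axis a 1)) (A w (e b))))"
        unfolding Ga sum_distrib_right by (intro sum.cong refl) simp
      also have "\<dots> = (\<Sum>j\<in>UNIV. \<Sum>b\<in>UNIV. \<Sum>a\<in>UNIV. lc_metric u $ i $ b * (lc_metric u $ j $ a * B (frame_map u (axis j 1)) W * B (frame_map u (axis a 1)) (A w (e b))))"
        by (intro sum.cong refl sum.swap)
      also have "\<dots> = (\<Sum>b\<in>UNIV. \<Sum>j\<in>UNIV. \<Sum>a\<in>UNIV. lc_metric u $ i $ b * (lc_metric u $ j $ a * B (frame_map u (axis j 1)) W * B (frame_map u (axis a 1)) (A w (e b))))"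
        by (rule sum.swap)
      also have "\<dots> = (\<Sum>b\<in>UNIV. lc_metric u $ i $ b * B W (A w (e b)))"
        using frame.inverse_metric[of W] by (simp add: sum_distrib_left[symmetric] lc_metric_def lc_gram_def)
      finally show ?thesis .
    qed
    have first: "(\<Sum>j\<in>UNIV. lc_metric u $ i $ j * (lc_gram u *v V u) $ j) = V u $ i"
    proof -
      have "(lc_metric u *v (lc_gram u *v V u)) $ i = V u $ i" by (simp add: matrix_vector_mul_assoc metric_gram_inverse[OF u])
      then show ?thesis by (simp add: matrix_vector_axis_sum[of "lc_metric u"])
    qed
    have "(\<Sum>j\<in>UNIV. lc_metric u $ i $ j * total_dx (\<lambda>z. - var_deriv_b lc_density j z) z +
      (\<Sum>k\<in>UNIV. lc_c u $ i $ j $ k * snd z 2 $ k) * - var_deriv_b lc_density j z) =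
      (\<Sum>j\<in>UNIV. lc_metric u $ i $ j * (- B (A w (e j)) W)) + (\<Sum>j\<in>UNIV. lc_metric u $ i $ j * (lc_gram u *v V u) $ j) +
      (\<Sum>j\<in>UNIV. (\<Sum>k\<in>UNIV. lc_c u $ i $ j $ k * snd z 2 $ k) * - B (frame_map u (axis j 1)) W)"
      unfolding t v sum.distrib distrib_left by simp
    also have "\<dots> = V u $ i"
      unfolding first second by (simp add: form_sym[of W] sum_negf)
    finally show ?thesis by (simp add: u_def)
  qed
  then show "total_dx (\<lambda>z. V (snd z 1) $ i) z = outer_op lc_metric lc_c (\<lambda>j z. - var_deriv_b lc_density j z) i z"
    unfolding outer_op_def by (intro total_dx_cong[OF S z])
qed

end

section \<open>From Hamiltonian systems to linear congruences\<close>

lemma partial_u_has_derivative: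
  assumes "f differentiable (at u)"
  shows "((\<lambda>s. f (u + s *\<^sub>R axis i 1)) has_real_derivative partial_u i f u) (at 0)"
  using field_jet_has_derivative[of f "(0, \<lambda>k. u)" "Some (1, i)"] assms
  by (simp add: jet_shift_def)

lemma partial_u_eqI:
  assumes "(f has_derivative D) (at u)"
  shows "partial_u k f u = D (axis k 1)"
  using frechet_derivative_at[OF assms] by (simp add: partial_u_def)

lemma partial_u_zero_constant:
  assumes "open U" "connected U" "\<And>u. u \<in> U \<Longrightarrow> f differentiable (at u)"
    "\<And>u k. u \<in> U \<Longrightarrow> partial_u k f u = 0" "u \<in> U" "v \<in> U"
  shows "f u = f v"
proof (rule zero_partials_constant[OF assms(1,2,5,6)])
  fix w i assume "w \<in> U"
  then show "((\<lambda>s. f (w + s *\<^sub>R axis i 1)) has_real_derivative 0) (at 0)"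
    using partial_u_has_derivative[OF assms(3), of w i] assms(4) by simp
qed

lemma partial_u_cong:
  assumes "open U" "u \<in> U" "\<And>v. v \<in> U \<Longrightarrow> f v = h v"
  shows "partial_u k f u = partial_u k h u"
  using frechet_derivative_cong_open[of U u f h] assms by (simp add: partial_u_def)

lemma partial_u_add:
  assumes "f differentiable (at u)" "h differentiable (at u)"
  shows "partial_u k (\<lambda>u. f u + h u) u = partial_u k f u + partial_u k h u"
  using partial_u_eqI[OF has_derivative_add[OF assms[unfolded frechet_derivative_works]], of k]
  by (simp add: partial_u_def)

lemma partial_u_mult:
  assumes "f differentiable (at u)" "h differentiable (at u)"
  shows "partial_u k (\<lambda>u. f u * h u) u = f u * partial_u k h u + partial_u k f u * h u"
  using partial_u_eqI[OF has_derivative_mult[OF assms[unfolded frechet_derivative_works]], of k]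
  by (simp add: partial_u_def)

lemma partial_u_const: "partial_u k (\<lambda>u. c) u = 0"
  by (simp add: partial_u_def)

lemma partial_u_sum:
  assumes "finite I" "\<And>i. i \<in> I \<Longrightarrow> f i differentiable (at u)"
  shows "partial_u k (\<lambda>u. \<Sum>i\<in>I. f i u) u = (\<Sum>i\<in>I. partial_u k (f i) u)"
  using assms
proof (induction I)
  case (insert j I)
  have "partial_u k (\<lambda>u. f j u + (\<Sum>i\<in>I. f i u)) u = partial_u k (f j) u + partial_u k (\<lambda>u. \<Sum>i\<in>I. f i u) u"
    using insert by (intro partial_u_add differentiable_sum) auto
  with insert show ?case by simp
qed (simp add: partial_u_const)

text \<open>By the quadratic equation, the derivatives of \<open>c\<^sub>m\<^sub>p\<^sub>k\<close> are \<open>- g\<^sup>s\<^sup>q c\<^sub>s\<^sub>m\<^sub>l c\<^sub>q\<^sub>p\<^sub>k\<close>, and differentiating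
  once more gives zero.  Hence \<open>c\<close> is affine and \<open>g\<^sub>m\<^sub>p\<close> quadratic, and both are determined by
  their values at \<open>u\<^sub>0\<close>.\<close>

lemma third_order_operator_structure:
  fixes U :: "(real^'n::finite) set"
  assumes op: "third_order_hamiltonian_operator U g \<Gamma>" and U: "open U" "connected U" and u0: "u0 \<in> U"
  shows "\<exists>B K \<omega>. bilinear (B :: real^'n \<Rightarrow> real^'n \<Rightarrow> real) \<and> (\<forall>v w. B v w = B w v) \<and>
    (\<forall>v. (\<forall>w. B w v = 0) \<longrightarrow> v = 0) \<and>
    bilinear (K :: real^'n \<Rightarrow> real^'n \<Rightarrow> real^'n) \<and> (\<forall>y z. K y z = - K z y) \<and> linear (\<omega> :: real^'n \<Rightarrow> real^'n) \<and>
    (\<forall>u\<in>U. \<forall>m p. g_low g m p u = B (K u (axis m 1) + \<omega> (axis m 1)) (K u (axis p 1) + \<omega> (axis p 1))) \<and>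
    (\<forall>u\<in>U. \<forall>m p k. c_low g \<Gamma> m p k u = - B (K u (axis m 1) + \<omega> (axis m 1)) (K (axis k 1) (axis p 1)))"
proof -
  define G where "G u = matrix_inv (g u)" for u
  define cl where "cl m p k = c_low g \<Gamma> m p k" for m p k
  have gs: "smooth_on U g" "smooth_on U \<Gamma>" using op by (simp_all add: third_order_hamiltonian_operator_def)
  have gsym: "g u $ i $ j = g u $ j $ i" and det: "det (g u) \<noteq> 0"
    and e1: "partial_u k (\<lambda>u. G u $ m $ p) u = - cl m p k u - cl p m k u"
    and e2: "cl m p k u = - cl m k p u"
    and e4: "partial_u l (cl m p k) u = - (\<Sum>s\<in>UNIV. \<Sum>q\<in>UNIV. g u $ s $ q * cl s m l u * cl q p k u)"
    if "u \<in> U" for u i j k l m p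
    using op that unfolding third_order_hamiltonian_operator_def cl_def g_low_def[abs_def] G_def by blast+
  have Gg: "G u ** g u = mat 1" "g u ** G u = mat 1" if "u \<in> U" for u
    using det[OF that] by (simp_all add: G_def matrix_inv_inverse)
  have Gg_sum: "(\<Sum>q\<in>UNIV. G u $ i $ q * g u $ q $ a) = (if i = a then 1 else 0)"
    and gG_sum: "(\<Sum>q\<in>UNIV. g u $ i $ q * G u $ q $ a) = (if i = a then 1 else 0)" if "u \<in> U" for u i a
    using arg_cong[OF Gg(1)[OF that], of "\<lambda>M. M $ i $ a"] arg_cong[OF Gg(2)[OF that], of "\<lambda>M. M $ i $ a"]
    by (simp_all add: matrix_matrix_mult_def mat_def)
  have Gsym: "G u $ i $ j = G u $ j $ i" if "u \<in> U" for u i j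
  proof -
    have "transpose (g u) = g u" by (simp add: transpose_def vec_eq_iff gsym[OF that])
    then have t: "transpose (G u) ** g u = mat 1"
      using arg_cong[OF Gg(2)[OF that], of transpose] by (simp add: matrix_transpose_mul transpose_mat)
    have "transpose (G u) = (transpose (G u) ** g u) ** G u"
      by (simp add: matrix_mul_assoc[symmetric] Gg(2)[OF that])
    also have "\<dots> = G u" by (simp add: t)
    finally have "transpose (G u) $ j $ i = G u $ j $ i" by simp
    then show ?thesis by (simp add: transpose_def)
  qed
  have sg: "smooth_on U (\<lambda>u. g u $ i $ j)" for i j
    by (rule smooth_on_vec2[OF U(1) gs(1)])
  have sGam: "smooth_on U (\<lambda>u. \<Gamma> u $ i $ j $ k)" for i j k
    by (rule smooth_on_vec3[OF U(1) gs(2)])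
  have sG: "smooth_on U (\<lambda>u. G u $ i $ j)" for i j
    unfolding G_def by (rule smooth_on_matrix_inv[OF U(1) sg det])
  have scl: "smooth_on U (cl m p k)" for m p k
    unfolding cl_def c_low_def[abs_def] g_low_def G_def[symmetric]
    by (intro smooth_on_sum[OF U(1)] smooth_on_mult[OF U(1)] sG sGam)
  note dg = smooth_on_imp_differentiable[OF sg]
  note dG = smooth_on_imp_differentiable[OF sG]
  note dcl = smooth_on_imp_differentiable[OF scl]
  define X where "X m l p k u = (\<Sum>s\<in>UNIV. \<Sum>q\<in>UNIV. g u $ s $ q * cl s m l u * cl q p k u)" for m l p k u
  have sX: "smooth_on U (X m l p k)" for m l p k
    unfolding X_def[abs_def] by (intro smooth_on_sum[OF U(1)] smooth_on_mult[OF U(1)] sg scl)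
  \<comment> \<open>Three contributions cancel. With \<open>P'\<close> and \<open>Q'\<close>
    denoting \<open>P\<close> and \<open>Q\<close> with raised index, the derivative of the upper
    metric gives two contractions of \<open>P'\<close>, \<open>Q'\<close> with \<open>cl\<close>;
    the quadratic equation, applied to either factor of \<open>X\<close>, gives each of them with
    the opposite sign.\<close>
  have X0: "partial_u r (X m l p k) u = 0" if u: "u \<in> U" for r m l p k u
  proof -
    define P where "P s = cl s m l u" for s
    define Q where "Q q = cl q p k u" for q
    define P' where "P' a = (\<Sum>s\<in>UNIV. g u $ a $ s * P s)" for a
    define Q' where "Q' a = (\<Sum>s\<in>UNIV. g u $ a $ s * Q s)" for a
    define dg' where "dg' s q = partial_u r (\<lambda>u. g u $ s $ q) u" for s q
    have lowP: "P s = (\<Sum>a\<in>UNIV. G u $ s $ a * P' a)" for s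
    proof -
      have "(\<Sum>a\<in>UNIV. G u $ s $ a * P' a) = (\<Sum>b\<in>UNIV. (\<Sum>a\<in>UNIV. G u $ s $ a * g u $ a $ b) * P b)"
        unfolding P'_def sum_distrib_left sum_distrib_right mult.assoc by (rule sum.swap)
      then show ?thesis by (simp add: Gg_sum[OF u] if_distrib[of "\<lambda>x. x * _"] cong: if_cong)
    qed
    \<comment> \<open>The derivative of \<open>g u ** G u = mat 1\<close>. It trades the unknown
      derivative of \<open>g\<close> for that of \<open>G\<close>, which \<open>e1\<close> expresses
      through \<open>cl\<close>.\<close>
    have dG0: "(\<Sum>s\<in>UNIV. dg' q s * G u $ s $ a) = - (\<Sum>s\<in>UNIV. g u $ q $ s * (- cl s a r u - cl a s r u))" for q a
    proof -
      have "0 = partial_u r (\<lambda>u. \<Sum>s\<in>UNIV. g u $ q $ s * G u $ s $ a) u"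
        using partial_u_cong[OF U(1) u, of "\<lambda>u. \<Sum>s\<in>UNIV. g u $ q $ s * G u $ s $ a" "\<lambda>u. if q = a then 1 else 0" r] gG_sum
        by (simp add: partial_u_const)
      also have "\<dots> = (\<Sum>s\<in>UNIV. partial_u r (\<lambda>u. g u $ q $ s * G u $ s $ a) u)"
        by (intro partial_u_sum differentiable_mult dg dG u) auto
      also have "\<dots> = (\<Sum>s\<in>UNIV. g u $ q $ s * (- cl s a r u - cl a s r u) + dg' q s * G u $ s $ a)"
        by (intro sum.cong refl) (simp add: partial_u_mult[OF dg[OF u] dG[OF u]] e1[OF u] dg'_def)
      finally show ?thesis by (simp add: sum.distrib)
    qed
    have dgs: "dg' s q = dg' q s" for s q
      unfolding dg'_def by (rule partial_u_cong[OF U(1) u]) (rule gsym)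
    have t1: "(\<Sum>s\<in>UNIV. \<Sum>q\<in>UNIV. dg' s q * P s * Q q) = (\<Sum>a\<in>UNIV. \<Sum>b\<in>UNIV. P' a * Q' b * (cl a b r u + cl b a r u))"
    proof -
      have "(\<Sum>s\<in>UNIV. \<Sum>q\<in>UNIV. dg' s q * P s * Q q) = (\<Sum>q\<in>UNIV. \<Sum>s\<in>UNIV. \<Sum>a\<in>UNIV. (dg' q s * G u $ s $ a) * P' a * Q q)"
        by (subst sum.swap) (simp add: lowP dgs sum_distrib_left sum_distrib_right mult_ac)
      also have "\<dots> = (\<Sum>q\<in>UNIV. \<Sum>a\<in>UNIV. \<Sum>s\<in>UNIV. (dg' q s * G u $ s $ a) * P' a * Q q)"
        by (intro sum.cong refl sum.swap)
      also have "\<dots> = (\<Sum>q\<in>UNIV. \<Sum>a\<in>UNIV. \<Sum>s\<in>UNIV. (g u $ q $ s * (cl s a r u + cl a s r u)) * P' a * Q q)"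
      proof (rule sum.cong[OF refl], rule sum.cong[OF refl])
        fix q a
        have "(\<Sum>s\<in>UNIV. dg' q s * G u $ s $ a * P' a * Q q) = (\<Sum>s\<in>UNIV. dg' q s * G u $ s $ a) * (P' a * Q q)"
          by (simp add: sum_distrib_right mult.assoc)
        also have "\<dots> = (\<Sum>s\<in>UNIV. g u $ q $ s * (cl s a r u + cl a s r u)) * (P' a * Q q)"
          unfolding dG0 sum_negf[symmetric] by (intro arg_cong2[where f="(*)"] sum.cong refl) (simp add: algebra_simps)
        finally show "(\<Sum>s\<in>UNIV. dg' q s * G u $ s $ a * P' a * Q q) =
            (\<Sum>s\<in>UNIV. g u $ q $ s * (cl s a r u + cl a s r u) * P' a * Q q)"
          by (simp add: sum_distrib_right mult.assoc)
      qed
      also have "\<dots> = (\<Sum>a\<in>UNIV. \<Sum>q\<in>UNIV. \<Sum>s\<in>UNIV. (g u $ q $ s * (cl s a r u + cl a s r u)) * P' a * Q q)"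
        by (rule sum.swap)
      also have "\<dots> = (\<Sum>a\<in>UNIV. \<Sum>s\<in>UNIV. \<Sum>q\<in>UNIV. (g u $ q $ s * (cl s a r u + cl a s r u)) * P' a * Q q)"
        by (intro sum.cong refl sum.swap)
      also have "\<dots> = (\<Sum>a\<in>UNIV. \<Sum>s\<in>UNIV. P' a * Q' s * (cl a s r u + cl s a r u))"
        by (intro sum.cong refl) (simp add: Q'_def sum_distrib_left sum_distrib_right gsym[OF u] algebra_simps)
      finally show ?thesis .
    qed
    have low: "(\<Sum>s\<in>UNIV. \<Sum>q\<in>UNIV. g u $ s $ q * f s * h q) = (\<Sum>s\<in>UNIV. f s * (\<Sum>q\<in>UNIV. g u $ s $ q * h q))" for f h
      by (simp add: sum_distrib_left mult_ac)
    have low': "(\<Sum>s\<in>UNIV. \<Sum>q\<in>UNIV. g u $ s $ q * f s * h q) = (\<Sum>q\<in>UNIV. h q * (\<Sum>s\<in>UNIV. g u $ q $ s * f s))" for f h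
      by (subst sum.swap) (simp add: sum_distrib_left mult_ac gsym[OF u, of _ "_::'n"])
    have t2: "(\<Sum>s\<in>UNIV. \<Sum>q\<in>UNIV. g u $ s $ q * partial_u r (cl s m l) u * Q q) =
       - (\<Sum>a\<in>UNIV. \<Sum>b\<in>UNIV. P' a * Q' b * cl a b r u)"
    proof -
      have "(\<Sum>s\<in>UNIV. \<Sum>q\<in>UNIV. g u $ s $ q * partial_u r (cl s m l) u * Q q) = (\<Sum>s\<in>UNIV. partial_u r (cl s m l) u * Q' s)"
        unfolding low Q'_def ..
      also have "\<dots> = (\<Sum>s\<in>UNIV. - (\<Sum>a\<in>UNIV. cl a s r u * P' a) * Q' s)"
        unfolding e4[OF u] low P_def[symmetric] P'_def[symmetric] ..
      also have "\<dots> = - (\<Sum>s\<in>UNIV. \<Sum>a\<in>UNIV. P' a * Q' s * cl a s r u)"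
        by (simp add: sum_negf sum_distrib_left sum_distrib_right mult_ac)
      also have "(\<Sum>s\<in>UNIV. \<Sum>a\<in>UNIV. P' a * Q' s * cl a s r u) = (\<Sum>a\<in>UNIV. \<Sum>b\<in>UNIV. P' a * Q' b * cl a b r u)"
        by (rule sum.swap)
      finally show ?thesis .
    qed
    have t3: "(\<Sum>s\<in>UNIV. \<Sum>q\<in>UNIV. g u $ s $ q * P s * partial_u r (cl q p k) u) =
       - (\<Sum>a\<in>UNIV. \<Sum>b\<in>UNIV. P' a * Q' b * cl b a r u)"
    proof -
      have "(\<Sum>s\<in>UNIV. \<Sum>q\<in>UNIV. g u $ s $ q * P s * partial_u r (cl q p k) u) = (\<Sum>q\<in>UNIV. partial_u r (cl q p k) u * P' q)"
        unfolding low' P'_def ..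
      also have "\<dots> = (\<Sum>q\<in>UNIV. - (\<Sum>a\<in>UNIV. cl a q r u * Q' a) * P' q)"
        unfolding e4[OF u] low Q_def[symmetric] Q'_def[symmetric] ..
      also have "\<dots> = - (\<Sum>a\<in>UNIV. \<Sum>b\<in>UNIV. P' a * Q' b * cl b a r u)"
        by (simp add: sum_negf sum_distrib_left sum_distrib_right mult_ac)
      finally show ?thesis .
    qed
    have dd3: "(\<lambda>u. g u $ s $ q * cl s m l u * cl q p k u) differentiable (at u)" for s q
      by (intro differentiable_mult dg dcl u)
    have "partial_u r (X m l p k) u = (\<Sum>s\<in>UNIV. partial_u r (\<lambda>u. \<Sum>q\<in>UNIV. g u $ s $ q * cl s m l u * cl q p k u) u)"
      unfolding X_def[abs_def]
      by (intro partial_u_sum differentiable_sum ballI dd3 finite_UNIV finite)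
    also have "\<dots> = (\<Sum>s\<in>UNIV. \<Sum>q\<in>UNIV. partial_u r (\<lambda>u. g u $ s $ q * cl s m l u * cl q p k u) u)"
      by (intro sum.cong refl partial_u_sum dd3 finite_UNIV finite)
    also have "\<dots> = (\<Sum>s\<in>UNIV. \<Sum>q\<in>UNIV. dg' s q * P s * Q q + g u $ s $ q * partial_u r (cl s m l) u * Q q +
         g u $ s $ q * P s * partial_u r (cl q p k) u)"
    proof (rule sum.cong[OF refl], rule sum.cong[OF refl])
      fix s q
      have dd: "(\<lambda>u. g u $ s $ q * cl s m l u) differentiable (at u)"
        by (intro differentiable_mult dg dcl u)
      show "partial_u r (\<lambda>u. g u $ s $ q * cl s m l u * cl q p k u) u =
        dg' s q * P s * Q q + g u $ s $ q * partial_u r (cl s m l) u * Q q + g u $ s $ q * P s * partial_u r (cl q p k) u"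
        unfolding partial_u_mult[OF dd dcl[OF u]] partial_u_mult[OF dg[OF u] dcl[OF u]] dg'_def P_def Q_def
        by (simp add: algebra_simps)
    qed
    also have "\<dots> = 0"
      unfolding sum.distrib t1 t2 t3 by (simp add: distrib_left sum.distrib)
    finally show ?thesis .
  qed
  have Xc: "X m l p k u = X m l p k u0" if "u \<in> U" for m l p k u
    by (rule partial_u_zero_constant[OF U smooth_on_imp_differentiable[OF sX] X0 that u0])

  define g0 where "g0 = g u0"
  define G0 where "G0 = G u0"
  define c0 where "c0 s m l = cl s m l u0" for s m l
  \<comment> \<open>Everything is normalised at \<open>u0\<close>. There \<open>B\<close> is the
    lowered metric, \<open>K\<close> is minus \<open>cl\<close> with its first index raised by
    \<open>g0\<close>, and \<open>\<omega>\<close> is chosen so that the frame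
    \<open>K u y + \<omega> y\<close> is the identity at \<open>u = u0\<close>.\<close>
  define B where "B v w = v \<bullet> (G0 *v w)" for v w :: "real^'n"
  define c1 where "c1 y z = (\<chi> s. \<Sum>m\<in>UNIV. \<Sum>l\<in>UNIV. c0 s m l * z $ m * y $ l)" for y z :: "real^'n"
  define K where "K y z = - (g0 *v c1 y z)" for y z
  define \<omega> where "\<omega> y = y - K u0 y" for y
  have B_bil: "bilinear B"
    unfolding bilinear_def B_def
    by (auto intro!: linearI simp: matrix_vector_right_distrib inner_add_left inner_add_right matrix_vector_mult_scaleR)
  have B_sym: "B v w = B w v" for v w
  proof -
    have e: "B v w = (\<Sum>i\<in>UNIV. \<Sum>j\<in>UNIV. v $ i * (G0 $ i $ j * w $ j))" for v w
      by (simp add: B_def inner_vec_def matrix_vector_axis_sum sum_distrib_left)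
    have "B v w = (\<Sum>j\<in>UNIV. \<Sum>i\<in>UNIV. v $ i * (G0 $ i $ j * w $ j))"
      unfolding e by (rule sum.swap)
    also have "\<dots> = B w v"
      unfolding e by (intro sum.cong refl) (simp add: G0_def Gsym[OF u0, of _ "_::'n"] mult_ac)
    finally show ?thesis .
  qed
  have gG0: "G0 ** g0 = mat 1" "g0 ** G0 = mat 1" using Gg[OF u0] by (simp_all add: G0_def g0_def)
  have B_nondeg: "v = 0" if "\<And>w. B w v = 0" for v
  proof -
    have "G0 *v v = 0" using that[of "G0 *v v"] by (simp add: B_def)
    then have "(g0 ** G0) *v v = 0" by (simp add: matrix_vector_mul_assoc[symmetric])
    then show ?thesis by (simp add: gG0)
  qed
  have c1_bil: "bilinear c1"
    unfolding bilinear_def c1_def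
    by (auto intro!: linearI simp: vec_eq_iff sum.distrib sum_distrib_left algebra_simps)
  have K_bil: "bilinear K"
    unfolding bilinear_def K_def using c1_bil
    by (auto intro!: linearI simp: bilinear_ladd bilinear_radd bilinear_lmul bilinear_rmul
        matrix_vector_right_distrib matrix_vector_mult_scaleR)
  have mneg: "M *v (- x) = - (M *v x)" for M :: "real^'n^'n" and x
    by (rule linear_neg[OF matrix_vector_mul_linear])
  have c1_skew: "c1 y z = - c1 z y" for y z
  proof -
    have "(\<Sum>m\<in>UNIV. \<Sum>l\<in>UNIV. c0 s m l * z $ m * y $ l) = - (\<Sum>m\<in>UNIV. \<Sum>l\<in>UNIV. c0 s m l * y $ m * z $ l)" for s
    proof -
      have c0s: "c0 s m l * z $ m * y $ l = - (c0 s l m * y $ l * z $ m)" for m l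
        using e2[OF u0, of s m l] by (simp add: c0_def)
      have "(\<Sum>m\<in>UNIV. \<Sum>l\<in>UNIV. c0 s m l * z $ m * y $ l) = (\<Sum>l\<in>UNIV. \<Sum>m\<in>UNIV. c0 s m l * z $ m * y $ l)"
        by (rule sum.swap)
      then show ?thesis unfolding c0s sum_negf .
    qed
    then show ?thesis by (simp add: c1_def vec_eq_iff)
  qed
  have K_skew: "K y z = - K z y" for y z
    using c1_skew[of y z] by (simp add: K_def mneg)
  have \<omega>_lin: "linear \<omega>"
    unfolding \<omega>_def using K_bil
    by (auto intro!: linearI simp: bilinear_radd bilinear_rmul scaleR_diff_right)
  define \<psi> where "\<psi> u y = K u y + \<omega> y" for u y
  have \<psi>_eq: "\<psi> u y = y + K (u - u0) y" for u y
    by (simp add: \<psi>_def \<omega>_def bilinear_lsub[OF K_bil])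
  have BK: "B v (K y z) = - (v \<bullet> c1 y z)" for v y z
    by (simp add: B_def K_def matrix_vector_mul_assoc gG0 mneg)
  have c1_axis: "c1 (axis k 1) (axis p 1) = (\<chi> s. c0 s p k)" for k p
  proof -
    have "(\<Sum>m\<in>UNIV. \<Sum>l\<in>UNIV. c0 s m l * axis p 1 $ m * axis k 1 $ l) =
       (\<Sum>m\<in>UNIV. if m = p then c0 s p k else 0)" for s
      by (intro sum.cong refl) (auto simp: axis_def if_distrib[of "\<lambda>x. _ * x"] cong: if_cong)
    then show ?thesis by (simp add: c1_def)
  qed
  have BKK: "B (K (axis l 1) (axis m 1)) (K (axis k 1) (axis p 1)) = X m l p k u0" for l m k p
  proof -
    have "X m l p k u0 = (\<Sum>q\<in>UNIV. \<Sum>s\<in>UNIV. g0 $ s $ q * c0 s m l * c0 q p k)"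
      unfolding X_def g0_def c0_def by (rule sum.swap)
    also have "\<dots> = (\<Sum>q\<in>UNIV. (g0 *v (\<chi> s. c0 s m l)) $ q * c0 q p k)"
      by (simp add: matrix_vector_axis_sum sum_distrib_right g0_def gsym[OF u0, of _ "_::'n"])
    also have "\<dots> = B (K (axis l 1) (axis m 1)) (K (axis k 1) (axis p 1))"
      unfolding BK by (simp add: K_def c1_axis inner_vec_def sum_negf)
    finally show ?thesis by simp
  qed
  have \<psi>_deriv: "((\<lambda>u. \<psi> u y) has_derivative (\<lambda>v. K v y)) (at u)" for y u
    unfolding \<psi>_def
    using linear_imp_has_derivative[OF bilinear_linear(2)[OF K_bil]] by (auto intro: has_derivative_add_const)
  have B_bb: "bounded_bilinear B" using B_bil by (simp add: bilinear_conv_bounded_bilinear)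
  have \<psi>_u0: "\<psi> u0 y = y" for y by (simp add: \<psi>_eq bilinear_lzero[OF K_bil])
  \<comment> \<open>Both sides agree at \<open>u0\<close>, and their derivatives agree because the
    contraction \<open>X\<close> keeps its value at \<open>u0\<close>; connectedness of
    \<open>U\<close> gives equality everywhere.\<close>
  have c_eq: "cl m p k u = - B (\<psi> u (axis m 1)) (K (axis k 1) (axis p 1))" if u: "u \<in> U" for m p k u
  proof -
    let ?E = "\<lambda>u. cl m p k u + B (\<psi> u (axis m 1)) (K (axis k 1) (axis p 1))"
    have D: "((\<lambda>u. B (\<psi> u (axis m 1)) (K (axis k 1) (axis p 1))) has_derivative
       (\<lambda>v. B (K v (axis m 1)) (K (axis k 1) (axis p 1)))) (at u)" for u
      by (rule bounded_linear.has_derivative[OF bounded_bilinear.bounded_linear_left[OF B_bb] \<psi>_deriv])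
    have "?E u = ?E u0"
    proof (rule partial_u_zero_constant[OF U _ _ u u0])
      show "?E differentiable (at u)" if "u \<in> U" for u
        using dcl[OF that] D differentiable_def by (intro differentiable_add) blast+
      show "partial_u l ?E u = 0" if "u \<in> U" for u l
      proof -
        have "(\<lambda>u. B (\<psi> u (axis m 1)) (K (axis k 1) (axis p 1))) differentiable (at u)"
          using D differentiable_def by blast
        from partial_u_add[OF dcl[OF that] this]
        have "partial_u l ?E u = partial_u l (cl m p k) u + B (K (axis l 1) (axis m 1)) (K (axis k 1) (axis p 1))"
          using partial_u_eqI[OF D] by simp
        then show ?thesis using Xc[OF that, of m l p k] by (simp add: e4[OF that] BKK X_def)
      qed
    qed
    also have "?E u0 = 0" by (simp add: \<psi>_u0 BK c1_axis inner_axis' c0_def)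
    finally show ?thesis by simp
  qed
  \<comment> \<open>The same comparison once more; the derivatives now agree by \<open>e1\<close>
    and the formula just found for \<open>cl\<close>.\<close>
  have g_eq: "G u $ m $ p = B (\<psi> u (axis m 1)) (\<psi> u (axis p 1))" if u: "u \<in> U" for m p u
  proof -
    let ?h = "\<lambda>u. B (\<psi> u (axis m 1)) (\<psi> u (axis p 1))"
    let ?E = "\<lambda>u. G u $ m $ p + (- 1) * ?h u"
    have D: "(?h has_derivative (\<lambda>v. B (\<psi> u (axis m 1)) (K v (axis p 1)) + B (K v (axis m 1)) (\<psi> u (axis p 1)))) (at u)" for u
      by (rule bounded_bilinear.FDERIV[OF B_bb \<psi>_deriv \<psi>_deriv])
    then have dh: "?h differentiable (at u)" for u using differentiable_def by blast
    have "?E u = ?E u0"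
    proof (rule partial_u_zero_constant[OF U _ _ u u0])
      show "?E differentiable (at u)" if "u \<in> U" for u
        by (intro differentiable_add dG[OF that] differentiable_mult dh) simp
      show "partial_u l ?E u = 0" if "u \<in> U" for u l
      proof -
        have "partial_u l ?E u = partial_u l (\<lambda>u. G u $ m $ p) u + partial_u l (\<lambda>u. (- 1) * ?h u) u"
          by (intro partial_u_add dG[OF that] differentiable_mult dh) simp
        also have "partial_u l (\<lambda>u. (- 1) * ?h u) u = (- 1) * partial_u l ?h u + partial_u l (\<lambda>u. - 1) u * ?h u"
          by (intro partial_u_mult dh) simp
        also have "partial_u l ?h u = B (\<psi> u (axis m 1)) (K (axis l 1) (axis p 1)) + B (K (axis l 1) (axis m 1)) (\<psi> u (axis p 1))"
          by (rule partial_u_eqI[OF D])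
        finally show ?thesis
          by (simp add: e1[OF that] c_eq[OF that] partial_u_const B_sym)
      qed
    qed
    also have "?E u0 = 0" by (simp add: \<psi>_u0 B_def G0_def inner_axis' matrix_vector_mul_component inner_axis)
    finally show ?thesis by simp
  qed
  have "\<forall>u\<in>U. \<forall>m p. g_low g m p u = B (K u (axis m 1) + \<omega> (axis m 1)) (K u (axis p 1) + \<omega> (axis p 1))"
    using g_eq by (simp add: g_low_def G_def \<psi>_def)
  moreover have "\<forall>u\<in>U. \<forall>m p k. c_low g \<Gamma> m p k u = - B (K u (axis m 1) + \<omega> (axis m 1)) (K (axis k 1) (axis p 1))"
    using c_eq by (simp add: cl_def \<psi>_def)
  moreover have "\<forall>v w. B v w = B w v" "\<forall>y z. K y z = - K z y" using B_sym K_skew by iprover+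
  moreover have "\<forall>v. (\<forall>w. B w v = 0) \<longrightarrow> v = 0" using B_nondeg by iprover
  ultimately show ?thesis
    using B_bil K_bil \<omega>_lin by (intro exI[of _ B] exI[of _ K] exI[of _ \<omega>] conjI)
qed

text \<open>Splits an identity that holds on \<open>U\<close> and is affine in \<open>u\<close> into
  its linear and its constant part, the former then being valid for all vectors and not only on
  \<open>U\<close>.\<close>

lemma affine_vanishes_on_open:
  fixes L :: "'a::real_normed_vector \<Rightarrow> 'b::real_vector"
  assumes "linear L" "open U" "u0 \<in> U" "\<And>u. u \<in> U \<Longrightarrow> L u + k = 0"
  shows "L y = 0" "k = 0"
proof -
  have L: "L y = 0" for y
  proof -
    have "\<forall>\<^sub>F s in nhds 0. u0 + s *\<^sub>R y \<in> U"
    proof -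
      have "open ((\<lambda>s::real. u0 + s *\<^sub>R y) -` U)"
        by (intro open_vimage[OF assms(2)] continuous_intros)
      then show ?thesis using assms(3) eventually_nhds_in_open by fastforce
    qed
    then obtain e where e: "e > 0" "\<And>s. dist s 0 < e \<Longrightarrow> u0 + s *\<^sub>R y \<in> U"
      unfolding eventually_nhds_metric by blast
    have "L (u0 + (e/2) *\<^sub>R y) + k = 0" using e by (intro assms(4)) simp
    moreover have "L (u0 + (e/2) *\<^sub>R y) = L u0 + (e/2) *\<^sub>R L y"
      by (simp add: linear_add[OF assms(1)] linear_scale[OF assms(1)])
    ultimately show ?thesis using assms(4)[OF assms(3)] e(1)
      by (metis add.commute add.left_commute add_cancel_left_right divide_eq_0_iff less_irrefl scaleR_eq_0_iff zero_neq_numeral)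
  qed
  show "L y = 0" by (rule L)
  show "k = 0" using assms(3,4) L by simp
qed

text \<open>Extension of an alternating form by one new basis vector, whose pairing with
  \<open>z\<close> is \<open>\<omega> z\<close>. It is applied twice, to add the
  \<open>x\<close>-direction and the \<open>t\<close>-direction.\<close>

definition extend_form ::
    "('a::real_vector \<Rightarrow> 'a \<Rightarrow> 'c::real_vector) \<Rightarrow> ('a \<Rightarrow> 'c) \<Rightarrow> 'a \<times> real \<Rightarrow> 'a \<times> real \<Rightarrow> 'c" where
  "extend_form A \<omega> Y Z = A (fst Y) (fst Z) + snd Y *\<^sub>R \<omega> (fst Z) - snd Z *\<^sub>R \<omega> (fst Y)"

lemma bilinear_extend_form:
  assumes "bilinear A" "linear \<omega>"
  shows "bilinear (extend_form A \<omega>)"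
  unfolding bilinear_def extend_form_def using assms
  by (auto intro!: linearI simp: bilinear_ladd bilinear_radd bilinear_lmul bilinear_rmul linear_add linear_cmul
      algebra_simps)

lemma extend_form_skew:
  assumes "\<And>y z. A y z = - A z y"
  shows "extend_form A \<omega> Y Z = - extend_form A \<omega> Z Y"
  using assms[of "fst Y" "fst Z"] by (simp add: extend_form_def)

text \<open>A 4-form on the extended space consists of its restriction and of the 3-form obtained by
  inserting the new vector once; these are the two assumptions. Terms with the new vector inserted
  twice cancel by symmetry of \<open>B\<close>.\<close>

lemma extend_form_quadric:
  assumes B: "bilinear B" and sym: "\<And>v w. B v w = (B w v :: real)"
    and Q: "\<And>x y z t. B (A x y) (A z t) - B (A x z) (A y t) + B (A x t) (A y z) = 0"
    and cyc: "\<And>y z t. B (\<omega> y) (A z t) - B (\<omega> z) (A y t) + B (\<omega> t) (A y z) = 0"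
  shows "B (extend_form A \<omega> X Y) (extend_form A \<omega> Z T) - B (extend_form A \<omega> X Z) (extend_form A \<omega> Y T)
    + B (extend_form A \<omega> X T) (extend_form A \<omega> Y Z) = 0"
proof -
  obtain x x' y y' z z' t t' where e: "X = (x, x')" "Y = (y, y')" "Z = (z, z')" "T = (t, t')" by (meson surj_pair)
  have "x' * (B (\<omega> y) (A z t) - B (\<omega> z) (A y t) + B (\<omega> t) (A y z)) = 0"
    "y' * (B (\<omega> x) (A z t) - B (\<omega> z) (A x t) + B (\<omega> t) (A x z)) = 0"
    "z' * (B (\<omega> x) (A y t) - B (\<omega> y) (A x t) + B (\<omega> t) (A x y)) = 0"
    "t' * (B (\<omega> x) (A y z) - B (\<omega> y) (A x z) + B (\<omega> z) (A x y)) = 0"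
    by (simp_all only: cyc mult_zero_right)
  note facts = this
  have ex: "B (extend_form A \<omega> (a, a') (b, b')) (extend_form A \<omega> (c, c') (d, d')) =
      B (A a b) (A c d) + c' * B (\<omega> d) (A a b) - d' * B (\<omega> c) (A a b) +
      a' * B (\<omega> b) (A c d) + a' * c' * B (\<omega> b) (\<omega> d) - a' * d' * B (\<omega> b) (\<omega> c) -
      b' * B (\<omega> a) (A c d) - b' * c' * B (\<omega> a) (\<omega> d) + b' * d' * B (\<omega> a) (\<omega> c)" for a a' b b' c c' d d'
  proof -
    have "B (A a b) (extend_form A \<omega> (c, c') (d, d')) = B (A a b) (A c d) + c' * B (\<omega> d) (A a b) - d' * B (\<omega> c) (A a b)"
      by (simp add: extend_form_def bilinear_radd[OF B] bilinear_rsub[OF B] bilinear_rmul[OF B] sym[of "A a b" "\<omega> _"])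
    moreover have "B (\<omega> p) (extend_form A \<omega> (c, c') (d, d')) = B (\<omega> p) (A c d) + c' * B (\<omega> p) (\<omega> d) - d' * B (\<omega> p) (\<omega> c)" for p
      by (simp add: extend_form_def bilinear_radd[OF B] bilinear_rsub[OF B] bilinear_rmul[OF B])
    moreover have "B (extend_form A \<omega> (a, a') (b, b')) v = B (A a b) v + a' * B (\<omega> b) v - b' * B (\<omega> a) v" for v
      by (simp add: extend_form_def bilinear_ladd[OF B] bilinear_lsub[OF B] bilinear_lmul[OF B])
    ultimately show ?thesis by (simp only: distrib_left right_diff_distrib mult.assoc)
  qed
  show ?thesis
    unfolding e ex sym[of "\<omega> z" "\<omega> y"] sym[of "\<omega> t" "\<omega> y"] sym[of "\<omega> t" "\<omega> z"]
    using facts Q[of x y z t]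
    by (simp only: distrib_left right_diff_distrib mult.assoc mult.left_commute[of z' y']
        mult.left_commute[of t' y'] mult.left_commute[of t' z']; linarith)
qed

lemma diff_fun_field:
  assumes "open U" "smooth_on U f"
  shows "differential_function_on (jet_dom U) (\<lambda>z. f (snd z 1))"
  using jet_smooth_field[OF assms] by (auto simp: diff_fun_iff jet_order_le_def intro!: exI[of _ 1])

lemma jet_field_on_vec:
  "jet_field_on S P \<longleftrightarrow> (\<forall>i. differential_function_on S (\<lambda>z. P z $ i))"
  by (auto simp: jet_field_on_def Basis_vec_def inner_axis)

lemma linear_eq_axis: "linear L \<Longrightarrow> linear M \<Longrightarrow> (\<And>i. L (axis i 1) = M (axis i 1)) \<Longrightarrow> L y = M y"
  for L M :: "real^'n::finite \<Rightarrow> 'b::real_vector"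
  by (simp add: linear_axis_sum[of L y] linear_axis_sum[of M y])

text \<open>Removes the outer total derivative of the operator. Its kernel consists of constants
  since \<open>U\<close> is connected, so one constant per component remains; they are collected in
  \<open>\<kappa>\<close>.\<close>

lemma hamiltonian_flux_constant:
  fixes U :: "(real^'n::finite) set"
  assumes U: "open U" "connected U" and V: "smooth_on U V"
    and g: "smooth_on U g" and \<Gamma>: "smooth_on U \<Gamma>"
    and q: "\<And>j. differential_function_on (jet_dom U) (q j)"
    and eq: "\<And>z i. z \<in> jet_dom U \<Longrightarrow> total_dx (\<lambda>z. V (snd z 1) $ i) z = outer_op g \<Gamma> q i z"
  obtains \<kappa> :: "real^'n" where "\<And>z i. z \<in> jet_dom U \<Longrightarrow> V (snd z 1) $ i - \<kappa> $ i =
     (\<Sum>j\<in>UNIV. g (snd z 1) $ i $ j * total_dx (q j) z + (\<Sum>k\<in>UNIV. \<Gamma> (snd z 1) $ i $ j $ k * snd z 2 $ k) * q j z)"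
proof -
  let ?S = "jet_dom U"
  have S: "open ?S" by (rule open_jet_dom[OF U(1)])
  let ?f = "\<lambda>i z. \<Sum>j\<in>UNIV. g (snd z 1) $ i $ j * total_dx (q j) z + (\<Sum>k\<in>UNIV. \<Gamma> (snd z 1) $ i $ j $ k * snd z 2 $ k) * q j z"
  have Vi: "smooth_on U (\<lambda>u. V u $ i)" for i
    using V smooth_on_vec_nth_iff[OF U(1)] by blast
  note df = diff_fun_sum[OF S] diff_fun_mult[OF S] diff_fun_add[OF S]
    diff_fun_const[OF S] diff_fun_coord[OF S] diff_fun_total_dx[OF S] q
  have dg: "differential_function_on ?S (\<lambda>z. g (snd z 1) $ i $ j)" for i j
    by (rule diff_fun_field[OF U(1) smooth_on_vec2[OF U(1) g]])
  have dG: "differential_function_on ?S (\<lambda>z. \<Gamma> (snd z 1) $ i $ j $ k)" for i j k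
    by (rule diff_fun_field[OF U(1) smooth_on_vec3[OF U(1) \<Gamma>]])
  have dV: "differential_function_on ?S (\<lambda>z. V (snd z 1) $ i)" for i
    by (rule diff_fun_field[OF U(1) Vi])
  have dff: "differential_function_on ?S (?f i)" for i
    by (intro df dg dG)
  have "\<exists>k. \<forall>z\<in>?S. V (snd z 1) $ i - ?f i z = k" for i
  proof -
    let ?d = "\<lambda>z. V (snd z 1) $ i + (- 1) * ?f i z"
    have dd: "differential_function_on ?S ?d" by (intro df dV dff)
    have dc: "?d z = ?d z'" if z: "z \<in> ?S" "z' \<in> ?S" for z z'
    proof (rule total_dx_zero_imp_constant[OF U refl dd _ z])
      fix z assume z: "z \<in> ?S"
      have "total_dx ?d z = total_dx (\<lambda>z. V (snd z 1) $ i) z + total_dx (\<lambda>z. (- 1) * ?f i z) z"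
        by (intro total_dx_add[OF S] df dV dff z)
      also have "total_dx (\<lambda>z. (- 1) * ?f i z) z = total_dx (\<lambda>z. - 1) z * ?f i z + (- 1) * total_dx (?f i) z"
        by (intro total_dx_mult[OF S] df dff z)
      finally show "total_dx ?d z = 0"
        using eq[OF z, of i] by (simp add: total_dx_const outer_op_def)
    qed
    have c: "V (snd z 1) $ i - ?f i z = V (snd z' 1) $ i - ?f i z'" if "z \<in> ?S" "z' \<in> ?S" for z z'
      using dc[OF that] by simp
    show ?thesis
    proof (cases "?S = {}")
      case False
      then obtain z0 where z0: "z0 \<in> ?S" by blast
      show ?thesis
        by (intro exI[of _ "V (snd z0 1) $ i - ?f i z0"] ballI c z0)
    qed simp
  qed
  then have "\<forall>i. \<exists>k. \<forall>z\<in>?S. V (snd z 1) $ i - ?f i z = k" by blast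
  from choice[OF this] obtain k where k: "\<And>i z. z \<in> ?S \<Longrightarrow> V (snd z 1) $ i - ?f i z = k i" by blast
  show ?thesis
  proof (rule that[of "\<chi> i. k i"])
    show "V (snd z 1) $ i - (\<chi> i. k i) $ i = ?f i z" if "z \<in> ?S" for z i
      using k[OF that, of i] by simp
  qed
qed

lemma sum_swap_pairs:
  "(\<Sum>i\<in>I. \<Sum>j\<in>J. \<Sum>a\<in>A. \<Sum>k\<in>K. f i j a k) = (\<Sum>a\<in>A. \<Sum>k\<in>K. \<Sum>i\<in>I. \<Sum>j\<in>J. f i j a k)"
proof -
  have "(\<Sum>i\<in>I. \<Sum>j\<in>J. \<Sum>a\<in>A. \<Sum>k\<in>K. f i j a k) = (\<Sum>i\<in>I. \<Sum>a\<in>A. \<Sum>j\<in>J. \<Sum>k\<in>K. f i j a k)"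
    by (rule sum.cong[OF refl], rule sum.swap)
  also have "\<dots> = (\<Sum>a\<in>A. \<Sum>i\<in>I. \<Sum>j\<in>J. \<Sum>k\<in>K. f i j a k)" by (rule sum.swap)
  also have "\<dots> = (\<Sum>a\<in>A. \<Sum>i\<in>I. \<Sum>k\<in>K. \<Sum>j\<in>J. f i j a k)"
    by (rule sum.cong[OF refl], rule sum.cong[OF refl], rule sum.swap)
  also have "\<dots> = (\<Sum>a\<in>A. \<Sum>k\<in>K. \<Sum>i\<in>I. \<Sum>j\<in>J. f i j a k)"
    by (rule sum.cong[OF refl], rule sum.swap)
  finally show ?thesis .
qed

text \<open>The components of \<open>A\<close> have separate sources: within the
  \<open>b\<close>-space they are the map \<open>K\<close> of the operator, between \<open>x\<close>
  and \<open>b\<close> the constant part \<open>\<omega>\<close> of its frame, and those with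
  \<open>t\<close> come from the affine right-hand side of the integrated equation. Correspondingly,
  the components of the quadric relation without \<open>t\<close> are the cyclic condition on
  \<open>c\<close>, and those with \<open>t\<close> are the Helmholtz conditions.\<close>

lemma linear_congruence_of_hamiltonian_system:
  notes [simp del] = One_nat_def
  fixes U :: "(real^'n::finite) set" and V :: "real^'n \<Rightarrow> real^'n"
  assumes U: "open U" "connected U" "u0 \<in> U" and V: "smooth_on U V"
    and op: "third_order_hamiltonian_operator U g \<Gamma>" and sys: "hamiltonian_system_wrt U V g \<Gamma>"
  obtains A B where "linear_congruence_on U V A B"
proof -
  obtain B :: "real^'n \<Rightarrow> real^'n \<Rightarrow> real" and K :: "real^'n \<Rightarrow> real^'n \<Rightarrow> real^'n" and \<omega> :: "real^'n \<Rightarrow> real^'n" where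
    B_bil: "bilinear B" and B_sym': "\<forall>v w. B v w = B w v" and B_nondeg': "\<forall>v. (\<forall>w. B w v = 0) \<longrightarrow> v = 0"
    and K_bil: "bilinear K" and K_skew': "\<forall>y z. K y z = - K z y" and \<omega>: "linear \<omega>"
    and g_eq': "\<forall>u\<in>U. \<forall>m p. g_low g m p u = B (K u (axis m 1) + \<omega> (axis m 1)) (K u (axis p 1) + \<omega> (axis p 1))"
    and c_eq': "\<forall>u\<in>U. \<forall>m p k. c_low g \<Gamma> m p k u = - B (K u (axis m 1) + \<omega> (axis m 1)) (K (axis k 1) (axis p 1))"
    using third_order_operator_structure[OF op U] by (elim exE conjE)
  have B_sym: "B v w = B w v" for v w using B_sym' by blast
  have B_nondeg: "v = 0" if "\<And>w. B w v = 0" for v using B_nondeg' that by blast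
  have K_skew: "K y z = - K z y" for y z using K_skew' by blast
  have g_eq: "g_low g m p u = B (K u (axis m 1) + \<omega> (axis m 1)) (K u (axis p 1) + \<omega> (axis p 1))"
    and c_eq: "c_low g \<Gamma> m p k u = - B (K u (axis m 1) + \<omega> (axis m 1)) (K (axis k 1) (axis p 1))"
    if "u \<in> U" for u m p k
    using g_eq' c_eq' that by blast+
  have gs: "smooth_on U g" "smooth_on U \<Gamma>" using op by (simp_all add: third_order_hamiltonian_operator_def)
  have det: "det (g u) \<noteq> 0"
    and e3: "c_low g \<Gamma> m p k u + c_low g \<Gamma> p k m u + c_low g \<Gamma> k m p u = 0"
    if "u \<in> U" for u k m p
    using op that unfolding third_order_hamiltonian_operator_def by blast+
  note B_simps = bilinear_ladd[OF B_bil] bilinear_radd[OF B_bil] bilinear_lmul[OF B_bil] bilinear_rmul[OF B_bil]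
    bilinear_lneg[OF B_bil] bilinear_rneg[OF B_bil]
  note lin_comp = linear_compose[unfolded o_def]
  define \<psi> where "\<psi> u y = K u y + \<omega> y" for u y
  have \<psi>_lin: "linear (\<psi> u)" for u
    unfolding \<psi>_def[abs_def] by (intro linear_compose_add bilinear_linear(1)[OF K_bil] \<omega>)
  have G_nth: "matrix_inv (g u) $ m $ p = B (\<psi> u (axis m 1)) (\<psi> u (axis p 1))" if "u \<in> U" for u m p
    using g_eq[OF that, of m p] by (simp add: g_low_def \<psi>_def)
  have frame: "metric_frame B (\<psi> u)" if u: "u \<in> U" for u
  proof (rule metric_frame.intro)
    fix y assume y: "\<psi> u y = 0"
    have "(matrix_inv (g u) *v y) $ i = 0" for i
    proof -
      have "linear (\<lambda>y. B (\<psi> u (axis i 1)) (\<psi> u y))"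
        using lin_comp[OF \<psi>_lin bilinear_linear(1)[OF B_bil]] .
      from linear_axis_sum[OF this, of y] show ?thesis
        by (simp add: matrix_vector_axis_sum G_nth[OF u] y bilinear_rzero[OF B_bil] mult.commute)
    qed
    then have "matrix_inv (g u) *v y = 0" by (simp add: vec_eq_iff)
    then have "(g u ** matrix_inv (g u)) *v y = 0" by (simp add: matrix_vector_mul_assoc[symmetric])
    then show "y = 0" by (simp add: matrix_inv_inverse[OF det[OF u]])
  qed (use B_bil B_sym B_nondeg \<psi>_lin in auto)
  have gram: "metric_frame.gram B (\<psi> u) = matrix_inv (g u)" if "u \<in> U" for u
    by (simp add: vec_eq_iff metric_frame.gram_def[OF frame[OF that]] G_nth[OF that])

  \<comment> \<open>Components of the quadric relation without \<open>t\<close>\<close>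
  have cyc_u: "B (\<psi> u y) (K z t) - B (\<psi> u z) (K y t) + B (\<psi> u t) (K y z) = 0" if u: "u \<in> U" for u y z t
  proof -
    let ?F = "\<lambda>y z t. B (\<psi> u y) (K z t) - B (\<psi> u z) (K y t) + B (\<psi> u t) (K y z)"
    have b: "?F (axis m 1) (axis k 1) (axis p 1) = 0" for m k p
      using e3[OF u, of m p k] K_skew[of "axis p 1" "axis m 1"]
      by (simp add: c_eq[OF u] \<psi>_def[symmetric] B_simps)
    have l: "linear (\<lambda>y. B (\<psi> u y) v)" "linear (\<lambda>y. B v (K y w))" "linear (\<lambda>y. B v (K w y))" for v w
      using lin_comp[OF \<psi>_lin bilinear_linear(2)[OF B_bil]]
        lin_comp[OF bilinear_linear(2)[OF K_bil] bilinear_linear(1)[OF B_bil]]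
        lin_comp[OF bilinear_linear(1)[OF K_bil] bilinear_linear(1)[OF B_bil]] by auto
    have z: "linear (\<lambda>y::real^'n. 0::real)" by (rule linear_zero)
    have a1: "?F y (axis k 1) (axis p 1) = 0" for k p y
      by (rule linear_eq_axis[of "\<lambda>y. ?F y (axis k 1) (axis p 1)" "\<lambda>y. 0", OF _ z b])
        (intro linear_compose_add linear_compose_sub l)
    have a2: "?F y z (axis p 1) = 0" for p y z
      by (rule linear_eq_axis[of "\<lambda>z. ?F y z (axis p 1)" "\<lambda>y. 0", OF _ z a1])
        (intro linear_compose_add linear_compose_sub l)
    show ?thesis
      by (rule linear_eq_axis[of "\<lambda>t. ?F y z t" "\<lambda>y. 0", OF _ z a2])
        (intro linear_compose_add linear_compose_sub l)
  qed
  \<comment> \<open>The identity \<open>cyc_u\<close> is affine in \<open>u\<close>, so on an open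
    set its two parts vanish separately: the linear part is the 4-form on the
    \<open>b\<close>-space, the constant part its contraction with the
    \<open>x\<close>-direction.\<close>
  have cyc: "B (K x y) (K z t) - B (K x z) (K y t) + B (K x t) (K y z) = 0"
    "B (\<omega> y) (K z t) - B (\<omega> z) (K y t) + B (\<omega> t) (K y z) = 0" for x y z t
  proof -
    let ?L = "\<lambda>x. B (K x y) (K z t) - B (K x z) (K y t) + B (K x t) (K y z)"
    have l: "linear (\<lambda>x. B (K x w) v)" for v w
      using lin_comp[OF bilinear_linear(2)[OF K_bil] bilinear_linear(2)[OF B_bil]] .
    have L: "linear ?L" by (intro linear_compose_add linear_compose_sub l)
    have "?L u + (B (\<omega> y) (K z t) - B (\<omega> z) (K y t) + B (\<omega> t) (K y z)) = 0" if "u \<in> U" for u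
      using cyc_u[OF that, of y z t] by (simp add: \<psi>_def B_simps)
    from affine_vanishes_on_open[OF L U(1,3) this]
    show "?L x = 0" "B (\<omega> y) (K z t) - B (\<omega> z) (K y t) + B (\<omega> t) (K y z) = 0" by auto
  qed

  \<comment> \<open>The Hamiltonian equation in the frame\<close>
  let ?S = "jet_dom U"
  have S: "open ?S" by (rule open_jet_dom[OF U(1)])
  note d = jet_derivation_total_dx[OF S]
  have in_S: "snd z 1 \<in> U" if "z \<in> ?S" for z using that by (simp add: jet_dom_def)
  obtain h where h: "differential_function_on ?S h"
    and heq: "\<And>z i. z \<in> ?S \<Longrightarrow> total_dx (\<lambda>z. V (snd z 1) $ i) z = outer_op g \<Gamma> (\<lambda>j z. - var_deriv_b h j z) i z"
    using sys unfolding hamiltonian_system_wrt_def by blast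
  define q where "q = (\<lambda>j z. - var_deriv_b h j z)"
  have q: "differential_function_on ?S (q j)" for j
  proof -
    have "differential_function_on ?S (\<lambda>z. (- 1) * var_deriv_b h j z)"
      by (intro diff_fun_mult[OF S] diff_fun_const[OF S]
          diff_fun_var_deriv_b[OF S h])
    then show ?thesis by (simp add: q_def)
  qed
  obtain \<kappa> where \<kappa>: "\<And>z i. z \<in> ?S \<Longrightarrow> V (snd z 1) $ i - \<kappa> $ i =
     (\<Sum>j\<in>UNIV. g (snd z 1) $ i $ j * total_dx (q j) z + (\<Sum>k\<in>UNIV. \<Gamma> (snd z 1) $ i $ j $ k * snd z 2 $ k) * q j z)"
    by (rule hamiltonian_flux_constant[OF U(1,2) V gs q]) (use heq in \<open>auto simp: q_def\<close>)

  \<comment> \<open>\<open>w\<close> are the components of \<open>q\<close> in the frame: \<open>q\<^sub>j = B (\<psi> e\<^sub>j) w\<close>\<close>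
  define r where "r z = g (snd z 1) *v (\<chi> j. q j z)" for z
  define w where "w z = \<psi> (snd z 1) (r z)" for z
  have r_field: "jet_field_on ?S r"
    unfolding jet_field_on_vec r_def matrix_vector_axis_sum vec_lambda_beta
    by (intro allI diff_fun_sum[OF S] diff_fun_mult[OF S] q
        diff_fun_field[OF U(1) smooth_on_vec2[OF U(1) gs(1)]])
  have w_field: "jet_field_on ?S w"
    unfolding w_def \<psi>_def
    by (intro jet_field_on_add[OF S] jet_vec_bilinear(1)[OF d K_bil] jet_vec_linear(1)[OF d \<omega>]
        jet_field_on_coord[OF S] r_field)
  have qw: "q j z = B (\<psi> (snd z 1) (axis j 1)) (w z)" if z: "z \<in> ?S" for j z
  proof -
    note u = in_S[OF z]
    have "B (\<psi> (snd z 1) (axis j 1)) (w z) = (matrix_inv (g (snd z 1)) *v r z) $ j"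
      using metric_frame.gram_mult[OF frame[OF u], of "r z" j] unfolding gram[OF u] w_def by simp
    also have "matrix_inv (g (snd z 1)) *v r z = (\<chi> j. q j z)"
      unfolding r_def matrix_vector_mul_assoc matrix_inv_inverse(2)[OF det[OF u]] by simp
    finally show ?thesis by simp
  qed
  have \<psi>_field: "jet_field_on ?S (\<lambda>z. \<psi> (snd z 1) y)" for y
    unfolding \<psi>_def
    by (intro jet_field_on_add[OF S] jet_vec_bilinear(1)[OF d K_bil] jet_field_on_coord[OF S] jet_field_on_const[OF d])
  have \<psi>_deriv: "jet_vec \<delta> (\<lambda>z. \<psi> (snd z 1) y) z = K (jet_vec \<delta> (\<lambda>z. snd z 1) z) y"
    if \<delta>: "jet_derivation ?S \<delta>" and z: "z \<in> ?S" for \<delta> z y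
  proof -
    have "jet_vec \<delta> (\<lambda>z. \<psi> (snd z 1) y) z = jet_vec \<delta> (\<lambda>z. K (snd z 1) y) z + jet_vec \<delta> (\<lambda>z. \<omega> y) z"
      unfolding \<psi>_def
      by (intro jet_vec_add[OF \<delta>] jet_vec_bilinear(1)[OF d K_bil] jet_field_on_coord[OF S] jet_field_on_const[OF d] z)
    also have "jet_vec \<delta> (\<lambda>z. K (snd z 1) y) z = K (jet_vec \<delta> (\<lambda>z. snd z 1) z) y"
      by (rule jet_vec_linear(2)[OF \<delta> bilinear_linear(2)[OF K_bil] jet_field_on_coord[OF S] z])
    finally show ?thesis by (simp add: jet_vec_const[OF \<delta>])
  qed
  have qw_field: "differential_function_on ?S (\<lambda>z. B (\<psi> (snd z 1) y) (w z))" for y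
    using jet_vec_bilinear(1)[OF d B_bil \<psi>_field w_field] by (simp add: jet_field_on_real)
  have qw_deriv: "\<delta> (\<lambda>z. B (\<psi> (snd z 1) y) (w z)) z =
      B (K (jet_vec \<delta> (\<lambda>z. snd z 1) z) y) (w z) + B (\<psi> (snd z 1) y) (jet_vec \<delta> w z)"
    if \<delta>: "jet_derivation ?S \<delta>" and z: "z \<in> ?S" for \<delta> z y
    using jet_vec_bilinear(2)[OF \<delta> B_bil \<psi>_field w_field z, of y] by (simp add: jet_vec_real \<psi>_deriv[OF \<delta> z])

  \<comment> \<open>Lowering the index of the integrated equation leaves
    \<open>total_dx (q b) z\<close> minus \<open>B (K (snd z 2) (axis b 1)) (w z)\<close>. By the
    Leibniz rule the second term is exactly the derivative of the frame vector in
    \<open>q b\<close>, so only the derivative of \<open>w\<close> survives.\<close>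
  have Dw: "jet_vec total_dx w z = \<psi> (snd z 1) (V (snd z 1) - \<kappa>)" if z: "z \<in> ?S" for z
  proof -
    define u where "u = snd z 1"
    have u: "u \<in> U" using in_S[OF z] by (simp add: u_def)
    interpret fr: metric_frame B "\<psi> u" by (rule frame[OF u])
    define G where "G = matrix_inv (g u)"
    have Gg: "G ** g u = mat 1" by (simp add: G_def matrix_inv_inverse[OF det[OF u]])
    have Gg_sum: "(\<Sum>i\<in>UNIV. G $ b $ i * g u $ i $ j) = (if b = j then 1 else 0)" for b j
      using arg_cong[OF Gg, of "\<lambda>M. M $ b $ j"] by (simp add: matrix_matrix_mult_def mat_def)
    have "(\<chi> j. q j z) = G *v r z"
      by (simp add: r_def u_def[symmetric] matrix_vector_mul_assoc Gg)
    then have q_sum: "q j z = (\<Sum>a\<in>UNIV. G $ j $ a * r z $ a)" for j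
      using matrix_vector_axis_sum[of G "r z" j] by (metis vec_lambda_beta)
    have key: "B (\<psi> u (axis b 1)) (jet_vec total_dx w z) = B (\<psi> u (axis b 1)) (\<psi> u (V u - \<kappa>))" for b
    proof -
      have t: "total_dx (q j) z = B (K (snd z 2) (axis j 1)) (w z) + B (\<psi> u (axis j 1)) (jet_vec total_dx w z)" for j
      proof -
        have "total_dx (q j) z = total_dx (\<lambda>z. B (\<psi> (snd z 1) (axis j 1)) (w z)) z"
          by (rule total_dx_cong[OF S z qw])
        then show ?thesis
          by (simp add: qw_deriv[OF d z] jet_vec_total_dx_coord u_def numeral_2_eq_2)
      qed
      have "B (\<psi> u (axis b 1)) (\<psi> u (V u - \<kappa>)) = (G *v (V u - \<kappa>)) $ b"
        using fr.gram_mult[of "V u - \<kappa>" b] by (simp add: gram[OF u] G_def)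
      also have "\<dots> = (\<Sum>i\<in>UNIV. G $ b $ i * (\<Sum>j\<in>UNIV. g u $ i $ j * total_dx (q j) z + (\<Sum>k\<in>UNIV. \<Gamma> u $ i $ j $ k * snd z 2 $ k) * q j z))"
        unfolding matrix_vector_axis_sum vector_minus_component using \<kappa>[OF z] by (simp add: u_def)
      also have "\<dots> = (\<Sum>i\<in>UNIV. \<Sum>j\<in>UNIV. (G $ b $ i * g u $ i $ j) * total_dx (q j) z) +
         (\<Sum>i\<in>UNIV. \<Sum>j\<in>UNIV. G $ b $ i * ((\<Sum>k\<in>UNIV. \<Gamma> u $ i $ j $ k * snd z 2 $ k) * q j z))"
        by (simp add: sum_distrib_left distrib_left sum.distrib mult.assoc)
      also have "(\<Sum>i\<in>UNIV. \<Sum>j\<in>UNIV. (G $ b $ i * g u $ i $ j) * total_dx (q j) z) =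
         (\<Sum>j\<in>UNIV. (\<Sum>i\<in>UNIV. G $ b $ i * g u $ i $ j) * total_dx (q j) z)"
        unfolding sum_distrib_right by (rule sum.swap)
      also have "\<dots> = total_dx (q b) z"
        by (simp add: Gg_sum if_distrib[of "\<lambda>x. x * _"] cong: if_cong)
      also have "(\<Sum>i\<in>UNIV. \<Sum>j\<in>UNIV. G $ b $ i * ((\<Sum>k\<in>UNIV. \<Gamma> u $ i $ j $ k * snd z 2 $ k) * q j z)) =
         - B (K (snd z 2) (axis b 1)) (w z)"
      proof -
        \<comment> \<open>Writing \<open>q j z\<close> through \<open>r z\<close> supplies the
          second factor \<open>G\<close>; the two factors together lower both indices of
          \<open>\<Gamma>\<close>, crosswise as in \<open>c_low\<close>.\<close>
        have "(\<Sum>i\<in>UNIV. \<Sum>j\<in>UNIV. G $ b $ i * ((\<Sum>k\<in>UNIV. \<Gamma> u $ i $ j $ k * snd z 2 $ k) * q j z)) =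
          (\<Sum>i\<in>UNIV. \<Sum>j\<in>UNIV. \<Sum>a\<in>UNIV. \<Sum>k\<in>UNIV. (G $ a $ j * G $ b $ i * \<Gamma> u $ i $ j $ k) * snd z 2 $ k * r z $ a)"
        proof (rule sum.cong[OF refl], rule sum.cong[OF refl])
          fix i j
          have Gs: "G $ j $ a = G $ a $ j" for a
            using G_nth[OF u, of j a] G_nth[OF u, of a j] B_sym unfolding G_def by metis
          have "G $ b $ i * ((\<Sum>k\<in>UNIV. \<Gamma> u $ i $ j $ k * snd z 2 $ k) * q j z) =
            (\<Sum>a\<in>UNIV. (G $ a $ j * r z $ a) * (\<Sum>k\<in>UNIV. G $ b $ i * (\<Gamma> u $ i $ j $ k * snd z 2 $ k)))"
            unfolding q_sum Gs sum_distrib_right[symmetric] sum_distrib_left[symmetric] by simp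
          also have "\<dots> = (\<Sum>a\<in>UNIV. \<Sum>k\<in>UNIV. (G $ a $ j * G $ b $ i * \<Gamma> u $ i $ j $ k) * snd z 2 $ k * r z $ a)"
            by (simp add: sum_distrib_left mult_ac)
          finally show "G $ b $ i * ((\<Sum>k\<in>UNIV. \<Gamma> u $ i $ j $ k * snd z 2 $ k) * q j z) =
            (\<Sum>a\<in>UNIV. \<Sum>k\<in>UNIV. (G $ a $ j * G $ b $ i * \<Gamma> u $ i $ j $ k) * snd z 2 $ k * r z $ a)" .
        qed
        also have "\<dots> = (\<Sum>a\<in>UNIV. \<Sum>k\<in>UNIV. \<Sum>i\<in>UNIV. \<Sum>j\<in>UNIV. (G $ a $ j * G $ b $ i * \<Gamma> u $ i $ j $ k) * snd z 2 $ k * r z $ a)"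
          by (rule sum_swap_pairs)
        also have "\<dots> = (\<Sum>a\<in>UNIV. \<Sum>k\<in>UNIV. c_low g \<Gamma> a b k u * snd z 2 $ k * r z $ a)"
          by (simp add: c_low_def g_low_def G_def sum_distrib_right)
        also have "\<dots> = (\<Sum>a\<in>UNIV. r z $ a * (- B (\<psi> u (axis a 1)) (K (snd z 2) (axis b 1))))"
        proof (rule sum.cong[OF refl])
          fix a
          have "linear (\<lambda>y. B (\<psi> u (axis a 1)) (K y (axis b 1)))"
            using lin_comp[OF bilinear_linear(2)[OF K_bil] bilinear_linear(1)[OF B_bil]] .
          from linear_axis_sum[OF this, of "snd z 2"]
          show "(\<Sum>k\<in>UNIV. c_low g \<Gamma> a b k u * snd z 2 $ k * r z $ a) = r z $ a * (- B (\<psi> u (axis a 1)) (K (snd z 2) (axis b 1)))"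
            by (simp add: c_eq[OF u] \<psi>_def[symmetric] sum_distrib_left sum_negf mult_ac)
        qed
        also have "\<dots> = - B (w z) (K (snd z 2) (axis b 1))"
        proof -
          have "linear (\<lambda>y. B (\<psi> u y) (K (snd z 2) (axis b 1)))"
            using lin_comp[OF \<psi>_lin bilinear_linear(2)[OF B_bil]] .
          from linear_axis_sum[OF this, of "r z"] show ?thesis
            by (simp add: w_def u_def sum_negf)
        qed
        finally show ?thesis by (simp add: B_sym)
      qed
      finally show ?thesis unfolding t by simp
    qed
    have "jet_vec total_dx w z - \<psi> u (V u - \<kappa>) = 0"
    proof (rule B_nondeg)
      fix x
      obtain y where x: "x = \<psi> u y" by (rule fr.frame_surj)
      have "B (\<psi> u y) (jet_vec total_dx w z) = B (\<psi> u y) (\<psi> u (V u - \<kappa>))"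
        by (rule linear_eq_axis[of "\<lambda>y. B (\<psi> u y) (jet_vec total_dx w z)" "\<lambda>y. B (\<psi> u y) (\<psi> u (V u - \<kappa>))"])
          (use key in \<open>auto intro!: lin_comp[OF \<psi>_lin bilinear_linear(2)[OF B_bil]]\<close>)
      then show "B x (jet_vec total_dx w z - \<psi> u (V u - \<kappa>)) = 0" by (simp add: x bilinear_rsub[OF B_bil])
    qed
    then show ?thesis by (simp add: u_def)
  qed

  \<comment> \<open>Affine dependence on \<open>b\<close> and \<open>x\<close>\<close>
  have "\<exists>\<eta> \<xi> \<zeta>. (\<forall>z\<in>?S. w z $ i = \<eta> \<bullet> snd z 0 + \<xi> * fst z + \<zeta>) \<and> (\<forall>u\<in>U. \<psi> u (V u - \<kappa>) $ i = \<eta> \<bullet> u + \<xi>)" for i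
  proof -
    have wi: "differential_function_on ?S (\<lambda>z. w z $ i)" using w_field by (simp add: jet_field_on_vec)
    have "total_dx (\<lambda>z. w z $ i) z = \<psi> (snd z 1) (V (snd z 1) - \<kappa>) $ i" if "z \<in> ?S" for z
      using jet_vec_inner[of "axis i 1" total_dx w z] Dw[OF that] by (simp add: inner_axis)
    note tot = this
    obtain \<eta> \<xi> \<zeta> where "\<And>z. z \<in> ?S \<Longrightarrow> w z $ i = \<eta> \<bullet> snd z 0 + \<xi> * fst z + \<zeta>"
      "\<And>u. u \<in> U \<Longrightarrow> \<psi> u (V u - \<kappa>) $ i = \<eta> \<bullet> u + \<xi>"
    proof (rule total_dx_field_imp_affine[OF U(1,2) refl wi, of "\<lambda>u. \<psi> u (V u - \<kappa>) $ i"])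
      show "U \<noteq> {}" using U(3) by blast
    qed (use tot in auto)
    then show ?thesis by blast
  qed
  then obtain \<eta> \<xi> \<zeta> where
    w_aff: "\<And>z i. z \<in> ?S \<Longrightarrow> w z $ i = \<eta> i \<bullet> snd z 0 + \<xi> i * fst z + \<zeta> i"
    and F_aff: "\<And>u i. u \<in> U \<Longrightarrow> \<psi> u (V u - \<kappa>) $ i = \<eta> i \<bullet> u + \<xi> i" by metis
  define H where "H y = (\<chi> i. \<eta> i \<bullet> y)" for y :: "real^'n"
  define X :: "real^'n" where "X = (\<chi> i. \<xi> i)"
  have H: "linear H" unfolding H_def by (rule linearI) (simp_all add: vec_eq_iff inner_add_right)
  have F: "\<psi> u (V u - \<kappa>) = H u + X" if "u \<in> U" for u
    using F_aff[OF that] by (simp add: vec_eq_iff H_def X_def)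
  have w_jet: "jet_vec (jet_d e) w z = (case e of Some (0, i) \<Rightarrow> H (axis i 1) | None \<Rightarrow> X | _ \<Rightarrow> 0)"
    if z: "z \<in> ?S" for e z
  proof -
    note de = jet_derivation_jet_d[OF S, of e]
    have f: "jet_field_on ?S (\<lambda>z. H (snd z 0))" "jet_field_on ?S (\<lambda>z. fst z *\<^sub>R X)" "jet_field_on ?S (\<lambda>z. \<chi> i. \<zeta> i)"
      using jet_vec_linear(1)[OF d H jet_field_on_coord[OF S]]
        jet_vec_linear(1)[OF d _ jet_field_on_fst[OF S], of "\<lambda>x. x *\<^sub>R X"]
        jet_field_on_const[OF d] by (auto intro: linearI simp: scaleR_left_distrib)
    have we: "w z = H (snd z 0) + fst z *\<^sub>R X + (\<chi> i. \<zeta> i)" if "z \<in> ?S" for z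
      using w_aff[OF that] by (simp add: vec_eq_iff H_def X_def mult.commute)
    have "jet_vec (jet_d e) w z = jet_vec (jet_d e) (\<lambda>z. H (snd z 0) + fst z *\<^sub>R X + (\<chi> i. \<zeta> i)) z"
      unfolding jet_vec_def by (intro sum.cong refl arg_cong2[where f=scaleR] jet_d_cong[OF S z]) (simp only: we)
    also have "\<dots> = jet_vec (jet_d e) (\<lambda>z. H (snd z 0)) z + jet_vec (jet_d e) (\<lambda>z. fst z *\<^sub>R X) z + jet_vec (jet_d e) (\<lambda>z. \<chi> i. \<zeta> i) z"
      using f by (simp add: jet_vec_add[OF de _ _ z] jet_field_on_add[OF S])
    also have "jet_vec (jet_d e) (\<lambda>z. H (snd z 0)) z = H (jet_vec (jet_d e) (\<lambda>z. snd z 0) z)"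
      by (rule jet_vec_linear(2)[OF de H jet_field_on_coord[OF S] z])
    also have "jet_vec (jet_d e) (\<lambda>z. fst z *\<^sub>R X) z = jet_vec (jet_d e) fst z *\<^sub>R X"
      by (rule jet_vec_linear(2)[OF de _ jet_field_on_fst[OF S] z]) (auto intro: linearI simp: scaleR_left_distrib)
    finally show ?thesis
      by (auto simp: jet_vec_const[OF de] jet_vec_jet_d_coord jet_vec_jet_d_fst linear_0[OF H] split: option.splits nat.splits)
  qed

  \<comment> \<open>Helmholtz conditions\<close>
  have helm_axis: "B (\<psi> u (axis j 1)) (H (axis i 1)) - B (K (axis i 1) (axis j 1)) (H u + X) - B (\<psi> u (axis i 1)) (H (axis j 1)) = 0"
    if u: "u \<in> U" for u i j
  proof -
    \<comment> \<open>The resulting condition involves \<open>u\<close> only, so any jet over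
      \<open>u\<close> serves.\<close>
    define z :: "'n jet" where "z = (0, \<lambda>k. u)"
    have z: "z \<in> ?S" using u by (simp add: z_def jet_dom_def)
    let ?p = "\<lambda>j z. (- 1) * B (\<psi> (snd z 1) (axis j 1)) (w z)"
    have p: "var_deriv_b h j z = ?p j z" if "z \<in> ?S" for z j
      using qw[OF that, of j] by (simp add: q_def)
    have pd: "\<delta> (?p j) z = - (B (K (jet_vec \<delta> (\<lambda>z. snd z 1) z) (axis j 1)) (w z) + B (\<psi> (snd z 1) (axis j 1)) (jet_vec \<delta> w z))"
      if \<delta>: "jet_derivation ?S \<delta>" and z: "z \<in> ?S" for \<delta> z j
    proof -
      have "\<delta> (?p j) z = \<delta> (\<lambda>z. - 1) z * B (\<psi> (snd z 1) (axis j 1)) (w z) + (- 1) * \<delta> (\<lambda>z. B (\<psi> (snd z 1) (axis j 1)) (w z)) z"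
        by (intro derivation_mult[OF \<delta>] diff_fun_const[OF S] qw_field z)
      then show ?thesis by (simp add: derivation_const[OF \<delta>] qw_deriv[OF \<delta> z])
    qed
    have o1: "jet_order_le 1 ?S (?p j)"
      unfolding jet_order_le_def
    proof (intro ballI impI)
      fix z z' assume zz: "z \<in> ?S" "z' \<in> ?S" "fst z = fst z' \<and> (\<forall>k\<le>1. snd z k = snd z' k)"
      have "w z = w z'" using w_aff[OF zz(1)] w_aff[OF zz(2)] zz(3) by (simp add: vec_eq_iff)
      with zz(3) show "?p j z = ?p j z'" by simp
    qed
    have d1: "jet_d (Some (1, i)) (?p j) z = - B (K (axis i 1) (axis j 1)) (w z)" if "z \<in> ?S" for z
      using pd[OF jet_derivation_jet_d[OF S] that, of "Some (1, i)" j] w_jet[OF that, of "Some (1, i)"]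
      by (simp add: jet_vec_jet_d_coord bilinear_rzero[OF B_bil] nat.case(2)[of _ _ 0, folded One_nat_def])
    have d0: "jet_d (Some (0, i)) (?p j) z = - B (\<psi> u (axis j 1)) (H (axis i 1))" for i j
      using pd[OF jet_derivation_jet_d[OF S] z, of "Some (0, i)" j] w_jet[OF z, of "Some (0, i)"]
      by (simp add: jet_vec_jet_d_coord bilinear_lzero[OF B_bil] bilinear_lzero[OF K_bil] z_def)
    have "total_dx (jet_d (Some (1, i)) (?p j)) z = total_dx (\<lambda>z. - B (K (axis i 1) (axis j 1)) (w z)) z"
      by (rule total_dx_cong[OF S z d1])
    also have "\<dots> = - B (K (axis i 1) (axis j 1)) (jet_vec total_dx w z)"
      using jet_vec_linear(2)[OF d linear_compose_neg[OF bilinear_linear(1)[OF B_bil]] w_field z]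
      by (simp add: jet_vec_real)
    also have "\<dots> = - B (K (axis i 1) (axis j 1)) (H u + X)"
      using Dw[OF z] F[OF u] by (simp add: z_def)
    finally have d2: "total_dx (jet_d (Some (1, i)) (?p j)) z = - B (K (axis i 1) (axis j 1)) (H u + X)" .
    \<comment> \<open>The Euler operator of \<open>?p j\<close> is evaluated in two ways, through
      the Helmholtz identity for \<open>h\<close> and from the order-one formula; the claim is their
      equality.\<close>
    have "var_deriv_b (?p j) i z = var_deriv_b (var_deriv_b h j) i z"
      by (rule var_deriv_b_cong[OF S _ z]) (simp add: p)
    also have "\<dots> = jet_d (Some (0, j)) (var_deriv_b h i) z"
      by (rule var_deriv_b_var_deriv_b[OF S h z])
    also have "\<dots> = jet_d (Some (0, j)) (?p i) z"
      by (rule jet_d_cong[OF S z p])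
    also have "var_deriv_b (?p j) i z = jet_d (Some (0, i)) (?p j) z - total_dx (jet_d (Some (1, i)) (?p j)) z"
      by (simp only: var_deriv_b_finite[OF S o1 z]) (simp add: One_nat_def)
    finally show ?thesis unfolding d0 d2 by simp
  qed
  have helm_u: "B (\<psi> u c) (H a) - B (K a c) (H u + X) - B (\<psi> u a) (H c) = 0" if u: "u \<in> U" for u a c
  proof -
    have z: "linear (\<lambda>y::real^'n. 0::real)" by (rule linear_zero)
    have l: "linear (\<lambda>y. B (\<psi> u y) v)" "linear (\<lambda>y. B v (H y))" "linear (\<lambda>y. B (K y v') v)" "linear (\<lambda>y. B (K v' y) v)" for v v'
      using lin_comp[OF \<psi>_lin bilinear_linear(2)[OF B_bil]] lin_comp[OF H bilinear_linear(1)[OF B_bil]]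
        lin_comp[OF bilinear_linear(2)[OF K_bil] bilinear_linear(2)[OF B_bil]]
        lin_comp[OF bilinear_linear(1)[OF K_bil] bilinear_linear(2)[OF B_bil]] by auto
    let ?F = "\<lambda>c a. B (\<psi> u c) (H a) - B (K a c) (H u + X) - B (\<psi> u a) (H c)"
    have a1: "?F c (axis i 1) = 0" for c i
      by (rule linear_eq_axis[of "\<lambda>c. ?F c (axis i 1)" "\<lambda>y. 0", OF _ z helm_axis[OF u]])
        (intro linear_compose_sub l)
    show ?thesis
      by (rule linear_eq_axis[of "\<lambda>a. ?F c a" "\<lambda>y. 0", OF _ z a1]) (intro linear_compose_sub l)
  qed
  \<comment> \<open>Separation of an identity affine in \<open>u\<close> once more. The first part
    is the component of the quadric relation with \<open>t\<close> and three
    \<open>b\<close>-directions; in the second, one of these is replaced by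
    \<open>x\<close>.\<close>
  have helm: "B (K y c) (H a) - B (K a c) (H y) - B (K y a) (H c) = 0"
    "B (\<omega> c) (H a) - B (K a c) X - B (\<omega> a) (H c) = 0" for y a c
  proof -
    let ?L = "\<lambda>y. B (K y c) (H a) - B (K a c) (H y) - B (K y a) (H c)"
    have l: "linear (\<lambda>y. B (K y v') v)" "linear (\<lambda>y. B v (H y))" for v v'
      using lin_comp[OF bilinear_linear(2)[OF K_bil] bilinear_linear(2)[OF B_bil]]
        lin_comp[OF H bilinear_linear(1)[OF B_bil]] by auto
    have L: "linear ?L" by (intro linear_compose_sub l)
    have "?L u + (B (\<omega> c) (H a) - B (K a c) X - B (\<omega> a) (H c)) = 0" if "u \<in> U" for u
      using helm_u[OF that, of c a] by (simp add: \<psi>_def B_simps)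
    from affine_vanishes_on_open[OF L U(1,3) this]
    show "?L y = 0" "B (\<omega> c) (H a) - B (K a c) X - B (\<omega> a) (H c) = 0" by auto
  qed

  \<comment> \<open>Assembly of the congruence\<close>
  define A1 where "A1 = extend_form K \<omega>"
  \<comment> \<open>The homogenised right-hand side, \<open>\<tau> (u, 1) = H u + X\<close>; the
    line condition becomes \<open>\<psi> u (V u - \<kappa>) = \<tau> (u, 1)\<close>.\<close>
  define \<tau> where "\<tau> Y = H (fst Y) + snd Y *\<^sub>R X" for Y :: "(real, 'n) vec \<times> real"
  define A2 where "A2 = extend_form A1 \<tau>"
  \<comment> \<open>The shear replaces \<open>V u\<close> by \<open>V u - \<kappa>\<close> in the
    vector \<open>((V u, 0), 1)\<close> and fixes all vectors without
    \<open>t\<close>-component.\<close>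
  define M :: "'n ambient \<Rightarrow> 'n ambient" where "M Z = ((fst (fst Z) - snd Z *\<^sub>R \<kappa>, snd (fst Z)), snd Z)" for Z
  define A where "A Y Z = A2 (M Y) (M Z)" for Y Z
  have A1_bil: "bilinear A1" unfolding A1_def by (rule bilinear_extend_form[OF K_bil \<omega>])
  have A1_skew: "A1 Y Z = - A1 Z Y" for Y Z unfolding A1_def by (rule extend_form_skew[OF K_skew])
  have A1_Q: "B (A1 x y) (A1 z t) - B (A1 x z) (A1 y t) + B (A1 x t) (A1 y z) = 0" for x y z t
    unfolding A1_def by (rule extend_form_quadric[OF B_bil B_sym cyc])
  have \<tau>_lin: "linear \<tau>"
    unfolding \<tau>_def by (rule linearI) (simp_all add: linear_add[OF H] linear_cmul[OF H] algebra_simps)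
  \<comment> \<open>Expanded in the \<open>x\<close>-components of the arguments, the parts of
    degree zero and one are the two identities \<open>helm\<close>, and the part of degree two
    cancels.\<close>
  have \<tau>_cyc: "B (\<tau> Y) (A1 Z T) - B (\<tau> Z) (A1 Y T) + B (\<tau> T) (A1 Y Z) = 0" for Y Z T
  proof -
    obtain y y' z z' t t' where e: "Y = (y, y')" "Z = (z, z')" "T = (t, t')" by (meson surj_pair)
    have ex: "B (\<tau> (a, a')) (A1 (b, b') (c, c')) = B (K b c) (H a) + b' * B (\<omega> c) (H a) - c' * B (\<omega> b) (H a)
       + a' * B (K b c) X + a' * b' * B (\<omega> c) X - a' * c' * B (\<omega> b) X" for a a' b b' c c'
      unfolding A1_def \<tau>_def extend_form_def B_sym[of "H _ + _ *\<^sub>R _"]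
      by (simp add: B_simps bilinear_lsub[OF B_bil] bilinear_rsub[OF B_bil] algebra_simps)
    have K1: "B (K z t) (H y) = - B (K t z) (H y)" and K2: "B (K z t) X = - B (K t z) X"
      and K3: "B (K y t) X = - B (K t y) X" and K4: "B (K y z) X = - B (K z y) X"
      using K_skew[of z t] K_skew[of y t] K_skew[of y z] by (simp_all add: B_simps)
    have "y' * (B (\<omega> z) (H t) - B (K t z) X - B (\<omega> t) (H z)) = 0"
      "z' * (B (\<omega> y) (H t) - B (K t y) X - B (\<omega> t) (H y)) = 0"
      "t' * (B (\<omega> y) (H z) - B (K z y) X - B (\<omega> z) (H y)) = 0" by (simp_all only: helm mult_zero_right)
    then show ?thesis using helm(1)[of y z t]
      unfolding e ex K1 K2 K3 K4
      by (simp only: distrib_left right_diff_distrib mult.assoc mult_minus_right mult.left_commute[of z' y']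
          mult.left_commute[of t' y'] mult.left_commute[of t' z']; linarith)
  qed
  have A2_bil: "bilinear A2" unfolding A2_def by (rule bilinear_extend_form[OF A1_bil \<tau>_lin])
  have A2_skew: "A2 Y Z = - A2 Z Y" for Y Z unfolding A2_def by (rule extend_form_skew[OF A1_skew])
  have A2_Q: "B (A2 x y) (A2 z t) - B (A2 x z) (A2 y t) + B (A2 x t) (A2 y z) = 0" for x y z t
    unfolding A2_def by (rule extend_form_quadric[OF B_bil B_sym A1_Q \<tau>_cyc])
  have M_lin: "linear M" unfolding M_def by (rule linearI) (simp_all add: algebra_simps)
  have A_frame: "A ((u, 1), 0) ((y, 0), 0) = \<psi> u y" for u y
    by (simp add: A_def M_def A2_def A1_def extend_form_def \<tau>_def \<psi>_def linear_0[OF H])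
  have A_line: "A ((u, 1), 0) ((V u, 0), 1) = 0" if "u \<in> U" for u
    using F[OF that]
    by (simp add: A_def M_def A2_def A1_def extend_form_def \<tau>_def \<psi>_def linear_0[OF \<omega>])
  have "linear_congruence_on U V A B"
    unfolding linear_congruence_on_def
  proof (intro conjI allI ballI impI)
    show "bilinear A"
      using lin_comp[OF M_lin bilinear_linear(1)[OF A2_bil]] lin_comp[OF M_lin bilinear_linear(2)[OF A2_bil]]
      unfolding bilinear_def A_def by auto
    show "A X Y = - A Y X" for X Y unfolding A_def by (rule A2_skew)
    show "B (A X Y) (A Z T) - B (A X Z) (A Y T) + B (A X T) (A Y Z) = 0" for X Y Z T
      unfolding A_def by (rule A2_Q)
    show "y = 0" if "u \<in> U" "A ((u, 1), 0) ((y, 0), 0) = 0" for u y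
      using metric_frame.inj[OF frame[OF that(1)]] that(2) A_frame by simp
  qed (use B_bil B_sym B_nondeg A_line in auto)
  then show ?thesis by (rule that)
qed

section \<open>Reciprocal transformations\<close>

context
  fixes U W :: "(real^'n::finite) set"
    and V \<sigma> :: "real^'n \<Rightarrow> real^'n"
    and \<alpha> \<beta> :: "real^'n" and a b c d :: real
  assumes U: "open U" and V: "smooth_on U V"
    and \<Delta>: "\<And>u. u \<in> U \<Longrightarrow> recip_delta \<alpha> \<beta> a b c d V u \<noteq> 0"
    and diffeo: "diffeomorphism_on U W (recip_u \<alpha> \<beta> a b c d V) \<sigma>"
    and ne: "U \<noteq> {}"
begin

abbreviation (input) "xu u \<equiv> \<alpha> \<bullet> u + a"
abbreviation (input) "xt u \<equiv> \<alpha> \<bullet> V u + b"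
abbreviation (input) "tu u \<equiv> \<beta> \<bullet> u + c"
abbreviation (input) "tt u \<equiv> \<beta> \<bullet> V u + d"
abbreviation (input) "del u \<equiv> recip_delta \<alpha> \<beta> a b c d V u"
abbreviation (input) "R u \<equiv> recip_u \<alpha> \<beta> a b c d V u"
abbreviation (input) "F u \<equiv> recip_flux \<alpha> \<beta> a b c d V u"

lemma recip_delta_eq: "del u = xu u * tt u - xt u * tu u"
  by (simp add: recip_delta_def)

lemma scaled_recip: "del u *\<^sub>R R u = tt u *\<^sub>R u - tu u *\<^sub>R V u" "del u *\<^sub>R F u = xu u *\<^sub>R V u - xt u *\<^sub>R u"
  if "u \<in> U"
  using \<Delta>[OF that] by (simp_all add: recip_u_def recip_flux_def)

text \<open>These are the coefficients of \<open>dx\<close> and \<open>dt\<close> in the defining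
  equality of 1-forms, after the new differentials have been expressed by the old ones.\<close>

lemma recip_decompose: "u = xu u *\<^sub>R R u + tu u *\<^sub>R F u" "V u = xt u *\<^sub>R R u + tt u *\<^sub>R F u" if u: "u \<in> U"
proof -
  have e: "x *\<^sub>R (t *\<^sub>R p - s *\<^sub>R q) + s *\<^sub>R (x *\<^sub>R q - y *\<^sub>R p) = (x * t - y * s) *\<^sub>R p"
    "y *\<^sub>R (t *\<^sub>R p - s *\<^sub>R q) + t *\<^sub>R (x *\<^sub>R q - y *\<^sub>R p) = (x * t - y * s) *\<^sub>R q"
    for x y s t and p q :: "real^'n"
    by (simp_all add: algebra_simps)
  have "del u *\<^sub>R (xu u *\<^sub>R R u + tu u *\<^sub>R F u) = del u *\<^sub>R u"
    unfolding scaleR_right_distrib scaleR_left_commute[of "del u"] unfolding scaled_recip[OF u]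
    unfolding e recip_delta_eq ..
  then show "u = xu u *\<^sub>R R u + tu u *\<^sub>R F u" using \<Delta>[OF u] by simp
  have "del u *\<^sub>R (xt u *\<^sub>R R u + tt u *\<^sub>R F u) = del u *\<^sub>R V u"
    unfolding scaleR_right_distrib scaleR_left_commute[of "del u"] unfolding scaled_recip[OF u]
    unfolding e recip_delta_eq ..
  then show "V u = xt u *\<^sub>R R u + tt u *\<^sub>R F u" using \<Delta>[OF u] by simp
qed

lemma inner_recip:
  assumes u: "u \<in> U"
  shows "del u * (\<gamma> \<bullet> R u) = tt u * (\<gamma> \<bullet> u) - tu u * (\<gamma> \<bullet> V u)" "del u * (\<gamma> \<bullet> F u) = xu u * (\<gamma> \<bullet> V u) - xt u * (\<gamma> \<bullet> u)"
  using arg_cong[OF scaled_recip(1)[OF u], of "inner \<gamma>"] arg_cong[OF scaled_recip(2)[OF u], of "inner \<gamma>"]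
  by (simp_all add: inner_diff_right)

lemma recip_inverse_maps: "u \<in> U \<Longrightarrow> \<sigma> (R u) = u" "w \<in> W \<Longrightarrow> R (\<sigma> w) = w" "u \<in> U \<Longrightarrow> R u \<in> W" "w \<in> W \<Longrightarrow> \<sigma> w \<in> U"
  and open_W: "open W" and smooth_recip_u: "smooth_on U (recip_u \<alpha> \<beta> a b c d V)" and smooth_\<sigma>: "smooth_on W \<sigma>"
  using diffeo by (auto simp: diffeomorphism_on_def homeomorphism_def)

text \<open>If \<open>ad = bc\<close>, then some nontrivial affine function vanishes on \<open>W\<close>, contradicting openness.\<close>

lemma recip_det_nonzero: "a * d - b * c \<noteq> 0"
proof
  assume 0: "a * d - b * c = 0"
  \<comment> \<open>A left null vector of the singular matrix with rows \<open>(a, b)\<close> and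
    \<open>(c, d)\<close>.\<close>
  obtain l m where lm: "l \<noteq> 0 \<or> m \<noteq> 0" "l * a + m * c = 0" "l * b + m * d = 0"
  proof (cases "a = 0 \<and> c = 0")
    case True
    show ?thesis
    proof (cases "b = 0 \<and> d = 0")
      case True
      with \<open>a = 0 \<and> c = 0\<close> show ?thesis by (intro that[of 1 0]) auto
    next
      case False
      with \<open>a = 0 \<and> c = 0\<close> show ?thesis by (intro that[of d "- b"]) auto
    qed
  next
    case False
    with 0 show ?thesis by (intro that[of c "- a"]) (auto simp: algebra_simps)
  qed
  \<comment> \<open>The combination of the two new differentials with weights \<open>l\<close> and
    \<open>m\<close> is \<gamma> applied to \<open>u dx + V dt\<close>, the constants having dropped
    out. Hence \<gamma> pairs to \<open>l\<close> with \<open>R u\<close> and to \<open>m\<close>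
    with \<open>F u\<close>. The first pairing is an affine relation on \<open>W\<close>; it forces
    \<gamma> and \<open>l\<close> to vanish, and the second then gives \<open>m = 0\<close>.\<close>
  define \<gamma> where "\<gamma> = l *\<^sub>R \<alpha> + m *\<^sub>R \<beta>"
  have gu: "\<gamma> \<bullet> u = l * xu u + m * tu u" "\<gamma> \<bullet> V u = l * xt u + m * tt u" for u
    using lm(2,3) by (simp_all add: \<gamma>_def inner_add_left algebra_simps)
  obtain u0 where u0: "u0 \<in> U" using ne by blast
  have "\<gamma> \<bullet> w + (- l) = 0" if w: "w \<in> W" for w
  proof -
    note u = recip_inverse_maps(4)[OF w]
    have "del (\<sigma> w) * (\<gamma> \<bullet> R (\<sigma> w)) = del (\<sigma> w) * l"
      unfolding inner_recip[OF u] gu[of "\<sigma> w"] unfolding recip_delta_eq by (simp add: algebra_simps)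
    then show ?thesis using \<Delta>[OF u] recip_inverse_maps(2)[OF w] by simp
  qed
  note zero = this
  have "linear (inner \<gamma>)" by (rule linearI) (simp_all add: inner_add_right)
  from affine_vanishes_on_open[OF this open_W recip_inverse_maps(3)[OF u0] zero]
  have \<gamma>: "\<gamma> \<bullet> y = 0" and "l = 0" for y by auto
  have "del u0 * (\<gamma> \<bullet> F u0) = del u0 * m"
    unfolding inner_recip[OF u0] gu[of u0] unfolding recip_delta_eq by (simp add: algebra_simps)
  then have "m = 0" using \<gamma> \<Delta>[OF u0] by simp
  with \<open>l = 0\<close> lm(1) show False by simp
qed

section \<open>Linearization of the transformation and its eigenvalues\<close>

definition d_V where "d_V u = frechet_derivative V (at u)"
definition d_recip where "d_recip u = frechet_derivative (recip_u \<alpha> \<beta> a b c d V) (at u)"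
definition d_flux where "d_flux u = frechet_derivative (recip_flux \<alpha> \<beta> a b c d V) (at u)"
definition d\<sigma> where "d\<sigma> w = frechet_derivative \<sigma> (at w)"
text \<open>The identity minus the two rank-one maps that arise in \<open>recip_decompose\<close>
  when the coefficients of \<open>R u\<close> and \<open>F u\<close> are differentiated.\<close>

definition moebius_map where "moebius_map u x = x - (\<alpha> \<bullet> x) *\<^sub>R R u - (\<beta> \<bullet> x) *\<^sub>R F u"

lemma smooth_on_inner_const: "smooth_on U f \<Longrightarrow> smooth_on U (\<lambda>u. k \<bullet> f u)"
  by (rule smooth_on_linear_comp[OF U bounded_linear_inner_right])

lemma smooth_recip_flux: "smooth_on U (recip_flux \<alpha> \<beta> a b c d V)"
proof -
  have id: "smooth_on U (\<lambda>u. u)" by (rule smooth_on_bounded_linear[OF bounded_linear_ident])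
  note s = smooth_on_add[OF U] smooth_on_diff[OF U] smooth_on_inner_const smooth_on_const
    smooth_on_mult[OF U] smooth_on_scaleR[OF U] id V
  have "smooth_on U (\<lambda>u. inverse (xu u * tt u - xt u * tu u) *\<^sub>R (xu u *\<^sub>R V u - xt u *\<^sub>R u))"
    by (intro s smooth_on_inverse[OF U]) (use \<Delta> in \<open>auto simp: recip_delta_def\<close>)
  then show ?thesis by (simp add: recip_flux_def[abs_def] recip_delta_def inverse_eq_divide)
qed

lemma recip_derivs:
  assumes "u \<in> U"
  shows "(V has_derivative d_V u) (at u)" "(recip_u \<alpha> \<beta> a b c d V has_derivative d_recip u) (at u)"
    "(recip_flux \<alpha> \<beta> a b c d V has_derivative d_flux u) (at u)"
  using smooth_on_imp_differentiable[OF V assms] smooth_on_imp_differentiable[OF smooth_recip_u assms]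
    smooth_on_imp_differentiable[OF smooth_recip_flux assms]
  by (simp_all add: frechet_derivative_works d_V_def d_recip_def d_flux_def)

lemma deriv_\<sigma>: "w \<in> W \<Longrightarrow> (\<sigma> has_derivative d\<sigma> w) (at w)"
  using smooth_on_imp_differentiable[OF smooth_\<sigma>] by (simp add: frechet_derivative_works d\<sigma>_def)

lemma has_derivative_unique_open:
  assumes "(f has_derivative D) (at u)" "(h has_derivative E) (at u)" "open S" "u \<in> S" "\<And>v. v \<in> S \<Longrightarrow> f v = h v"
  shows "D v = E v"
proof -
  have "(h has_derivative D) (at u)"
    by (rule has_derivative_transform_within_open[OF assms(1,3,4,5)])
  then show ?thesis using has_derivative_unique[OF _ assms(2)] by blast
qed

lemma recip_deriv_inverse:
  assumes u: "u \<in> U"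
  shows "d\<sigma> (R u) (d_recip u v) = v" "d_recip u (d\<sigma> (R u) y) = y"
proof -
  note w = recip_inverse_maps(3)[OF u]
  show "d\<sigma> (R u) (d_recip u v) = v"
    by (rule has_derivative_unique_open[OF has_derivative_compose[OF recip_derivs(2)[OF u] deriv_\<sigma>[OF w]] has_derivative_ident U u])
      (rule recip_inverse_maps(1))
  have "(recip_u \<alpha> \<beta> a b c d V has_derivative d_recip u) (at (\<sigma> (R u)))"
    using recip_derivs(2)[OF u] recip_inverse_maps(1)[OF u] by simp
  from has_derivative_compose[OF deriv_\<sigma>[OF w] this]
  show "d_recip u (d\<sigma> (R u) y) = y"
    by (rule has_derivative_unique_open[OF _ has_derivative_ident open_W w]) (rule recip_inverse_maps(2))
qed

lemma recip_linear_derivs: "u \<in> U \<Longrightarrow> linear (d_V u)" "u \<in> U \<Longrightarrow> linear (d_recip u)" "u \<in> U \<Longrightarrow> linear (d_flux u)"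
  using recip_derivs has_derivative_linear by blast+

lemma recip_deriv_decompose:
  assumes u: "u \<in> U"
  shows "moebius_map u v = xu u *\<^sub>R d_recip u v + tu u *\<^sub>R d_flux u v" "moebius_map u (d_V u v) = xt u *\<^sub>R d_recip u v + tt u *\<^sub>R d_flux u v"
proof -
  have i: "((\<lambda>u. \<gamma> \<bullet> u + k) has_derivative (\<lambda>v. \<gamma> \<bullet> v)) (at u)" for \<gamma> k and u :: "real^'n"
    by (auto intro!: derivative_eq_intros)
  have iV: "((\<lambda>u. \<gamma> \<bullet> V u + k) has_derivative (\<lambda>v. \<gamma> \<bullet> d_V u v)) (at u)" for \<gamma> k
    using recip_derivs(1)[OF u] by (auto intro!: derivative_eq_intros)
  have "v = (xu u *\<^sub>R d_recip u v + (\<alpha> \<bullet> v) *\<^sub>R R u) + (tu u *\<^sub>R d_flux u v + (\<beta> \<bullet> v) *\<^sub>R F u)"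
    by (rule has_derivative_unique_open[OF has_derivative_ident has_derivative_add[OF has_derivative_scaleR[OF i recip_derivs(2)[OF u]]
        has_derivative_scaleR[OF i recip_derivs(3)[OF u]]] U u]) (rule recip_decompose(1))
  then show "moebius_map u v = xu u *\<^sub>R d_recip u v + tu u *\<^sub>R d_flux u v" unfolding moebius_map_def by (simp add: algebra_simps)
  have "d_V u v = (xt u *\<^sub>R d_recip u v + (\<alpha> \<bullet> d_V u v) *\<^sub>R R u) + (tt u *\<^sub>R d_flux u v + (\<beta> \<bullet> d_V u v) *\<^sub>R F u)"
    by (rule has_derivative_unique_open[OF recip_derivs(1)[OF u] has_derivative_add[OF has_derivative_scaleR[OF iV recip_derivs(2)[OF u]]
        has_derivative_scaleR[OF iV recip_derivs(3)[OF u]]] U u]) (rule recip_decompose(2))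
  then show "moebius_map u (d_V u v) = xt u *\<^sub>R d_recip u v + tt u *\<^sub>R d_flux u v" unfolding moebius_map_def by (simp add: algebra_simps)
qed

lemma linear_moebius_map: "linear (moebius_map u)"
  unfolding moebius_map_def by (rule linearI) (simp_all add: inner_add_right algebra_simps)

text \<open>Up to signs off the diagonal, the right-hand sides are the entries of the matrix with
  rows \<open>(a, b)\<close>, \<open>(c, d)\<close> times the adjugate of the one with rows
  \<open>(xu u, xt u)\<close>, \<open>(tu u, tt u)\<close>, because
  \<open>\<alpha> \<bullet> u = xu u - a\<close> and similarly for the other products.\<close>

lemma inner_recip_special:
  assumes u: "u \<in> U"
  shows "del u * (1 - \<alpha> \<bullet> R u) = a * tt u - b * tu u" "del u * (\<beta> \<bullet> R u) = d * tu u - c * tt u"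
    "del u * (\<alpha> \<bullet> F u) = a * xt u - b * xu u" "del u * (1 - \<beta> \<bullet> F u) = d * xu u - c * xt u"
proof -
  show "del u * (1 - \<alpha> \<bullet> R u) = a * tt u - b * tu u"
    using inner_recip(1)[OF u, of \<alpha>] by (simp add: recip_delta_eq algebra_simps)
  show "del u * (\<beta> \<bullet> R u) = d * tu u - c * tt u"
    using inner_recip(1)[OF u, of \<beta>] by (simp add: recip_delta_eq algebra_simps)
  show "del u * (\<alpha> \<bullet> F u) = a * xt u - b * xu u"
    using inner_recip(2)[OF u, of \<alpha>] by (simp add: recip_delta_eq algebra_simps)
  show "del u * (1 - \<beta> \<bullet> F u) = d * xu u - c * xt u"
    using inner_recip(2)[OF u, of \<beta>] by (simp add: recip_delta_eq algebra_simps)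
qed

text \<open>The map is a rank-two perturbation of the identity, so its kernel lies in the span of
  \<open>R u\<close> and \<open>F u\<close> and is governed by a two-by-two matrix. By
  \<open>inner_recip_special\<close> the determinant of that matrix is
  \<open>(a * d - b * c) / del u\<close>.\<close>

lemma moebius_map_injective:
  assumes u: "u \<in> U" and x: "moebius_map u x = 0"
  shows "x = 0"
proof -
  define p q where "p = \<alpha> \<bullet> x" and "q = \<beta> \<bullet> x"
  define e11 e12 e21 e22 where "e11 = 1 - \<alpha> \<bullet> R u" and "e12 = \<alpha> \<bullet> F u" and "e21 = \<beta> \<bullet> R u" and "e22 = 1 - \<beta> \<bullet> F u"
  have xe: "x = p *\<^sub>R R u + q *\<^sub>R F u" using x by (simp add: moebius_map_def p_def q_def algebra_simps)
  have "p = p * (\<alpha> \<bullet> R u) + q * (\<alpha> \<bullet> F u)" "q = p * (\<beta> \<bullet> R u) + q * (\<beta> \<bullet> F u)"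
    using arg_cong[OF xe, of "inner \<alpha>"] arg_cong[OF xe, of "inner \<beta>"]
    unfolding inner_add_right inner_scaleR_right p_def[symmetric] q_def[symmetric] .
  then have e: "e11 * p - e12 * q = 0" "e22 * q - e21 * p = 0"
    by (simp_all add: e11_def e12_def e21_def e22_def algebra_simps)
  have "(del u * del u) * (e11 * e22 - e12 * e21) = (del u * e11) * (del u * e22) - (del u * e12) * (del u * e21)"
    by (simp add: algebra_simps)
  also have "\<dots> = (a * d - b * c) * del u"
    unfolding e11_def e12_def e21_def e22_def inner_recip_special[OF u]
    unfolding recip_delta_eq by (simp add: algebra_simps)
  finally have det: "e11 * e22 - e12 * e21 \<noteq> 0"
    using recip_det_nonzero \<Delta>[OF u] by auto
  have "(e11 * e22 - e12 * e21) * p = e22 * (e11 * p - e12 * q) + e12 * (e22 * q - e21 * p)"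
    "(e11 * e22 - e12 * e21) * q = e21 * (e11 * p - e12 * q) + e11 * (e22 * q - e21 * p)"
    by (simp_all add: algebra_simps)
  then have "(e11 * e22 - e12 * e21) * p = 0" "(e11 * e22 - e12 * e21) * q = 0"
    by (simp_all only: e mult_zero_right add_0_right)
  then have "p = 0" "q = 0" using det by simp_all
  then show ?thesis using xe by simp
qed

text \<open>An eigenvector \<open>v\<close> of \<open>d_V u\<close> stays characteristic, since
  \<open>d_flux u\<close> after the inverse of \<open>d_recip u\<close> is the new characteristic
  matrix; the eigenvalue undergoes a linear fractional transformation. Its denominator is nonzero
  because \<open>del u\<close> and \<open>d_recip u v\<close> are; in the inverse direction this
  follows from injectivity of \<open>moebius_map u\<close>.\<close>

lemma recip_eigenvectors:
  assumes u: "u \<in> U" and v: "v \<noteq> 0"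
  shows "d_V u v = l *\<^sub>R v \<Longrightarrow> tt u - l * tu u \<noteq> 0 \<and> d_flux u v = ((l * xu u - xt u) / (tt u - l * tu u)) *\<^sub>R d_recip u v"
    and "d_flux u v = m *\<^sub>R d_recip u v \<Longrightarrow> xu u + m * tu u \<noteq> 0 \<and> d_V u v = ((xt u + m * tt u) / (xu u + m * tu u)) *\<^sub>R v"
proof -
  have R0: "d_recip u v \<noteq> 0"
  proof
    assume "d_recip u v = 0"
    then have "d\<sigma> (R u) (d_recip u v) = 0" using deriv_\<sigma>[OF recip_inverse_maps(3)[OF u]] has_derivative_linear linear_0 by metis
    then show False using recip_deriv_inverse(1)[OF u] v by simp
  qed
  show "tt u - l * tu u \<noteq> 0 \<and> d_flux u v = ((l * xu u - xt u) / (tt u - l * tu u)) *\<^sub>R d_recip u v" if l: "d_V u v = l *\<^sub>R v"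
  proof -
    have "xt u *\<^sub>R d_recip u v + tt u *\<^sub>R d_flux u v = l *\<^sub>R (xu u *\<^sub>R d_recip u v + tu u *\<^sub>R d_flux u v)"
      using recip_deriv_decompose[OF u, of v] by (simp add: l linear_scale[OF linear_moebius_map])
    then have eq: "(l * xu u - xt u) *\<^sub>R d_recip u v = (tt u - l * tu u) *\<^sub>R d_flux u v"
      by (simp add: algebra_simps)
    have n0: "tt u - l * tu u \<noteq> 0"
    proof
      assume z: "tt u - l * tu u = 0"
      with eq R0 have z2: "l * xu u - xt u = 0" by simp
      have "del u = xu u * (tt u - l * tu u) + tu u * (l * xu u - xt u)" by (simp add: recip_delta_eq algebra_simps)
      then show False using z z2 \<Delta>[OF u] by simp
    qed
    have "d_flux u v = (1 / (tt u - l * tu u)) *\<^sub>R ((tt u - l * tu u) *\<^sub>R d_flux u v)" using n0 by simp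
    also have "\<dots> = ((l * xu u - xt u) / (tt u - l * tu u)) *\<^sub>R d_recip u v" unfolding eq[symmetric] by simp
    finally show ?thesis using n0 by blast
  qed
  show "xu u + m * tu u \<noteq> 0 \<and> d_V u v = ((xt u + m * tt u) / (xu u + m * tu u)) *\<^sub>R v" if m: "d_flux u v = m *\<^sub>R d_recip u v"
  proof -
    have e: "moebius_map u v = (xu u + m * tu u) *\<^sub>R d_recip u v" "moebius_map u (d_V u v) = (xt u + m * tt u) *\<^sub>R d_recip u v"
      using recip_deriv_decompose(1)[OF u, of v] recip_deriv_decompose(2)[OF u, of v] by (simp_all add: m algebra_simps)
    have n0: "xu u + m * tu u \<noteq> 0" using e(1) moebius_map_injective[OF u] v by force
    have "moebius_map u (d_V u v - ((xt u + m * tt u) / (xu u + m * tu u)) *\<^sub>R v) = 0"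
      using n0 by (simp add: linear_diff[OF linear_moebius_map] linear_scale[OF linear_moebius_map] e)
    from moebius_map_injective[OF u this] n0 show ?thesis by simp
  qed
qed

text \<open>The new spectrum is the image of the old one under a linear fractional map whose
  coefficient matrix has determinant \<open>del u\<close>. It is therefore injective and preserves
  the number of eigenvalues.\<close>

lemma strictly_hyperbolic_recip:
  assumes hyp: "strictly_hyperbolic_on U V"
  shows "strictly_hyperbolic_on W (recip_flux \<alpha> \<beta> a b c d V \<circ> \<sigma>)"
  unfolding strictly_hyperbolic_on_def
proof
  fix w assume w: "w \<in> W"
  define u where "u = \<sigma> w"
  have u: "u \<in> U" and Ru: "R u = w" using recip_inverse_maps(2,4)[OF w] by (simp_all add: u_def)
  have D: "((recip_flux \<alpha> \<beta> a b c d V \<circ> \<sigma>) has_derivative (\<lambda>y. d_flux u (d\<sigma> w y))) (at w)"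
    using has_derivative_compose[OF deriv_\<sigma>[OF w], of "recip_flux \<alpha> \<beta> a b c d V" "d_flux u"] recip_derivs(3)[OF u]
    by (simp add: u_def o_def)
  then have mF: "matrix (frechet_derivative (recip_flux \<alpha> \<beta> a b c d V \<circ> \<sigma>) (at w)) *v y = d_flux u (d\<sigma> w y)" for y
    using frechet_derivative_at[OF D] fun_cong[OF matrix_vector_mul(2)[OF has_derivative_linear[OF D]], of y] by simp
  have mV: "matrix (frechet_derivative V (at u)) *v v = d_V u v" for v
    using fun_cong[OF matrix_vector_mul(2)[OF recip_linear_derivs(1)[OF u]], of v] by (simp add: d_V_def)
  define E where "E = {l. \<exists>v. v \<noteq> 0 \<and> d_V u v = l *\<^sub>R v}"
  define N where "N = {l. \<exists>y. y \<noteq> 0 \<and> d_flux u (d\<sigma> w y) = l *\<^sub>R y}"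
  define f where "f l = (l * xu u - xt u) / (tt u - l * tu u)" for l
  have lin\<sigma>: "linear (d\<sigma> w)" using has_derivative_linear[OF deriv_\<sigma>[OF w]] .
  have N_iff: "m \<in> N \<longleftrightarrow> (\<exists>v. v \<noteq> 0 \<and> d_flux u v = m *\<^sub>R d_recip u v)" for m
  proof
    assume "m \<in> N"
    then obtain y where "y \<noteq> 0" "d_flux u (d\<sigma> w y) = m *\<^sub>R y" by (auto simp: N_def)
    moreover have "d_recip u (d\<sigma> w y) = y" using recip_deriv_inverse(2)[OF u] by (simp add: Ru)
    ultimately show "\<exists>v. v \<noteq> 0 \<and> d_flux u v = m *\<^sub>R d_recip u v"
      using linear_0[OF recip_linear_derivs(2)[OF u]] by metis
  next
    assume "\<exists>v. v \<noteq> 0 \<and> d_flux u v = m *\<^sub>R d_recip u v"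
    then obtain v where "v \<noteq> 0" "d_flux u v = m *\<^sub>R d_recip u v" by blast
    moreover have "d\<sigma> w (d_recip u v) = v" using recip_deriv_inverse(1)[OF u] by (simp add: Ru)
    ultimately show "m \<in> N" unfolding N_def using linear_0[OF lin\<sigma>] by (intro CollectI exI[of _ "d_recip u v"]) auto
  qed
  have nz: "tt u - l * tu u \<noteq> 0" if "l \<in> E" for l
    using that recip_eigenvectors(1)[OF u] by (auto simp: E_def)
  have "N = f ` E"
  proof (intro set_eqI iffI)
    fix m assume "m \<in> N"
    then obtain v where v: "v \<noteq> 0" "d_flux u v = m *\<^sub>R d_recip u v" using N_iff by blast
    define l where "l = (xt u + m * tt u) / (xu u + m * tu u)"
    have n0: "xu u + m * tu u \<noteq> 0" and l: "d_V u v = l *\<^sub>R v" using recip_eigenvectors(2)[OF u v] by (simp_all add: l_def)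
    have lE: "l \<in> E" using v(1) l by (auto simp: E_def)
    have "l * (xu u + m * tu u) = xt u + m * tt u" using n0 by (simp add: l_def)
    then have "l * xu u - xt u = m * (tt u - l * tu u)" by (simp add: algebra_simps)
    then have "m = f l" using nz[OF lE] by (simp add: f_def)
    with lE show "m \<in> f ` E" by blast
  next
    fix m assume "m \<in> f ` E"
    then obtain l v where lv: "m = f l" "v \<noteq> 0" "d_V u v = l *\<^sub>R v" by (auto simp: E_def)
    with recip_eigenvectors(1)[OF u lv(2,3)] show "m \<in> N" unfolding N_iff f_def by blast
  qed
  moreover have "inj_on f E"
  proof (rule inj_onI)
    fix l m assume lm: "l \<in> E" "m \<in> E" "f l = f m"
    then have "(l * xu u - xt u) * (tt u - m * tu u) = (m * xu u - xt u) * (tt u - l * tu u)"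
      using nz by (simp add: f_def frac_eq_eq)
    then have "(l - m) * del u = 0" by (simp add: recip_delta_eq algebra_simps)
    then show "l = m" using \<Delta>[OF u] by simp
  qed
  moreover have "card E = CARD('n)"
    using bspec[OF hyp[unfolded strictly_hyperbolic_on_def] u] unfolding mV E_def .
  ultimately show "card {l. \<exists>v. v \<noteq> 0 \<and> matrix (frechet_derivative (recip_flux \<alpha> \<beta> a b c d V \<circ> \<sigma>) (at w)) *v v = l *\<^sub>R v} = CARD('n)"
    unfolding mF N_def[symmetric] by (simp add: card_image)
qed

text \<open>Composition with a linear map preserves the algebraic identities, and the new plane is
  carried to the old one. What needs an argument is the frame condition, in which the new
  \<open>p\<close> is a combination of the old \<open>p\<close> and \<open>q\<close>.\<close>

lemma linear_congruence_recip:
  assumes cong: "linear_congruence_on U V A B"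
  obtains A' where "linear_congruence_on W (recip_flux \<alpha> \<beta> a b c d V \<circ> \<sigma>) A' B"
proof -
  have A_bil: "bilinear A" and A_skew: "A X Y = - A Y X" and B_bil: "bilinear B" and B_sym: "\<forall>v w. B v w = B w v"
    and B_nondeg: "\<forall>v. (\<forall>w. B w v = 0) \<longrightarrow> v = 0"
    and quadric: "B (A X Y) (A Z T) - B (A X Z) (A Y T) + B (A X T) (A Y Z) = 0"
    and line: "u \<in> U \<Longrightarrow> A ((u, 1), 0) ((V u, 0), 1) = 0"
    and frame_inj: "u \<in> U \<Longrightarrow> A ((u, 1), 0) ((y, 0), 0) = 0 \<Longrightarrow> y = 0" for X Y Z T u y
    using cong unfolding linear_congruence_on_def by blast+
  note A_simps = bilinear_ladd[OF A_bil] bilinear_radd[OF A_bil] bilinear_lsub[OF A_bil] bilinear_rsub[OF A_bil]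
    bilinear_lmul[OF A_bil] bilinear_rmul[OF A_bil]
  define D where "D = a * d - b * c"
  have D0: "D \<noteq> 0" using recip_det_nonzero by (simp add: D_def)
  \<comment> \<open>the inverse of the linear map \<open>(y, x, t) \<mapsto> (y, \<alpha> \<bullet> y + a x + b t, \<beta> \<bullet> y + c x + d t)\<close>\<close>
  define N :: "'n ambient \<Rightarrow> 'n ambient" where
    "N Z = ((fst (fst Z), (d * (snd (fst Z) - \<alpha> \<bullet> fst (fst Z)) - b * (snd Z - \<beta> \<bullet> fst (fst Z))) / D),
       (a * (snd Z - \<beta> \<bullet> fst (fst Z)) - c * (snd (fst Z) - \<alpha> \<bullet> fst (fst Z))) / D)" for Z
  have N_lin: "linear N"
    unfolding N_def by (rule linearI) (simp_all add: inner_add_right add_divide_distrib diff_divide_distrib algebra_simps)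
  define A' where "A' X Y = A (N X) (N Y)" for X Y
  define p where "p u = (((u, 1), 0) :: 'n ambient)" for u
  define q where "q u = (((V u, 0), 1) :: 'n ambient)" for u
  define vec where "vec y = (((y, 0), 0) :: 'n ambient)" for y
  have pp: "A X X = 0" for X
    unfolding vec_eq_iff
  proof
    fix i
    show "A X X $ i = 0 $ i" using arg_cong[OF A_skew[of X X], of "\<lambda>v. v $ i"] by simp
  qed
  have pq: "A (p u) (q u) = 0" "A (q u) (p u) = 0" if "u \<in> U" for u
    using line[OF that] A_skew[of "q u" "p u"] by (simp_all add: p_def q_def)
  \<comment> \<open>\<open>N\<close> undoes the linear change of \<open>(b, x, t)\<close>, so it
    sends the new tangent vectors into the old tangent plane; the coefficients are those of the
    inverse of the matrix with rows \<open>(xu u, xt u)\<close>, \<open>(tu u, tt u)\<close>,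
    multiplied by \<open>del u\<close>.\<close>
  have N_p: "del u *\<^sub>R N ((R u, 1), 0) = tt u *\<^sub>R p u - tu u *\<^sub>R q u"
    and N_q: "del u *\<^sub>R N ((F u, 0), 1) = xu u *\<^sub>R q u - xt u *\<^sub>R p u" if u: "u \<in> U" for u
  proof -
    have "D * tt u = d * (a * tt u - b * tu u) + b * (d * tu u - c * tt u)"
      "D * tu u = a * (d * tu u - c * tt u) + c * (a * tt u - b * tu u)"
      "D * xt u = d * (a * xt u - b * xu u) + b * (d * xu u - c * xt u)"
      "D * xu u = a * (d * xu u - c * xt u) + c * (a * xt u - b * xu u)"
      by (simp_all add: D_def algebra_simps)
    then have e: "D * tt u = d * (del u * (1 - \<alpha> \<bullet> R u)) + b * (del u * (\<beta> \<bullet> R u))"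
      "D * tu u = a * (del u * (\<beta> \<bullet> R u)) + c * (del u * (1 - \<alpha> \<bullet> R u))"
      "D * xt u = d * (del u * (\<alpha> \<bullet> F u)) + b * (del u * (1 - \<beta> \<bullet> F u))"
      "D * xu u = a * (del u * (1 - \<beta> \<bullet> F u)) + c * (del u * (\<alpha> \<bullet> F u))"
      by (simp_all only: inner_recip_special[OF u])
    have "tt u = del u * ((d * (1 - \<alpha> \<bullet> R u) + b * (\<beta> \<bullet> R u)) / D)"
      "- tu u = del u * ((- a * (\<beta> \<bullet> R u) - c * (1 - \<alpha> \<bullet> R u)) / D)"
      "- xt u = del u * ((- d * (\<alpha> \<bullet> F u) - b * (1 - \<beta> \<bullet> F u)) / D)"
      "xu u = del u * ((a * (1 - \<beta> \<bullet> F u) + c * (\<alpha> \<bullet> F u)) / D)"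
      using D0 e by (simp_all add: field_simps)
    then show "del u *\<^sub>R N ((R u, 1), 0) = tt u *\<^sub>R p u - tu u *\<^sub>R q u" "del u *\<^sub>R N ((F u, 0), 1) = xu u *\<^sub>R q u - xt u *\<^sub>R p u"
      using scaled_recip[OF u] by (simp_all add: N_def p_def q_def)
  qed
  have line': "A' ((R u, 1), 0) ((F u, 0), 1) = 0" if u: "u \<in> U" for u
  proof -
    have "(del u * del u) *\<^sub>R A' ((R u, 1), 0) ((F u, 0), 1) = A (del u *\<^sub>R N ((R u, 1), 0)) (del u *\<^sub>R N ((F u, 0), 1))"
      by (simp add: A'_def A_simps)
    also have "\<dots> = 0" unfolding N_p[OF u] N_q[OF u] by (simp add: A_simps pp pq[OF u])
    finally show ?thesis using \<Delta>[OF u] by simp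
  qed
  have frame': "y = 0" if u: "u \<in> U" and y: "A' ((R u, 1), 0) ((y, 0), 0) = 0" for u y
  proof -
    \<comment> \<open>The \<open>x\<close>- and \<open>t\<close>-components of
      \<open>N ((y, 0), 0)\<close>; subtracting \<open>s\<close> times \<open>p\<close> and
      \<open>t\<close> times \<open>q\<close> leaves a vector \<open>z\<close> of the
      \<open>b\<close>-space, and \<open>A\<close> with arguments in the plane does not see the part
      subtracted.\<close>
    define s t where "s = (b * (\<beta> \<bullet> y) - d * (\<alpha> \<bullet> y)) / D" and "t = (c * (\<alpha> \<bullet> y) - a * (\<beta> \<bullet> y)) / D"
    define z where "z = y - s *\<^sub>R u - t *\<^sub>R V u"
    have Ny: "N ((y, 0), 0) = vec z + s *\<^sub>R p u + t *\<^sub>R q u"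
      by (simp add: N_def s_def t_def vec_def z_def p_def q_def algebra_simps)
    have "0 = A (del u *\<^sub>R N ((R u, 1), 0)) (N ((y, 0), 0))"
      using y by (simp add: A'_def A_simps)
    also have "\<dots> = tt u *\<^sub>R A (p u) (vec z) - tu u *\<^sub>R A (q u) (vec z)"
      unfolding N_p[OF u] Ny by (simp add: A_simps pp pq[OF u])
    finally have 1: "tt u *\<^sub>R A (p u) (vec z) = tu u *\<^sub>R A (q u) (vec z)" by simp
    \<comment> \<open>The derivative of \<open>A(p, q) = 0\<close> in the direction
      \<open>z\<close>. It converts the pairing with \<open>q\<close> into one with
      \<open>p\<close>, to which the injectivity of the old frame applies.\<close>
    have 2: "A (q u) (vec z) = A (p u) (vec (d_V u z))"
    proof -
      have bb: "bounded_bilinear A" using A_bil by (simp add: bilinear_conv_bounded_bilinear)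
      have l: "bounded_linear vec"
        unfolding linear_conv_bounded_linear[symmetric] vec_def by (rule linearI) simp_all
      have pe: "p = (\<lambda>u. vec u + ((0, 1), 0))" and qe: "q = (\<lambda>u. vec (V u) + ((0, 0), 1))"
        by (simp_all add: fun_eq_iff p_def q_def vec_def)
      have dp: "(p has_derivative vec) (at u)"
        unfolding pe using bounded_linear_imp_has_derivative[OF l] by (rule has_derivative_add_const)
      have dq: "(q has_derivative (\<lambda>v. vec (d_V u v))) (at u)"
        unfolding qe using bounded_linear.has_derivative[OF l recip_derivs(1)[OF u]] by (rule has_derivative_add_const)
      have "A (p u) (vec (d_V u z)) + A (vec z) (q u) = 0"
        by (rule has_derivative_unique_open[OF bounded_bilinear.FDERIV[OF bb dp dq] has_derivative_const U u pq(1)])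
      then have "A (p u) (vec (d_V u z)) = - A (vec z) (q u)" by (rule eq_neg_iff_add_eq_0[THEN iffD2])
      then show ?thesis by (simp only: A_skew[of "q u" "vec z"])
    qed
    have "A (p u) (vec (tt u *\<^sub>R z - tu u *\<^sub>R d_V u z)) = tt u *\<^sub>R A (p u) (vec z) - tu u *\<^sub>R A (p u) (vec (d_V u z))"
    proof -
      have "vec (tt u *\<^sub>R z - tu u *\<^sub>R d_V u z) = tt u *\<^sub>R vec z - tu u *\<^sub>R vec (d_V u z)" by (simp add: vec_def)
      then show ?thesis by (simp only: A_simps)
    qed
    also have "\<dots> = 0" by (simp only: 1 2 diff_self)
    finally have 3: "tt u *\<^sub>R z - tu u *\<^sub>R d_V u z = 0"
      by (rule frame_inj[OF u, folded p_def vec_def])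
    \<comment> \<open>Eliminating \<open>d_flux u z\<close> from the two linearized decompositions
      identifies the vector just shown to vanish, up to \<open>moebius_map u\<close>, with a
      multiple of \<open>d_recip u z\<close>. The local diffeomorphism property then gives
      \<open>z = 0\<close>.\<close>
    have "del u *\<^sub>R d_recip u z = tt u *\<^sub>R (xu u *\<^sub>R d_recip u z + tu u *\<^sub>R d_flux u z) - tu u *\<^sub>R (xt u *\<^sub>R d_recip u z + tt u *\<^sub>R d_flux u z)"
      by (simp only: recip_delta_eq) (simp add: algebra_simps)
    also have "\<dots> = moebius_map u (tt u *\<^sub>R z - tu u *\<^sub>R d_V u z)"
      unfolding recip_deriv_decompose[OF u, symmetric] by (simp only: linear_diff[OF linear_moebius_map] linear_scale[OF linear_moebius_map])
    also have "\<dots> = 0" unfolding 3 by (rule linear_0[OF linear_moebius_map])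
    finally have "d_recip u z = 0" using \<Delta>[OF u] by simp
    then have "z = 0"
      using recip_deriv_inverse(1)[OF u, of z] linear_0[OF has_derivative_linear[OF deriv_\<sigma>[OF recip_inverse_maps(3)[OF u]]]] by simp
    then have yz: "y = s *\<^sub>R u + t *\<^sub>R V u" by (simp add: z_def algebra_simps)
    \<comment> \<open>Now \<open>y\<close> lies in the span of \<open>u\<close> and
      \<open>V u\<close>. Comparing its products with \<alpha> and \<beta> with those encoded in
      \<open>s\<close> and \<open>t\<close> gives a homogeneous system for \<open>s\<close>,
      \<open>t\<close> of determinant \<open>del u\<close>.\<close>
    have "\<alpha> \<bullet> y = s * (\<alpha> \<bullet> u) + t * (\<alpha> \<bullet> V u)" "\<beta> \<bullet> y = s * (\<beta> \<bullet> u) + t * (\<beta> \<bullet> V u)"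
      using arg_cong[OF yz, of "inner \<alpha>"] arg_cong[OF yz, of "inner \<beta>"] by (simp_all add: inner_add_right)
    moreover have "\<alpha> \<bullet> y = - (a * s + b * t)" "\<beta> \<bullet> y = - (c * s + d * t)"
    proof -
      have "D * (a * s + b * t) = a * (D * s) + b * (D * t)" "D * (c * s + d * t) = c * (D * s) + d * (D * t)"
        by (simp_all add: algebra_simps)
      moreover have "D * s = b * (\<beta> \<bullet> y) - d * (\<alpha> \<bullet> y)" "D * t = c * (\<alpha> \<bullet> y) - a * (\<beta> \<bullet> y)"
        using D0 by (simp_all add: s_def t_def)
      ultimately have "D * (a * s + b * t) = D * - (\<alpha> \<bullet> y)" "D * (c * s + d * t) = D * - (\<beta> \<bullet> y)"
        by (simp_all only: D_def) (simp_all add: algebra_simps)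
      then have "a * s + b * t = - (\<alpha> \<bullet> y)" "c * s + d * t = - (\<beta> \<bullet> y)"
        by (simp_all only: mult_left_cancel[OF D0])
      then show "\<alpha> \<bullet> y = - (a * s + b * t)" "\<beta> \<bullet> y = - (c * s + d * t)" by simp_all
    qed
    ultimately have st: "s * xu u + t * xt u = 0" "s * tu u + t * tt u = 0" by (simp_all add: algebra_simps)
    have "s * del u = tt u * (s * xu u + t * xt u) - xt u * (s * tu u + t * tt u)"
      "t * del u = xu u * (s * tu u + t * tt u) - tu u * (s * xu u + t * xt u)"
      by (simp_all add: recip_delta_eq algebra_simps)
    then have "s * del u = 0" "t * del u = 0" by (simp_all only: st mult_zero_right diff_self)
    then have "s = 0" "t = 0" using \<Delta>[OF u] by simp_all
    then show "y = 0" by (simp add: yz)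
  qed
  have "linear_congruence_on W (recip_flux \<alpha> \<beta> a b c d V \<circ> \<sigma>) A' B"
    unfolding linear_congruence_on_def
  proof (intro conjI)
    show "bilinear A'"
      using linear_compose[OF N_lin bilinear_linear(1)[OF A_bil]] linear_compose[OF N_lin bilinear_linear(2)[OF A_bil]]
      unfolding bilinear_def A'_def o_def by blast
    show "\<forall>X Y. A' X Y = - A' Y X" unfolding A'_def using A_skew by blast
    show "\<forall>X Y Z T. B (A' X Y) (A' Z T) - B (A' X Z) (A' Y T) + B (A' X T) (A' Y Z) = 0"
      unfolding A'_def using quadric by blast
    show "\<forall>w\<in>W. A' ((w, 1), 0) (((recip_flux \<alpha> \<beta> a b c d V \<circ> \<sigma>) w, 0), 1) = 0"
      using line'[OF recip_inverse_maps(4)] recip_inverse_maps(2) by simp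
    show "\<forall>w\<in>W. \<forall>y. A' ((w, 1), 0) ((y, 0), 0) = 0 \<longrightarrow> y = 0"
      using frame'[OF recip_inverse_maps(4)] recip_inverse_maps(2) by simp
  qed (use B_bil B_sym B_nondeg in auto)
  then show ?thesis by (rule that)
qed

end

theorem theorem4:
  fixes U W :: "(real^'n::finite) set"
    and V \<sigma> :: "real^'n \<Rightarrow> real^'n"
    and g :: "real^'n \<Rightarrow> real^'n^'n" and \<Gamma> :: "real^'n \<Rightarrow> real^'n^'n^'n"
    and \<alpha> \<beta> :: "real^'n" and a b c d :: real
  assumes "open U" and "connected U" and "smooth_on U V"
    and "strictly_hyperbolic_on U V"
    and "third_order_hamiltonian_operator U g \<Gamma>"
    and "hamiltonian_system_wrt U V g \<Gamma>"
    and "\<And>u. u \<in> U \<Longrightarrow> recip_delta \<alpha> \<beta> a b c d V u \<noteq> 0"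
    and "diffeomorphism_on U W (recip_u \<alpha> \<beta> a b c d V) \<sigma>"
  shows "strictly_hyperbolic_on W (recip_flux \<alpha> \<beta> a b c d V \<circ> \<sigma>) \<and>
    (\<exists>g' \<Gamma>'. third_order_hamiltonian_operator W g' \<Gamma>' \<and>
      hamiltonian_system_wrt W (recip_flux \<alpha> \<beta> a b c d V \<circ> \<sigma>) g' \<Gamma>')"
proof -
  have W: "open W" using assms(8) by (simp add: diffeomorphism_on_def)
  have "strictly_hyperbolic_on W (recip_flux \<alpha> \<beta> a b c d V \<circ> \<sigma>) \<and>
    (\<exists>A B. linear_congruence_on W (recip_flux \<alpha> \<beta> a b c d V \<circ> \<sigma>) A B)"
  proof (cases "U = {}")
    \<comment> \<open>On the empty set the congruence asks nothing of \<open>V\<close>, and the zero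
      form with the standard inner product is one. The other case can use a base point in
      \<open>U\<close>.\<close>
    case True
    then have "W = {}" using assms(8) by (auto simp: diffeomorphism_on_def homeomorphism_def)
    moreover have "linear_congruence_on {} (recip_flux \<alpha> \<beta> a b c d V \<circ> \<sigma>) (\<lambda>X Y. 0) inner"
    proof -
      have "bilinear (\<lambda>X Y :: 'n ambient. 0 :: real^'n)" by (simp add: bilinear_def linear_zero)
      moreover have "bilinear (inner :: real^'n \<Rightarrow> _)"
        by (simp add: bilinear_conv_bounded_bilinear bounded_bilinear_inner)
      moreover have "\<forall>v::real^'n. (\<forall>w. w \<bullet> v = 0) \<longrightarrow> v = 0" using inner_eq_zero_iff by blast
      ultimately show ?thesis by (simp add: linear_congruence_on_def inner_commute)
    qed
    ultimately show ?thesis by (auto simp: strictly_hyperbolic_on_def)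
  next
    case False
    then obtain u0 where u0: "u0 \<in> U" by blast
    obtain A B where AB: "linear_congruence_on U V A B"
      by (rule linear_congruence_of_hamiltonian_system[OF assms(1,2) u0 assms(3,5,6)])
    obtain A' where "linear_congruence_on W (recip_flux \<alpha> \<beta> a b c d V \<circ> \<sigma>) A' B"
      by (rule linear_congruence_recip[OF assms(1,3,7,8) False AB])
    then show ?thesis using strictly_hyperbolic_recip[OF assms(1,3,7,8) False assms(4)] by blast
  qed
  then obtain A B where "strictly_hyperbolic_on W (recip_flux \<alpha> \<beta> a b c d V \<circ> \<sigma>)"
    "linear_congruence_on W (recip_flux \<alpha> \<beta> a b c d V \<circ> \<sigma>) A B" by blast
  then show ?thesis
    using third_order_hamiltonian_operator_congruence[OF W] hamiltonian_system_congruence[OF W] by blast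
qed

end
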